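(* Let $n\geqslant 1$ and let $(u(a),0)$, that is, $(u_1,\ldots,u_n,v_1,\ldots,v_n)$ with $v_1=\ldots=v_n=0$, be a solution of the Garnier system $\mathcal G_n(\theta)$ whose parameters $\theta=(\theta_1,\ldots,\theta_{n+2},\theta_\infty)\in\mathbb C^{n+3}$ satisfy $\sum_{i=1}^{n+2}\theta_i-1=\theta_\infty$ or $\sum_{i=1}^{n+2}\theta_i-1=-\theta_\infty$. For $i=1,\ldots,n$ let $F_i$ be the meromorphic function on $Z'$ extending $\sigma_i(u_1(a),\ldots,u_n(a))$, where $\sigma_i$ is the $i$-th elementary symmetric polynomial. Then, for each $i=1,\ldots,n$, the polar locus of $F_i$ is an analytic submanifold of $Z'$ and $(F_i)_\infty=-1$ (i.e. every irreducible component of the polar locus has order $-1$).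
   Context: **Spaces.** $B=(\mathbb C\setminus\{0,1\})^n\setminus\bigcup_{i\neq j}\{a_i=a_j\}$, with coordinates $a=(a_1,\ldots,a_n)$, and $Z'$ is the universal cover of $B$. Put $a_{n+1}=0$, $a_{n+2}=1$. **Garnier system.** $\mathcal G_n(\theta)$ is the completely integrable Hamiltonian system $$\frac{\partial u_i}{\partial a_j}=\frac{\partial H_j}{\partial v_i},\qquad \frac{\partial v_i}{\partial a_j}=-\frac{\partial H_j}{\partial u_i},\qquad i,j=1,\ldots,n,$$ with Hamiltonians (rational in $a,u,v,\theta$) $$H_i=M_i\sum_{k=1}^n M^{k,i}\Bigl(v_k^2-\sum_{m=1}^{n+2}\frac{\theta_m-\delta_{im}}{u_k-a_m}\,v_k+\frac{\varkappa}{u_k(u_k-1)}\Bigr),\qquad \varkappa=\tfrac14\Bigl(\bigl(\sum_{m=1}^{n+2}\theta_m-1\bigr)^2-\theta_\infty^2\Bigr),$$ $$M_i=-\frac{(a_i-u_1)\cdots(a_i-u_n)}{\prod_{j=1,j\ne i}^{n+2}(a_i-a_j)},\qquad M^{k,i}=\frac{u_k(u_k-1)(u_k-a_1)\cdots(u_k-a_n)}{(u_k-a_i)\prod_{j=1,j\ne k}^n(u_k-u_j)},$$ where $\delta_{im}$ is the Kronecker delta. A solution is a local solution near some point of $B$. By Garnier's theorem (a known result), for any local solution the functions $\sigma_i(u_1(a),\ldots,u_n(a))$, $i=1,\ldots,n$, extend to meromorphic functions $F_i$ on $Z'$. **Polar loci and orders.** A meromorphic function $f$ on $Z'$ is holomorphic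 outside its polar locus $P$ and near every point of $P$ is a quotient $\varphi/\psi$ of holomorphic functions, $f$ not extending holomorphically to $P$; $P$ is empty or an analytic subset of codimension one. The order of an irreducible component of $P$ is minus the exponent of the corresponding irreducible factor of $\psi$ (for $\varphi/\psi$ in lowest terms), so it is a negative integer. $(f)_\infty$ denotes the integer-valued function on the regular points of $P$ equal to the order of the irreducible component containing the point (the assertion $(f)_\infty=-1$ is vacuous if $P$ is empty). *)

theory Defs
  imports "HOL-Analysis.Analysis"
begin

definition coord_upd :: "complex ^ 'n \<Rightarrow> 'n \<Rightarrow> complex \<Rightarrow> complex ^ 'n" where
  "coord_upd x j w = (\<chi> l. if l = j then w else x $ l)"

definition cvec_holomorphic :: "(complex ^ 'n \<Rightarrow> complex) \<Rightarrow> (complex ^ 'n) set \<Rightarrow> bool" where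
  "cvec_holomorphic f S \<longleftrightarrow>
     (\<forall>x\<in>S. \<exists>D. (f has_derivative D) (at x) \<and> (\<forall>c h. D (c *s h) = c * D h))"

definition elem_sym :: "nat \<Rightarrow> complex ^ 'n \<Rightarrow> complex" where
  "elem_sym i u = (\<Sum>S | S \<subseteq> (UNIV :: 'n set) \<and> card S = i. \<Prod>k\<in>S. u $ k)"

text \<open>
  The number of variables is \<open>n = CARD('n)\<close>. The index set \<open>{1, \<dots>, n + 2}\<close> of the points
  \<open>a\<^sub>m\<close> and of the parameters \<open>\<theta>\<^sub>m\<close> is rendered as the type \<open>'n + bool\<close>: \<open>Inl i\<close> is the index
  \<open>i \<le> n\<close>, \<open>Inr False\<close> is \<open>n + 1\<close> and \<open>Inr True\<close> is \<open>n + 2\<close>.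
\<close>

definition sing_pt :: "complex ^ 'n \<Rightarrow> 'n + bool \<Rightarrow> complex" where
  "sing_pt a m = (case m of Inl i \<Rightarrow> a $ i | Inr b \<Rightarrow> (if b then 1 else 0))"

definition garnier_base :: "(complex ^ 'n) set" where
  "garnier_base = {a. (\<forall>i. a $ i \<notin> {0, 1}) \<and> (\<forall>i j. i \<noteq> j \<longrightarrow> a $ i \<noteq> a $ j)}"

definition garnier_M :: "complex ^ 'n \<Rightarrow> complex ^ 'n \<Rightarrow> 'n \<Rightarrow> complex" where
  "garnier_M a u i =
     - ((\<Prod>k\<in>UNIV. a $ i - u $ k) / (\<Prod>m\<in>UNIV - {Inl i}. a $ i - sing_pt a m))"

definition garnier_MM :: "complex ^ 'n \<Rightarrow> complex ^ 'n \<Rightarrow> 'n \<Rightarrow> 'n \<Rightarrow> complex" where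
  "garnier_MM a u k i =
     (u $ k * (u $ k - 1) * (\<Prod>l\<in>UNIV. u $ k - a $ l)) /
     ((u $ k - a $ i) * (\<Prod>j\<in>UNIV - {k}. u $ k - u $ j))"

definition garnier_kappa :: "('n::finite + bool \<Rightarrow> complex) \<Rightarrow> complex \<Rightarrow> complex" where
  "garnier_kappa \<theta> \<theta>inf = (1 / 4) * (((\<Sum>m\<in>UNIV. \<theta> m) - 1)\<^sup>2 - \<theta>inf\<^sup>2)"

definition garnier_H_expr ::
    "('n + bool \<Rightarrow> complex) \<Rightarrow> complex \<Rightarrow> 'n
      \<Rightarrow> (complex ^ 'n) \<times> (complex ^ 'n) \<times> (complex ^ 'n) \<Rightarrow> complex" where
  "garnier_H_expr \<theta> \<theta>inf i = (\<lambda>(a, u, v).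
     garnier_M a u i *
     (\<Sum>k\<in>UNIV. garnier_MM a u k i *
        ((v $ k)\<^sup>2
         - (\<Sum>m\<in>UNIV. (\<theta> m - (if m = Inl i then 1 else 0)) / (u $ k - sing_pt a m)) * v $ k
         + garnier_kappa \<theta> \<theta>inf / (u $ k * (u $ k - 1)))))"

definition garnier_generic :: "((complex ^ 'n) \<times> (complex ^ 'n) \<times> (complex ^ 'n)) set" where
  "garnier_generic = {(a, u, v). a \<in> garnier_base \<and>
     (\<forall>k m. u $ k \<noteq> sing_pt a m) \<and> (\<forall>k j. k \<noteq> j \<longrightarrow> u $ k \<noteq> u $ j)}"

text \<open>
  \<open>garnier_H_expr\<close> has zero denominators (hence, by the convention \<open>x / 0 = 0\<close>, wrong values)
  where \<open>u\<^sub>k = a\<^sub>m\<close>, although the corresponding factors cancel in the product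
  \<open>M\<^sub>i M\<^sup>k\<^sup>,\<^sup>i (\<dots>)\<close> and the rational function \<open>H\<^sub>i\<close> is regular there. The value of the rational
  function is recovered as a limit from the dense open set on which every denominator of the
  expression is nonzero. Over \<open>garnier_base\<close> the polar set of the Hamiltonians consists of the
  diagonals \<open>u\<^sub>k = u\<^sub>j\<close> only, which is why solutions are required to avoid exactly these.
\<close>

definition garnier_H ::
    "('n + bool \<Rightarrow> complex) \<Rightarrow> complex \<Rightarrow> 'n
      \<Rightarrow> (complex ^ 'n) \<times> (complex ^ 'n) \<times> (complex ^ 'n) \<Rightarrow> complex" where
  "garnier_H \<theta> \<theta>inf i x = Lim (at x within garnier_generic) (garnier_H_expr \<theta> \<theta>inf i)"

definition garnier_solution ::
    "('n + bool \<Rightarrow> complex) \<Rightarrow> complex \<Rightarrow> (complex ^ 'n) set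
      \<Rightarrow> (complex ^ 'n \<Rightarrow> complex ^ 'n) \<Rightarrow> (complex ^ 'n \<Rightarrow> complex ^ 'n) \<Rightarrow> bool" where
  "garnier_solution \<theta> \<theta>inf D u v \<longleftrightarrow>
     open D \<and> D \<subseteq> garnier_base \<and>
     (\<forall>i. cvec_holomorphic (\<lambda>a. u a $ i) D) \<and>
     (\<forall>i. cvec_holomorphic (\<lambda>a. v a $ i) D) \<and>
     (\<forall>a\<in>D. \<forall>k j. k \<noteq> j \<longrightarrow> u a $ k \<noteq> u a $ j) \<and>
     (\<forall>a\<in>D. \<forall>i j.
        ((\<lambda>w. u (coord_upd a j w) $ i) has_field_derivative
           deriv (\<lambda>w. garnier_H \<theta> \<theta>inf j (a, u a, coord_upd (v a) i w)) (v a $ i)) (at (a $ j)) \<and>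
        ((\<lambda>w. v (coord_upd a j w) $ i) has_field_derivative
           - deriv (\<lambda>w. garnier_H \<theta> \<theta>inf j (a, coord_upd (u a) i w, v a)) (u a $ i)) (at (a $ j)))"

text \<open>A simply connected set in the library's sense is in particular path-connected.\<close>

definition universal_cover ::
    "'z::topological_space set \<Rightarrow> ('z \<Rightarrow> 'b) \<Rightarrow> 'b::topological_space set \<Rightarrow> bool" where
  "universal_cover Z p S \<longleftrightarrow> covering_space Z p S \<and> simply_connected Z"

abbreviation nbhd_in :: "'z::topological_space set \<Rightarrow> 'z \<Rightarrow> 'z set \<Rightarrow> bool" where
  "nbhd_in Z z W \<equiv> openin (top_of_set Z) W \<and> z \<in> W"

text \<open>
  The charts of the complex structure on the cover \<open>Z\<close> are the restrictions of \<open>p\<close> to open sets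
  on which \<open>p\<close> is a homeomorphism onto an open subset of \<open>\<complex>\<^sup>n\<close>; \<open>q\<close> is the inverse of the chart.
\<close>

definition cover_chart ::
    "'z::topological_space set \<Rightarrow> ('z \<Rightarrow> complex ^ 'n) \<Rightarrow> 'z set \<Rightarrow> (complex ^ 'n \<Rightarrow> 'z) \<Rightarrow> bool" where
  "cover_chart Z p V q \<longleftrightarrow>
     openin (top_of_set Z) V \<and> open (p ` V) \<and> homeomorphism V (p ` V) p q"

definition cover_holomorphic ::
    "'z::topological_space set \<Rightarrow> ('z \<Rightarrow> complex ^ 'n) \<Rightarrow> ('z \<Rightarrow> complex) \<Rightarrow> 'z set \<Rightarrow> bool" where
  "cover_holomorphic Z p f W \<longleftrightarrow>
     (\<forall>z\<in>W. \<exists>V q. cover_chart Z p V q \<and> z \<in> V \<and> V \<subseteq> W \<and> cvec_holomorphic (f \<circ> q) (p ` V))"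

text \<open>
  Germs at \<open>z\<close> are represented by functions on the whole type that are holomorphic near \<open>z\<close>.
  A germ is a unit of the local ring at \<open>z\<close> iff its value at \<open>z\<close> is nonzero.
\<close>

definition hol_germ ::
    "'z::topological_space set \<Rightarrow> ('z \<Rightarrow> complex ^ 'n) \<Rightarrow> 'z \<Rightarrow> ('z \<Rightarrow> complex) \<Rightarrow> bool" where
  "hol_germ Z p z f \<longleftrightarrow> (\<exists>W. nbhd_in Z z W \<and> cover_holomorphic Z p f W)"

definition germ_eq ::
    "'z::topological_space set \<Rightarrow> 'z \<Rightarrow> ('z \<Rightarrow> complex) \<Rightarrow> ('z \<Rightarrow> complex) \<Rightarrow> bool" where
  "germ_eq Z z f g \<longleftrightarrow> (\<exists>W. nbhd_in Z z W \<and> (\<forall>w\<in>W. f w = g w))"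

definition germ_dvd ::
    "'z::topological_space set \<Rightarrow> ('z \<Rightarrow> complex ^ 'n) \<Rightarrow> 'z
      \<Rightarrow> ('z \<Rightarrow> complex) \<Rightarrow> ('z \<Rightarrow> complex) \<Rightarrow> bool" where
  "germ_dvd Z p z g f \<longleftrightarrow> (\<exists>h. hol_germ Z p z h \<and> germ_eq Z z f (\<lambda>w. g w * h w))"

definition germ_coprime ::
    "'z::topological_space set \<Rightarrow> ('z \<Rightarrow> complex ^ 'n) \<Rightarrow> 'z
      \<Rightarrow> ('z \<Rightarrow> complex) \<Rightarrow> ('z \<Rightarrow> complex) \<Rightarrow> bool" where
  "germ_coprime Z p z f g \<longleftrightarrow>
     (\<forall>h. hol_germ Z p z h \<and> germ_dvd Z p z h f \<and> germ_dvd Z p z h g \<longrightarrow> h z \<noteq> 0)"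

text \<open>The zero germ is excluded by the last condition, taking both factors to be zero.\<close>

definition germ_irreducible ::
    "'z::topological_space set \<Rightarrow> ('z \<Rightarrow> complex ^ 'n) \<Rightarrow> 'z \<Rightarrow> ('z \<Rightarrow> complex) \<Rightarrow> bool" where
  "germ_irreducible Z p z g \<longleftrightarrow>
     hol_germ Z p z g \<and> g z = 0 \<and>
     (\<forall>h1 h2. hol_germ Z p z h1 \<and> hol_germ Z p z h2 \<and> germ_eq Z z g (\<lambda>w. h1 w * h2 w)
        \<longrightarrow> h1 z \<noteq> 0 \<or> h2 z \<noteq> 0)"

text \<open>
  A meromorphic function is represented by a total function \<open>f\<close> together with its polar locus
  \<open>P\<close>; the values of \<open>f\<close> on \<open>P\<close> are irrelevant.
\<close>

definition local_quotient ::
    "'z::topological_space set \<Rightarrow> ('z \<Rightarrow> complex ^ 'n) \<Rightarrow> ('z \<Rightarrow> complex) \<Rightarrow> 'z set \<Rightarrow> 'z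
      \<Rightarrow> ('z \<Rightarrow> complex) \<Rightarrow> ('z \<Rightarrow> complex) \<Rightarrow> bool" where
  "local_quotient Z p f P z \<phi> \<psi> \<longleftrightarrow>
     hol_germ Z p z \<phi> \<and> hol_germ Z p z \<psi> \<and> \<not> germ_eq Z z \<psi> (\<lambda>_. 0) \<and>
     (\<exists>W. nbhd_in Z z W \<and> (\<forall>w\<in>W - P. \<psi> w \<noteq> 0 \<longrightarrow> f w = \<phi> w / \<psi> w))"

definition meromorphic_with_polar_locus ::
    "'z::topological_space set \<Rightarrow> ('z \<Rightarrow> complex ^ 'n) \<Rightarrow> ('z \<Rightarrow> complex) \<Rightarrow> 'z set \<Rightarrow> bool" where
  "meromorphic_with_polar_locus Z p f P \<longleftrightarrow>
     closedin (top_of_set Z) P \<and>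
     cover_holomorphic Z p f (Z - P) \<and>
     (\<forall>z\<in>P. \<exists>\<phi> \<psi>. local_quotient Z p f P z \<phi> \<psi>) \<and>
     (\<forall>z\<in>P. \<not> (\<exists>W g. nbhd_in Z z W \<and> cover_holomorphic Z p g W \<and> (\<forall>w\<in>W - P. g w = f w)))"

text \<open>
  \<open>z\<close> is a regular point of \<open>P\<close> if near \<open>z\<close> the set \<open>P\<close> is the common zero set of finitely many
  holomorphic functions whose differentials at \<open>z\<close> are linearly independent over \<open>\<complex>\<close>.
\<close>

definition regular_point ::
    "'z::topological_space set \<Rightarrow> ('z \<Rightarrow> complex ^ 'n) \<Rightarrow> 'z set \<Rightarrow> 'z \<Rightarrow> bool" where
  "regular_point Z p P z \<longleftrightarrow> z \<in> P \<and>
     (\<exists>W q r (g :: nat \<Rightarrow> 'z \<Rightarrow> complex).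
        cover_chart Z p W q \<and> z \<in> W \<and>
        (\<forall>k<r. cover_holomorphic Z p (g k) W) \<and>
        P \<inter> W = {w \<in> W. \<forall>k<r. g k w = 0} \<and>
        (\<forall>c :: nat \<Rightarrow> complex.
           (\<forall>j. (\<Sum>k<r. c k * deriv (\<lambda>x. g k (q (coord_upd (p z) j x))) (p z $ j)) = 0)
             \<longrightarrow> (\<forall>k<r. c k = 0)))"

definition analytic_submanifold ::
    "'z::topological_space set \<Rightarrow> ('z \<Rightarrow> complex ^ 'n) \<Rightarrow> 'z set \<Rightarrow> bool" where
  "analytic_submanifold Z p P \<longleftrightarrow>
     closedin (top_of_set Z) P \<and> (\<forall>z\<in>P. regular_point Z p P z)"

text \<open>
  The value of \<open>(f)\<^sub>\<infinity>\<close> at a regular point \<open>z\<close> of the polar locus \<open>P\<close>. Near such a point only one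
  irreducible component of \<open>P\<close> is present; \<open>g\<close> is the irreducible factor of the denominator
  corresponding to it, and \<open>k\<close> the exponent of \<open>g\<close> in the denominator of \<open>f = \<phi> / \<psi>\<close> in lowest
  terms. The integer is unique since the local rings are factorial.
\<close>

definition polar_order ::
    "'z::topological_space set \<Rightarrow> ('z \<Rightarrow> complex ^ 'n) \<Rightarrow> ('z \<Rightarrow> complex) \<Rightarrow> 'z set \<Rightarrow> 'z \<Rightarrow> int" where
  "polar_order Z p f P z = (THE m. \<exists>\<phi> \<psi> g k.
     local_quotient Z p f P z \<phi> \<psi> \<and> germ_coprime Z p z \<phi> \<psi> \<and>
     germ_irreducible Z p z g \<and> (\<exists>W. nbhd_in Z z W \<and> {w \<in> W. g w = 0} = P \<inter> W) \<and>
     germ_dvd Z p z (\<lambda>w. g w ^ k) \<psi> \<and> \<not> germ_dvd Z p z (\<lambda>w. g w ^ Suc k) \<psi> \<and>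
     m = - int k)"

end

theory Submission
  imports Defs "HOL-Complex_Analysis.Conformal_Mappings"
begin

text \<open>
  The constraint on \<open>\<theta>\<close> says \<open>\<kappa> = 0\<close>, so that \<open>v = 0\<close> is an invariant locus on which the Garnier
  system reduces to equations for \<open>u\<close> alone. In suitable coordinates they are of Riccati type: write \<open>a\<^sub>m\<close> for the
  \<open>n + 2\<close> points, \<open>Q(x) = \<Prod>\<^sub>k (x - u\<^sub>k)\<close>, \<open>R(x) = \<Prod>\<^sub>m (x - a\<^sub>m)\<close> and \<open>Q / R = \<Sum>\<^sub>m \<beta>\<^sub>m / (x - a\<^sub>m)\<close>.
  Then \<open>\<Sum> \<beta>\<^sub>m = 0\<close>, \<open>\<Sum> a\<^sub>m \<beta>\<^sub>m = 1\<close>, and for \<open>c = 1 - \<Sum> \<theta>\<^sub>m\<close>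
  \<open>\<partial>\<beta>\<^sub>i/\<partial>a\<^sub>j = (\<theta>\<^sub>j \<beta>\<^sub>i - \<theta>\<^sub>i \<beta>\<^sub>j) / (a\<^sub>i - a\<^sub>j) - c \<beta>\<^sub>i \<beta>\<^sub>j\<close> for \<open>i \<noteq> j\<close> (\<open>garnier_riccati\<close>). The
  coefficients of \<open>Q\<close>, that is the symmetric functions \<open>\<sigma>\<^sub>i\<close> up to sign, and the \<open>\<beta>\<^sub>m\<close> determine each
  other by affine maps with coefficients holomorphic in \<open>a\<close>; so the \<open>\<beta>\<^sub>m\<close> become meromorphic functions \<open>G\<^sub>m\<close>
  on the cover, and by the identity theorem the Riccati system holds for them everywhere.

  Near an arbitrary point \<open>z\<close> of the cover the Riccati system has a linear lift
  (\<open>riccati_linearization\<close>). By the symmetry of the right-hand side in \<open>i\<close> and \<open>j\<close> the form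
  \<open>\<Sum> G\<^sub>j da\<^sub>j\<close> is closed; if \<open>\<Lambda>\<close> is a primitive near a point \<open>z1\<close> close to \<open>z\<close> where all \<open>G\<^sub>m\<close> are
  holomorphic, and \<open>L = exp (c \<Lambda>)\<close>, then \<open>y\<^sub>m = L G\<^sub>m\<close> satisfies the linear system without the term
  \<open>c \<beta>\<^sub>i \<beta>\<^sub>j\<close>. Solutions of a linear system extend holomorphically to a ball whose radius depends only
  on bounds for the coefficients, hence to a neighbourhood of \<open>z\<close>. There \<open>L = \<Sum> a\<^sub>m y\<^sub>m\<close>,
  \<open>G\<^sub>m = y\<^sub>m / L\<close> and \<open>\<partial>L/\<partial>a\<^sub>j = c y\<^sub>j\<close>. At a zero of \<open>L\<close> the differential of \<open>L\<close> does not vanish: for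
  \<open>c = 0\<close> the function \<open>L\<close> is constant; for \<open>c \<noteq> 0\<close> a vanishing differential gives \<open>y\<^sub>1 = \<dots> = y\<^sub>n = 0\<close>,
  and the relations \<open>\<Sum> y\<^sub>m = 0\<close> and \<open>\<Sum> a\<^sub>m y\<^sub>m = L = 0\<close> then force \<open>y = 0\<close>, which uniqueness for linear
  systems excludes.

  So near \<open>z\<close> every \<open>F\<^sub>i\<close> is a quotient \<open>N / L\<close> with \<open>L\<close> having nonzero differential on its zero set.
  Such a hypersurface is a smooth and locally irreducible divisor, so if \<open>z\<close> is a pole of \<open>F\<^sub>i\<close>, then
  \<open>L\<close> does not divide \<open>N\<close>, the polar locus is \<open>{L = 0}\<close> near \<open>z\<close>, and the order is \<open>-1\<close>
  (\<open>polar_divisor_smooth_order_one\<close>).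

  Functions of several variables are handled one variable at a time: by Osgood's lemma a continuous
  function that is holomorphic in each variable separately is holomorphic, which gives closure
  under locally uniform limits, parameter integrals and partial derivatives.
\<close>

section \<open>Holomorphic functions of several variables\<close>

definition partial_deriv :: "'n \<Rightarrow> (complex ^ 'n \<Rightarrow> complex) \<Rightarrow> complex ^ 'n \<Rightarrow> complex" where
  "partial_deriv j f x = deriv (\<lambda>w. f (coord_upd x j w)) (x $ j)"

lemma coord_upd_nth [simp]: "coord_upd x j w $ l = (if l = j then w else x $ l)"
  by (simp add: coord_upd_def)

lemma coord_upd_same [simp]: "coord_upd x j (x $ j) = x"
  by (vector coord_upd_def)

lemma coord_upd_upd [simp]: "coord_upd (coord_upd x j w) j w' = coord_upd x j w'"
  by (vector coord_upd_def)

lemma coord_upd_eq_axis: "coord_upd x j w = (x + w *s axis j 1) - (x $ j) *s axis j 1"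
  by (vector coord_upd_def axis_def)

lemma norm_vector_smult: "norm (c *s (x :: complex ^ 'n)) = norm c * norm x"
  unfolding norm_vec_def vector_smult_component norm_mult
  by (rule L2_set_right_distrib[symmetric]) simp

lemma cmod_vec_nth_le: "norm (x $ j) \<le> norm (x :: complex ^ 'n)"
  by (rule Finite_Cartesian_Product.norm_nth_le)

lemma norm_coord_upd_diff: "norm (coord_upd x j w - x) = norm (w - x $ j)"
proof -
  have "coord_upd x j w - x = (w - x $ j) *s axis j 1"
    by (vector coord_upd_def axis_def)
  then show ?thesis by (simp only: norm_vector_smult norm_axis_1)
      (simp add: norm_axis_1)
qed

lemma dist_coord_upd: "dist (coord_upd x j w) x = dist w (x $ j)"
  by (simp add: dist_norm norm_coord_upd_diff)

lemma continuous_on_vector_smult [continuous_intros]: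
  fixes f :: "'a::topological_space \<Rightarrow> complex" and g :: "'a \<Rightarrow> complex ^ 'n"
  assumes "continuous_on S f" "continuous_on S g"
  shows "continuous_on S (\<lambda>x. f x *s g x)"
  unfolding vector_scalar_mult_def
  by (intro continuous_intros continuous_on_vec_lambda assms)

lemma continuous_on_coord_upd [continuous_intros]:
  fixes f :: "'a::topological_space \<Rightarrow> complex ^ 'n"
  assumes "continuous_on S f" "continuous_on S g"
  shows "continuous_on S (\<lambda>x. coord_upd (f x) j (g x))"
  unfolding coord_upd_eq_axis by (intro continuous_intros assms)

lemma has_derivative_vector_smult_left:
  "((\<lambda>w. b + w *s (h :: complex ^ 'n)) has_derivative (\<lambda>w. w *s h)) F"
proof -
  have "bounded_linear (\<lambda>w. w *s h)"
    by (rule bounded_linear_intro[where K = "norm h"])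
       (auto simp: norm_vector_smult vec_eq_iff algebra_simps)
  then have "((\<lambda>w. w *s h) has_derivative (\<lambda>w. w *s h)) F"
    by (rule bounded_linear.has_derivative) (auto intro: derivative_eq_intros)
  from has_derivative_add[OF has_derivative_const this, of b] show ?thesis by simp
qed

lemma hol_line_has_field_derivative:
  fixes f :: "complex ^ 'n \<Rightarrow> complex"
  assumes f: "(f has_derivative D) (at (b + w *s h))" and D: "\<And>c h. D (c *s h) = c * D h"
  shows "((\<lambda>w. f (b + w *s h)) has_field_derivative D h) (at w)"
proof -
  have "((\<lambda>w. f (b + w *s h)) has_derivative (\<lambda>w. D (w *s h))) (at w)"
    by (rule has_derivative_compose[where g = f and f = "\<lambda>w. b + w *s h", OF has_derivative_vector_smult_left f])
  then show ?thesis
    by (simp add: has_field_derivative_def D mult.commute[of _ "D h"])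
qed

text \<open>
  A complex linear differential is determined by the partial derivatives; this is what turns
  directional derivatives along complex lines into the sums used below.
\<close>

lemma has_derivative_complex_linear_expand:
  assumes f: "(f has_derivative D) (at x)" and D: "\<And>c h. D (c *s h) = c * D h"
  shows "((\<lambda>w. f (coord_upd x j w)) has_field_derivative D (axis j 1)) (at (x $ j))"
    and "D h = (\<Sum>j\<in>UNIV. h $ j * partial_deriv j f x)"
proof -
  have *: "((\<lambda>w. f (coord_upd x j w)) has_field_derivative D (axis j 1)) (at (x $ j))" for j
  proof -
    have "x = (x - (x $ j) *s axis j 1) + (x $ j) *s axis j 1" by simp
    then have "((\<lambda>w. f ((x - (x $ j) *s axis j 1) + w *s axis j 1)) has_field_derivative D (axis j 1)) (at (x $ j))"
      using f by (intro hol_line_has_field_derivative D) simp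
    moreover have "(x - (x $ j) *s axis j 1) + w *s axis j 1 = coord_upd x j w" for w
      by (simp add: coord_upd_eq_axis)
    ultimately show ?thesis by simp
  qed
  then show "((\<lambda>w. f (coord_upd x j w)) has_field_derivative D (axis j 1)) (at (x $ j))" .
  have lin: "linear D" using f has_derivative_linear by blast
  have pd: "partial_deriv j f x = D (axis j 1)" for j
    unfolding partial_deriv_def using * by (rule DERIV_imp_deriv)
  have "h = (\<Sum>j\<in>UNIV. (h $ j) *s axis j 1)"
    by (simp add: basis_expansion)
  then have "D h = D (\<Sum>j\<in>UNIV. (h $ j) *s axis j 1)" by simp
  also have "\<dots> = (\<Sum>j\<in>UNIV. D ((h $ j) *s axis j 1))" by (rule linear_sum[OF lin])
  finally show "D h = (\<Sum>j\<in>UNIV. h $ j * partial_deriv j f x)" by (simp add: D pd)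
qed

lemma hol_coord_deriv:
  assumes "cvec_holomorphic f S" "x \<in> S"
  shows "((\<lambda>w. f (coord_upd x j w)) has_field_derivative partial_deriv j f x) (at (x $ j))"
proof -
  obtain D where "(f has_derivative D) (at x)" "\<And>c h. D (c *s h) = c * D h"
    using assms unfolding cvec_holomorphic_def by blast
  from has_derivative_complex_linear_expand(1)[OF this, of j]
  show ?thesis unfolding partial_deriv_def using DERIV_imp_deriv by fastforce
qed

lemma hol_line_deriv:
  assumes "cvec_holomorphic f S" "b + w *s h \<in> S"
  shows "((\<lambda>w. f (b + w *s h)) has_field_derivative
           (\<Sum>j\<in>UNIV. h $ j * partial_deriv j f (b + w *s h))) (at w)"
proof -
  obtain D where D: "(f has_derivative D) (at (b + w *s h))" "\<And>c h. D (c *s h) = c * D h"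
    using assms unfolding cvec_holomorphic_def by blast
  from hol_line_has_field_derivative[OF this] has_derivative_complex_linear_expand(2)[OF this]
  show ?thesis by simp
qed

lemma hol_on_line:
  assumes "cvec_holomorphic f S" "\<And>w. w \<in> T \<Longrightarrow> b + w *s h \<in> S"
  shows "(\<lambda>w. f (b + w *s h)) holomorphic_on T"
  unfolding holomorphic_on_def field_differentiable_def
  using hol_line_deriv[OF assms(1) assms(2)] has_field_derivative_at_within by blast

lemma hol_on_coord:
  assumes "cvec_holomorphic f S" "\<And>w. w \<in> T \<Longrightarrow> coord_upd x j w \<in> S"
  shows "(\<lambda>w. f (coord_upd x j w)) holomorphic_on T"
proof -
  have eq: "(x - (x $ j) *s axis j 1) + w *s axis j 1 = coord_upd x j w" for w
    by (simp add: coord_upd_eq_axis)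
  show ?thesis
    using hol_on_line[OF assms(1), of T "x - (x $ j) *s axis j 1" "axis j 1"] assms(2)
    by (simp add: eq)
qed

lemma hol_subset: "cvec_holomorphic f S \<Longrightarrow> T \<subseteq> S \<Longrightarrow> cvec_holomorphic f T"
  unfolding cvec_holomorphic_def by blast

lemma hol_isCont: "cvec_holomorphic f S \<Longrightarrow> x \<in> S \<Longrightarrow> isCont f x"
  unfolding cvec_holomorphic_def by (meson has_derivative_continuous)

lemma hol_continuous_on: "cvec_holomorphic f S \<Longrightarrow> continuous_on S f"
  by (simp add: continuous_at_imp_continuous_on hol_isCont)

lemma hol_const: "cvec_holomorphic (\<lambda>x. c) S"
  unfolding cvec_holomorphic_def by (auto intro!: exI[of _ "\<lambda>h. 0"])

lemma hol_nth: "cvec_holomorphic (\<lambda>x. x $ j) S"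
  unfolding cvec_holomorphic_def
  by (auto intro!: exI[of _ "\<lambda>h. h $ j"] bounded_linear_imp_has_derivative bounded_linear_vec_nth)

lemma hol_mult:
  assumes "cvec_holomorphic f S" "cvec_holomorphic g S"
  shows "cvec_holomorphic (\<lambda>x. f x * g x) S"
  unfolding cvec_holomorphic_def
proof
  fix x assume "x \<in> S"
  then obtain D E where "(f has_derivative D) (at x)" "\<And>c h. D (c *s h) = c * D h"
    "(g has_derivative E) (at x)" "\<And>c h. E (c *s h) = c * E h"
    using assms unfolding cvec_holomorphic_def by meson
  then show "\<exists>D. ((\<lambda>x. f x * g x) has_derivative D) (at x) \<and> (\<forall>c h. D (c *s h) = c * D h)"
    by (intro exI[of _ "\<lambda>h. f x * E h + D h * g x"] conjI has_derivative_mult)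
       (auto simp: algebra_simps)
qed

lemma hol_add:
  assumes "cvec_holomorphic f S" "cvec_holomorphic g S"
  shows "cvec_holomorphic (\<lambda>x. f x + g x) S"
  unfolding cvec_holomorphic_def
proof
  fix x assume "x \<in> S"
  then obtain D E where "(f has_derivative D) (at x)" "\<And>c h. D (c *s h) = c * D h"
    "(g has_derivative E) (at x)" "\<And>c h. E (c *s h) = c * E h"
    using assms unfolding cvec_holomorphic_def by meson
  then show "\<exists>D. ((\<lambda>x. f x + g x) has_derivative D) (at x) \<and> (\<forall>c h. D (c *s h) = c * D h)"
    by (intro exI[of _ "\<lambda>h. D h + E h"] conjI has_derivative_add)
       (auto simp: algebra_simps)
qed

lemma hol_field_compose:
  assumes "cvec_holomorphic f S" "\<And>x. x \<in> S \<Longrightarrow> (g has_field_derivative g' (f x)) (at (f x))"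
  shows "cvec_holomorphic (\<lambda>x. g (f x)) S"
  unfolding cvec_holomorphic_def
proof
  fix x assume x: "x \<in> S"
  then obtain D where D: "(f has_derivative D) (at x)" "\<And>c h. D (c *s h) = c * D h"
    using assms unfolding cvec_holomorphic_def by meson
  have "((\<lambda>x. g (f x)) has_derivative (\<lambda>h. g' (f x) * D h)) (at x)"
    using has_derivative_compose[OF D(1)] assms(2)[OF x] unfolding has_field_derivative_def by blast
  then show "\<exists>D. ((\<lambda>x. g (f x)) has_derivative D) (at x) \<and> (\<forall>c h. D (c *s h) = c * D h)"
    by (intro exI[of _ "\<lambda>h. g' (f x) * D h"] conjI) (auto simp: D)
qed

lemma hol_exp: "cvec_holomorphic f S \<Longrightarrow> cvec_holomorphic (\<lambda>x. exp (f x)) S"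
  by (rule hol_field_compose[where g' = exp]) (auto intro!: DERIV_exp)

lemma hol_inverse:
  assumes "cvec_holomorphic f S" "\<And>x. x \<in> S \<Longrightarrow> f x \<noteq> 0"
  shows "cvec_holomorphic (\<lambda>x. inverse (f x)) S"
proof (rule hol_field_compose[OF assms(1), where g' = "\<lambda>z. - (inverse z ^ Suc (Suc 0))"])
  show "(inverse has_field_derivative - (inverse (f x) ^ Suc (Suc 0))) (at (f x))" if "x \<in> S" for x
    using assms(2)[OF that] by (rule DERIV_inverse)
qed

lemma hol_divide:
  assumes "cvec_holomorphic f S" "cvec_holomorphic g S" "\<And>x. x \<in> S \<Longrightarrow> g x \<noteq> 0"
  shows "cvec_holomorphic (\<lambda>x. f x / g x) S"
  using hol_mult[OF assms(1) hol_inverse[OF assms(2,3)]]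
  by (simp add: divide_inverse)

lemma hol_uminus: "cvec_holomorphic f S \<Longrightarrow> cvec_holomorphic (\<lambda>x. - f x) S"
  using hol_mult[OF hol_const[of "-1"], of f S] by simp

lemma hol_diff:
  assumes "cvec_holomorphic f S" "cvec_holomorphic g S"
  shows "cvec_holomorphic (\<lambda>x. f x - g x) S"
  using hol_add[OF assms(1) hol_uminus[OF assms(2)]] by simp

lemma hol_sum:
  assumes "\<And>i. i \<in> I \<Longrightarrow> cvec_holomorphic (f i) S"
  shows "cvec_holomorphic (\<lambda>x. \<Sum>i\<in>I. f i x) S"
  using assms by (induction I rule: infinite_finite_induct)
    (auto intro: hol_const hol_add)

lemma hol_prod:
  assumes "\<And>i. i \<in> I \<Longrightarrow> cvec_holomorphic (f i) S"
  shows "cvec_holomorphic (\<lambda>x. \<Prod>i\<in>I. f i x) S"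
  using assms by (induction I rule: infinite_finite_induct)
    (auto intro: hol_const hol_mult)

lemma hol_power: "cvec_holomorphic f S \<Longrightarrow> cvec_holomorphic (\<lambda>x. f x ^ k) S"
  by (induction k) (auto intro: hol_const hol_mult)

lemmas hol_intros = hol_const hol_nth hol_mult
  hol_add hol_diff hol_uminus hol_sum
  hol_prod hol_power hol_divide hol_exp

lemma hol_cong:
  assumes "open S" "\<And>x. x \<in> S \<Longrightarrow> f x = g x" "cvec_holomorphic f S"
  shows "cvec_holomorphic g S"
  unfolding cvec_holomorphic_def
proof
  fix x assume x: "x \<in> S"
  then obtain D where D: "(f has_derivative D) (at x)" "\<And>c h. D (c *s h) = c * D h"
    using assms(3) unfolding cvec_holomorphic_def by meson
  have "(g has_derivative D) (at x)"
    using has_derivative_transform_within_open[OF D(1) assms(1) x] assms(2) by blast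
  then show "\<exists>D. (g has_derivative D) (at x) \<and> (\<forall>c h. D (c *s h) = c * D h)" using D(2) by blast
qed

lemma partial_deriv_cong:
  assumes "open S" "\<And>x. x \<in> S \<Longrightarrow> f x = g x" "x \<in> S"
  shows "partial_deriv j f x = partial_deriv j g x"
  unfolding partial_deriv_def
proof (rule deriv_cong_ev)
  have "continuous_on UNIV (\<lambda>w. coord_upd x j w)" by (intro continuous_intros)
  then have "open ((\<lambda>w. coord_upd x j w) -` S)" using assms(1) open_vimage by blast
  moreover have "x $ j \<in> (\<lambda>w. coord_upd x j w) -` S" using assms(3) by simp
  ultimately show "\<forall>\<^sub>F w in nhds (x $ j). f (coord_upd x j w) = g (coord_upd x j w)"
    using assms(2) unfolding eventually_nhds by blast
qed simp

lemma partial_deriv_eqI: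
  "((\<lambda>w. f (coord_upd x j w)) has_field_derivative d) (at (x $ j)) \<Longrightarrow> partial_deriv j f x = d"
  unfolding partial_deriv_def by (rule DERIV_imp_deriv)

lemma hol_ofD:
  assumes "cvec_holomorphic f S" "x \<in> S"
  obtains D where "(f has_derivative D) (at x)" "\<And>c h. D (c *s h) = c * D h"
    "\<And>h. D h = (\<Sum>j\<in>UNIV. h $ j * partial_deriv j f x)"
proof -
  obtain D where "(f has_derivative D) (at x)" "\<And>c h. D (c *s h) = c * D h"
    using assms unfolding cvec_holomorphic_def by blast
  with has_derivative_complex_linear_expand(2)[OF this] that show ?thesis by blast
qed

text \<open>
  By Cauchy's inequality, applied to the difference of two members of the family, uniform closeness on a
  compact disc gives closeness of the derivatives.
\<close>

lemma deriv_continuous_param: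
  fixes h :: "'a::topological_space \<Rightarrow> complex \<Rightarrow> complex"
  assumes U: "open U" and cont: "continuous_on (T \<times> U) (\<lambda>(y, w). h y w)"
    and hol: "\<And>y. y \<in> T \<Longrightarrow> h y holomorphic_on U"
  shows "continuous_on (T \<times> U) (\<lambda>(y, w). deriv (h y) w)"
  unfolding continuous_on_def
proof safe
  fix y0 w0 assume y0: "y0 \<in> T" and w0: "w0 \<in> U"
  obtain r where r: "r > 0" "cball w0 (2 * r) \<subseteq> U"
  proof -
    obtain e where "e > 0" "cball w0 e \<subseteq> U" using U w0 open_contains_cball by blast
    then show thesis by (intro that[of "e / 2"]) auto
  qed
  have dcont: "isCont (deriv (h y0)) w0"
    using holomorphic_deriv[OF hol[OF y0] U] U w0 continuous_on_eq_continuous_at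
      holomorphic_on_imp_continuous_on by blast
  show "((\<lambda>(y, w). deriv (h y) w) \<longlongrightarrow> deriv (h y0) w0) (at (y0, w0) within T \<times> U)"
  proof (rule tendstoI)
    fix e :: real assume e: "e > 0"
    have "continuous_on (T \<times> cball w0 (2 * r)) (\<lambda>(y, w). h y w)"
      using cont by (rule continuous_on_subset) (use r in auto)
    then obtain X0 where X0: "y0 \<in> X0" "open X0" and
      "\<forall>y\<in>X0 \<inter> T. \<forall>t\<in>cball w0 (2 * r). dist ((\<lambda>(y, w). h y w) (y, t)) ((\<lambda>(y, w). h y w) (y0, t)) \<le> e * r / 4"
      by (rule continuous_on_prod_compactE[OF _ compact_cball y0, where e = "e * r / 4"]) (use e r in auto)
    then have X0h: "dist (h y t) (h y0 t) \<le> e * r / 4" if "y \<in> X0" "y \<in> T" "t \<in> cball w0 (2 * r)" for y t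
      using that by auto
    obtain d where d: "d > 0" "\<And>w. dist w w0 < d \<Longrightarrow> dist (deriv (h y0) w) (deriv (h y0) w0) < e / 2"
      using dcont e unfolding continuous_at_eps_delta by (metis half_gt_zero)
    have "dist (deriv (h y) w) (deriv (h y0) w0) < e"
      if y: "y \<in> X0" "y \<in> T" and w: "w \<in> ball w0 (min d r)" for y w
    proof -
      have sub: "cball w r \<subseteq> cball w0 (2 * r)"
      proof
        fix v assume "v \<in> cball w r"
        then show "v \<in> cball w0 (2 * r)"
          using w dist_triangle[of w0 v w] by simp
      qed
      then have subU: "cball w r \<subseteq> U" using r by auto
      have hol2: "(\<lambda>w. h y w - h y0 w) holomorphic_on U"
        by (intro holomorphic_intros hol y y0)
      have "norm ((deriv ^^ 1) (\<lambda>w. h y w - h y0 w) w) \<le> fact 1 * (e * r / 4) / r ^ 1"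
      proof (rule Cauchy_inequality)
        show "(\<lambda>w. h y w - h y0 w) holomorphic_on ball w r"
          using hol2 holomorphic_on_subset subU ball_subset_cball by (metis order_trans)
        show "continuous_on (cball w r) (\<lambda>w. h y w - h y0 w)"
          using hol2 holomorphic_on_subset subU holomorphic_on_imp_continuous_on by blast
        show "norm (h y x - h y0 x) \<le> e * r / 4" if "norm (w - x) = r" for x
          using X0h[of y x] y sub that by (auto simp: dist_norm subset_eq)
      qed (use r in auto)
      then have "norm (deriv (\<lambda>w. h y w - h y0 w) w) \<le> e / 4" using r by simp
      moreover have "deriv (\<lambda>w. h y w - h y0 w) w = deriv (h y) w - deriv (h y0) w"
        using subU r holomorphic_on_imp_differentiable_at[OF hol U] y y0
        by (intro deriv_diff) (auto simp: subset_eq)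
      ultimately have "dist (deriv (h y) w) (deriv (h y0) w) \<le> e / 4" by (simp add: dist_norm)
      moreover have "dist (deriv (h y0) w) (deriv (h y0) w0) < e / 2"
        using d(2)[of w] w by (simp add: dist_commute)
      ultimately show ?thesis
        using e dist_triangle[of "deriv (h y) w" "deriv (h y0) w0" "deriv (h y0) w"] by linarith
    qed
    moreover have "open (X0 \<times> ball w0 (min d r))" "(y0, w0) \<in> X0 \<times> ball w0 (min d r)"
      using X0 d r by (auto intro: open_Times)
    ultimately show "\<forall>\<^sub>F x in at (y0, w0) within T \<times> U. dist (case x of (y, w) \<Rightarrow> deriv (h y) w) (deriv (h y0) w0) < e"
      unfolding eventually_at_topological
      by (intro exI[of _ "X0 \<times> ball w0 (min d r)"]) auto
  qed
qed

lemma ball_coord_upd: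
  fixes x y :: "complex ^ 'n"
  assumes "y \<in> ball x r" "w \<in> ball (x $ j) r"
  shows "coord_upd y j w \<in> ball x (2 * r)"
proof -
  have "x - coord_upd y j w = (x - coord_upd x j w) + (coord_upd (x - y) j 0)"
    by (vector coord_upd_def)
  then have "norm (x - coord_upd y j w) \<le> norm (x - coord_upd x j w) + norm (coord_upd (x - y) j 0)"
    by (metis norm_triangle_ineq)
  moreover have "norm (x - coord_upd x j w) = norm (x $ j - w)"
    by (metis norm_coord_upd_diff norm_minus_commute)
  moreover have "norm (coord_upd (x - y) j 0) \<le> norm (x - y)"
    by (rule norm_le_componentwise_cart) simp
  ultimately show ?thesis using assms by (simp add: dist_norm)
qed

lemma partial_deriv_continuous_on:
  assumes S: "open S" and f: "continuous_on S f"
    and diff: "\<And>x. x \<in> S \<Longrightarrow> (\<lambda>w. f (coord_upd x j w)) field_differentiable (at (x $ j))"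
  shows "continuous_on S (partial_deriv j f)"
  unfolding continuous_on_eq_continuous_at[OF S]
proof
  fix x0 assume "x0 \<in> S"
  then obtain e where e: "e > 0" "ball x0 e \<subseteq> S" using S open_contains_ball by blast
  define r where "r = e / 2"
  have r: "r > 0" "\<And>y w. y \<in> ball x0 r \<Longrightarrow> w \<in> ball (x0 $ j) r \<Longrightarrow> coord_upd y j w \<in> S"
    using e ball_coord_upd[of _ x0 r _ j] by (auto simp: r_def)
  have "continuous_on (ball x0 r \<times> ball (x0 $ j) r) (\<lambda>(y, w). deriv (\<lambda>w. f (coord_upd y j w)) w)"
  proof (rule deriv_continuous_param)
    show "continuous_on (ball x0 r \<times> ball (x0 $ j) r) (\<lambda>(y, w). f (coord_upd y j w))"
      unfolding split_beta
      by (rule continuous_on_compose2[OF f]) (auto intro!: continuous_intros r)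
    show "(\<lambda>w. f (coord_upd y j w)) holomorphic_on ball (x0 $ j) r" if y: "y \<in> ball x0 r" for y
    proof -
      have "(\<lambda>w. f (coord_upd y j w)) field_differentiable (at w)" if "w \<in> ball (x0 $ j) r" for w
        using diff[OF r(2)[OF y that]] by simp
      then show ?thesis by (meson holomorphic_on_def field_differentiable_at_within)
    qed
  qed simp
  moreover have "continuous_on (ball x0 r) (\<lambda>y. (y, y $ j))" by (intro continuous_intros)
  moreover have "(y, y $ j) \<in> ball x0 r \<times> ball (x0 $ j) r" if "y \<in> ball x0 r" for y
    using that cmod_vec_nth_le[of "x0 - y" j] by (auto simp: dist_norm)
  ultimately have "continuous_on (ball x0 r) (\<lambda>y. deriv (\<lambda>w. f (coord_upd y j w)) (y $ j))"
    using continuous_on_compose2[of "ball x0 r \<times> ball (x0 $ j) r" "\<lambda>(y, w). deriv (\<lambda>w. f (coord_upd y j w)) w"]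
    by fastforce
  then have "continuous_on (ball x0 r) (partial_deriv j f)" by (simp add: partial_deriv_def[abs_def])
  then show "isCont (partial_deriv j f) x0"
    using r(1) by (simp add: continuous_on_eq_continuous_at)
qed

text \<open>
  Passing from \<open>x\<close> to \<open>x + h\<close> one coordinate at a time, each step is controlled by a partial
  derivative at an intermediate point, and the partial derivatives are continuous.
\<close>

theorem osgood:
  fixes f :: "complex ^ 'n \<Rightarrow> complex"
  assumes S: "open S" and f: "continuous_on S f"
    and diff: "\<And>x j. x \<in> S \<Longrightarrow> (\<lambda>w. f (coord_upd x j w)) field_differentiable (at (x $ j))"
  shows "cvec_holomorphic f S"
  unfolding cvec_holomorphic_def
proof
  fix x assume x: "x \<in> S"
  define D where "D A h = (\<Sum>j\<in>A. h $ j * partial_deriv j f x)" for A and h :: "complex ^ 'n"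
  define tr where "tr A h = (\<chi> l. if l \<in> A then h $ l else 0)" for A and h :: "complex ^ 'n"
  have norm_tr: "norm (tr A h) \<le> norm h" for A h
    by (rule norm_le_componentwise_cart) (simp add: tr_def)
  \<comment> \<open>\<open>tr A h\<close> keeps the coordinates of \<open>h\<close> in \<open>A\<close>; in the induction half
    of the allowed error is spent on the last coordinate.\<close>
  have step: "\<exists>d>0. \<forall>h. norm h < d \<longrightarrow> norm (f (x + tr A h) - f x - D A h) \<le> e * norm h"
    if "finite A" "e > 0" for A and e :: real
    using that
  proof (induction A arbitrary: e rule: finite_induct)
    case empty
    have "tr {} h = 0" for h by (vector tr_def)
    with empty show ?case by (intro exI[of _ 1]) (auto simp: D_def)
  next
    case (insert j A)
    obtain d1 where d1: "d1 > 0" "\<And>h. norm h < d1 \<Longrightarrow> norm (f (x + tr A h) - f x - D A h) \<le> e / 2 * norm h"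
      using insert.IH[of "e / 2"] insert.prems by auto
    have "isCont (partial_deriv j f) x"
      using partial_deriv_continuous_on[OF S f diff] S x continuous_on_eq_continuous_at by blast
    then obtain d2 where d2: "d2 > 0"
      "\<And>y. dist y x < d2 \<Longrightarrow> dist (partial_deriv j f y) (partial_deriv j f x) < e / 2"
      using insert.prems unfolding continuous_at_eps_delta by (metis half_gt_zero)
    obtain d3 where d3: "d3 > 0" "ball x d3 \<subseteq> S" using S x open_contains_ball by blast
    show ?case
    proof (intro exI[of _ "min d1 (min d2 d3 / 2)"] conjI allI impI)
      show "0 < min d1 (min d2 d3 / 2)" using d1 d2 d3 by auto
      fix h :: "complex ^ 'n" assume h: "norm h < min d1 (min d2 d3 / 2)"
      define y where "y = x + tr A h"
      define F where "F w = f (coord_upd y j (x $ j + w)) - w * partial_deriv j f x" for w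
      have yj: "y $ j = x $ j" using insert.hyps by (simp add: y_def tr_def)
      have near: "dist (coord_upd y j (x $ j + w)) x < min d2 d3" if "norm w \<le> norm h" for w
      proof -
        have "dist (coord_upd y j (x $ j + w)) x \<le> dist (coord_upd y j (x $ j + w)) y + dist y x"
          by (rule dist_triangle)
        also have "\<dots> \<le> norm w + norm h"
          using norm_tr[of A h] dist_coord_upd[of y j "x $ j + w"] by (simp add: yj) (simp add: y_def dist_norm)
        finally show ?thesis using that h by simp
      qed
      have der: "(F has_field_derivative partial_deriv j f (coord_upd y j (x $ j + w)) - partial_deriv j f x)
                  (at w within cball 0 (norm h))" if "w \<in> cball 0 (norm h)" for w
      proof -
        have "coord_upd y j (x $ j + w) \<in> S" using near[of w] d3 that by (auto simp: dist_commute)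
        from diff[OF this, of j]
        have "((\<lambda>w. f (coord_upd y j w)) has_field_derivative partial_deriv j f (coord_upd y j (x $ j + w))) (at (x $ j + w))"
          by (simp add: field_differentiable_derivI partial_deriv_def)
        then have "((\<lambda>w. f (coord_upd y j (w + x $ j))) has_field_derivative partial_deriv j f (coord_upd y j (x $ j + w))) (at w)"
          unfolding DERIV_shift[symmetric, of "\<lambda>w. f (coord_upd y j w)"] by (simp add: add.commute)
        then have "((\<lambda>w. f (coord_upd y j (x $ j + w))) has_field_derivative partial_deriv j f (coord_upd y j (x $ j + w))) (at w)"
          by (simp add: add.commute)
        then show ?thesis unfolding F_def
          by (auto intro!: derivative_eq_intros simp: has_field_derivative_at_within)
      qed
      have "norm (F (h $ j) - F 0) \<le> e / 2 * norm (h $ j - 0)"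
      proof (rule field_differentiable_bound[OF convex_cball der])
        show "norm (partial_deriv j f (coord_upd y j (x $ j + w)) - partial_deriv j f x) \<le> e / 2"
          if "w \<in> cball 0 (norm h)" for w
          using d2(2)[of "coord_upd y j (x $ j + w)"] near[of w] that by (simp add: dist_norm)
      qed (auto simp: cmod_vec_nth_le)
      also have "\<dots> \<le> e / 2 * norm h"
        using insert.prems cmod_vec_nth_le[of h j] by (simp add: mult_left_mono)
      finally have 1: "norm (F (h $ j) - F 0) \<le> e / 2 * norm h" .
      have 2: "norm (f y - f x - D A h) \<le> e / 2 * norm h" using d1 h by (simp add: y_def)
      have "coord_upd y j (x $ j + h $ j) = x + tr (insert j A) h"
        using yj by (auto simp: vec_eq_iff y_def tr_def)
      moreover have "coord_upd y j (x $ j) = y" using yj by (metis coord_upd_same)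
      moreover have "D (insert j A) h = D A h + h $ j * partial_deriv j f x"
        using insert.hyps by (simp add: D_def)
      ultimately have "f (x + tr (insert j A) h) - f x - D (insert j A) h = (F (h $ j) - F 0) + (f y - f x - D A h)"
        by (simp add: F_def)
      then have "norm (f (x + tr (insert j A) h) - f x - D (insert j A) h)
          \<le> norm (F (h $ j) - F 0) + norm (f y - f x - D A h)"
        by (simp only: norm_triangle_ineq)
      also have "\<dots> \<le> e * norm h" using 1 2 by (simp add: field_simps)
      finally show "norm (f (x + tr (insert j A) h) - f x - D (insert j A) h) \<le> e * norm h" .
    qed
  qed
  have tr_UNIV: "tr UNIV h = h" for h by (vector tr_def)
  have "(f has_derivative D UNIV) (at x)"
    unfolding has_derivative_within_alt
  proof (intro conjI allI impI)
    show "bounded_linear (D UNIV)"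
      unfolding D_def by (intro bounded_linear_sum bounded_linear_mult_left[THEN bounded_linear_compose] bounded_linear_vec_nth)
    fix e :: real assume "e > 0"
    then obtain d where "d > 0" "\<And>h. norm h < d \<Longrightarrow> norm (f (x + h) - f x - D UNIV h) \<le> e * norm h"
      using step[of UNIV e] by (auto simp: tr_UNIV)
    then show "\<exists>d>0. \<forall>y\<in>UNIV. norm (y - x) < d \<longrightarrow> norm (f y - f x - D UNIV (y - x)) \<le> e * norm (y - x)"
      by (intro exI[of _ d]) (auto, metis add.commute diff_add_cancel)
  qed
  moreover have "D UNIV (c *s h) = c * D UNIV h" for c h
    by (simp add: D_def sum_distrib_left mult.assoc)
  ultimately show "\<exists>D. (f has_derivative D) (at x) \<and> (\<forall>c h. D (c *s h) = c * D h)" by blast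
qed

theorem hol_uniform_limit:
  fixes f :: "nat \<Rightarrow> complex ^ 'n \<Rightarrow> complex"
  assumes S: "open S" and f: "\<And>n. cvec_holomorphic (f n) S"
    and lim: "\<And>x. x \<in> S \<Longrightarrow> \<exists>d>0. cball x d \<subseteq> S \<and> uniform_limit (cball x d) f g sequentially"
  shows "cvec_holomorphic g S"
proof (rule osgood[OF S])
  show "continuous_on S g"
    unfolding continuous_on_eq_continuous_at[OF S]
  proof
    fix x assume "x \<in> S"
    then obtain d where d: "d > 0" "cball x d \<subseteq> S" "uniform_limit (cball x d) f g sequentially"
      using lim by blast
    have "continuous_on (cball x d) g"
      by (rule uniform_limit_theorem[OF _ d(3)])
         (use f d(2) hol_continuous_on continuous_on_subset in \<open>blast intro: always_eventually\<close>, simp)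
    then have "continuous_on (ball x d) g" by (rule continuous_on_subset) auto
    then show "isCont g x" using d(1) by (simp add: continuous_on_eq_continuous_at)
  qed
next
  fix x j assume "x \<in> S"
  then obtain d where d: "d > 0" "cball x d \<subseteq> S" "uniform_limit (cball x d) f g sequentially"
    using lim by blast
  have in_ball: "coord_upd x j w \<in> cball x d" if "w \<in> cball (x $ j) d" for w
    using that dist_coord_upd[of x j w] by (simp add: dist_commute)
  have ul: "uniform_limit (cball (x $ j) d) (\<lambda>n w. f n (coord_upd x j w)) (\<lambda>w. g (coord_upd x j w)) sequentially"
    unfolding uniform_limit_iff
  proof (intro allI impI)
    fix e :: real assume "e > 0"
    then have "\<forall>\<^sub>F n in sequentially. \<forall>y\<in>cball x d. dist (f n y) (g y) < e"
      using d(3) unfolding uniform_limit_iff by blast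
    then show "\<forall>\<^sub>F n in sequentially. \<forall>w\<in>cball (x $ j) d. dist (f n (coord_upd x j w)) (g (coord_upd x j w)) < e"
      by (rule eventually_mono) (use in_ball in blast)
  qed
  have hol: "(\<lambda>w. f n (coord_upd x j w)) holomorphic_on cball (x $ j) d" for n
    by (rule hol_on_coord[OF f]) (use in_ball d in blast)
  have "(\<lambda>w. g (coord_upd x j w)) holomorphic_on ball (x $ j) d"
  proof (rule holomorphic_uniform_limit[OF _ ul])
    show "\<forall>\<^sub>F n in sequentially. continuous_on (cball (x $ j) d) (\<lambda>w. f n (coord_upd x j w)) \<and>
            (\<lambda>w. f n (coord_upd x j w)) holomorphic_on ball (x $ j) d"
      using hol by (auto intro!: always_eventually holomorphic_on_imp_continuous_on
          intro: holomorphic_on_subset[OF hol])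
  qed auto
  then show "(\<lambda>w. g (coord_upd x j w)) field_differentiable at (x $ j)"
    using d(1) by (auto intro: holomorphic_on_imp_differentiable_at)
qed

text \<open>
  Continuity in the parameter and differentiation under the integral in each variable suffice, by Osgood's
  lemma.
\<close>

theorem hol_integral:
  fixes g :: "complex ^ 'n \<Rightarrow> real \<Rightarrow> complex"
  assumes S: "open S" and cont: "continuous_on (S \<times> {0..1}) (\<lambda>(x, t). g x t)"
    and hol: "\<And>t. t \<in> {0..1} \<Longrightarrow> cvec_holomorphic (\<lambda>x. g x t) S"
  shows "cvec_holomorphic (\<lambda>x. integral {0..1} (g x)) S"
proof (rule osgood[OF S])
  show "continuous_on S (\<lambda>x. integral {0..1} (g x))"
    using integral_continuous_on_param[of S 0 1 g] cont by simp
next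
  fix x j assume x: "x \<in> S"
  then obtain d where d: "d > 0" "ball x d \<subseteq> S" using S open_contains_ball by blast
  have in_S: "coord_upd x j w \<in> S" if "w \<in> ball (x $ j) d" for w
    using that d dist_coord_upd[of x j w] by (auto simp: dist_commute subset_eq)
  have c1: "continuous_on ({0..1} \<times> ball (x $ j) d) (\<lambda>(t, w). g (coord_upd x j w) t)"
  proof -
    have "continuous_on ({0..1} \<times> ball (x $ j) d) (\<lambda>p. (\<lambda>(x, t). g x t) (coord_upd x j (snd p), fst p))"
      by (rule continuous_on_compose2[OF cont]) (auto intro!: continuous_intros in_S)
    then show ?thesis by (simp add: split_beta)
  qed
  have h1: "(\<lambda>w. g (coord_upd x j w) t) holomorphic_on ball (x $ j) d" if "t \<in> {0..1}" for t
    by (rule hol_on_coord[OF hol[OF that]]) (use in_S in blast)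
  have c2: "continuous_on ({0..1} \<times> ball (x $ j) d) (\<lambda>(t, w). deriv (\<lambda>w. g (coord_upd x j w) t) w)"
    by (rule deriv_continuous_param[OF open_ball c1 h1])
  have "(\<lambda>w. integral (cbox 0 1) (g (coord_upd x j w))) holomorphic_on ball (x $ j) d"
  proof (rule leibniz_rule_holomorphic)
    show "((\<lambda>w. g (coord_upd x j w) t) has_field_derivative deriv (\<lambda>w. g (coord_upd x j w) t) w)
            (at w within ball (x $ j) d)"
      if "w \<in> ball (x $ j) d" "t \<in> cbox 0 1" for w t
      using holomorphic_derivI[OF h1 open_ball] that has_field_derivative_at_within by auto
    show "g (coord_upd x j w) integrable_on cbox 0 1" if "w \<in> ball (x $ j) d" for w
    proof (rule integrable_continuous)
      have "continuous_on {0..1} (\<lambda>t. (\<lambda>(x, t). g x t) (coord_upd x j w, t))"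
        by (rule continuous_on_compose2[OF cont]) (auto intro!: continuous_intros in_S that)
      then show "continuous_on (cbox 0 1) (g (coord_upd x j w))" by simp
    qed
    have "continuous_on (ball (x $ j) d \<times> {0..1})
            (\<lambda>p. (\<lambda>(t, w). deriv (\<lambda>w. g (coord_upd x j w) t) w) (snd p, fst p))"
      by (rule continuous_on_compose2[OF c2]) (auto intro!: continuous_intros)
    then show "continuous_on (ball (x $ j) d \<times> cbox 0 1) (\<lambda>(w, t). deriv (\<lambda>w. g (coord_upd x j w) t) w)"
      by (simp add: split_beta)
  qed auto
  then show "(\<lambda>w. integral {0..1} (g (coord_upd x j w))) field_differentiable at (x $ j)"
    using d(1) by (auto intro: holomorphic_on_imp_differentiable_at)
qed

lemma bounded_linear_smult_axis: "bounded_linear (\<lambda>c. c *s axis l (1::complex) :: complex ^ 'n)"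
  by (rule bounded_linear_intro[where K = 1])
     (auto simp: norm_vector_smult vec_eq_iff algebra_simps norm_axis_1)

lemma has_derivative_cvec_componentwise:
  fixes g :: "complex ^ 'm \<Rightarrow> complex ^ 'n"
  assumes "\<And>l. ((\<lambda>y. g y $ l) has_derivative D l) (at x)"
  shows "(g has_derivative (\<lambda>h. \<chi> l. D l h)) (at x)"
proof -
  have "((\<lambda>y. (g y $ l) *s axis l 1 :: complex ^ 'n) has_derivative (\<lambda>h. D l h *s axis l 1)) (at x)" for l
    using bounded_linear_smult_axis assms[of l] by (rule bounded_linear.has_derivative)
  then have "((\<lambda>y. \<Sum>l\<in>UNIV. (g y $ l) *s axis l 1 :: complex ^ 'n) has_derivative
      (\<lambda>h. \<Sum>l\<in>UNIV. D l h *s axis l 1)) (at x)"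
    by (rule has_derivative_sum)
  moreover have "(\<Sum>l\<in>UNIV. D l h *s axis l 1) = (\<chi> l. D l h)" for h
    using basis_expansion[of "\<chi> l. D l h"] by simp
  ultimately show ?thesis by (simp add: basis_expansion)
qed

lemma hol_compose:
  fixes g :: "complex ^ 'm \<Rightarrow> complex ^ 'n"
  assumes f: "cvec_holomorphic f S" and g: "\<And>l. cvec_holomorphic (\<lambda>y. g y $ l) T" and "g ` T \<subseteq> S"
  shows "cvec_holomorphic (\<lambda>y. f (g y)) T"
  unfolding cvec_holomorphic_def
proof
  fix y assume y: "y \<in> T"
  have "\<exists>E. ((\<lambda>y. g y $ l) has_derivative E) (at y) \<and> (\<forall>c h. E (c *s h) = c * E h)" for l
    using g y unfolding cvec_holomorphic_def by blast
  then obtain E where E: "\<And>l. ((\<lambda>y. g y $ l) has_derivative E l) (at y)" "\<And>l c h. E l (c *s h) = c * E l h"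
    by metis
  obtain D where D: "(f has_derivative D) (at (g y))" "\<And>c h. D (c *s h) = c * D h"
    using f y assms(3) unfolding cvec_holomorphic_def by blast
  have "((\<lambda>y. f (g y)) has_derivative (\<lambda>h. D (\<chi> l. E l h))) (at y)"
    by (rule has_derivative_compose[OF has_derivative_cvec_componentwise[OF E(1)] D(1)])
  moreover have "(\<chi> l. E l (c *s h)) = c *s (\<chi> l. E l h)" for c h
    by (simp add: vec_eq_iff E(2))
  ultimately show "\<exists>D. ((\<lambda>y. f (g y)) has_derivative D) (at y) \<and> (\<forall>c h. D (c *s h) = c * D h)"
    by (intro exI[of _ "\<lambda>h. D (\<chi> l. E l h)"]) (simp add: D(2))
qed

text \<open>
  Cauchy's formula for the derivative writes the partial derivative as an integral, over a circle of
  fixed radius, of holomorphic functions of \<open>x\<close>.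
\<close>

theorem hol_partial_deriv:
  assumes S: "open S" and f: "cvec_holomorphic f S"
  shows "cvec_holomorphic (partial_deriv j f) S"
  unfolding cvec_holomorphic_def
proof
  fix x0 assume "x0 \<in> S"
  then obtain e where e: "e > 0" "ball x0 e \<subseteq> S" using S open_contains_ball by blast
  define r where "r = e / 2"
  have r: "r > 0" using e by (simp add: r_def)
  have in_S: "coord_upd x j (x $ j + z) \<in> S" if "x \<in> ball x0 r" "norm z \<le> r" for x z
  proof -
    have "dist (coord_upd x j (x $ j + z)) x0 \<le> dist (coord_upd x j (x $ j + z)) x + dist x x0"
      by (rule dist_triangle)
    also have "\<dots> < 2 * r"
      using that by (simp only: dist_coord_upd) (simp add: dist_norm norm_minus_commute)
    finally show ?thesis using e by (auto simp: r_def dist_commute subset_eq)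
  qed
  define \<gamma> where "\<gamma> t = of_real r * exp (2 * of_real pi * \<i> * of_real t)" for t :: real
  have n\<gamma>: "norm (\<gamma> t) = r" for t using r by (simp add: \<gamma>_def norm_mult)
  have \<gamma>0: "\<gamma> t \<noteq> 0" for t using n\<gamma>[of t] r by auto
  have cont\<gamma>: "continuous_on A (\<lambda>p. \<gamma> (h p))" if "continuous_on A h" for A :: "'z::topological_space set" and h
    unfolding \<gamma>_def by (intro continuous_intros that)
  define g where "g x t = f (coord_upd x j (x $ j + \<gamma> t)) / \<gamma> t" for x t
  have hol: "cvec_holomorphic (\<lambda>x. integral {0..1} (g x)) (ball x0 r)"
  proof (rule hol_integral)
    have "continuous_on (ball x0 r \<times> {0..1}) (\<lambda>p. f (coord_upd (fst p) j (fst p $ j + \<gamma> (snd p))) / \<gamma> (snd p))"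
      by (intro continuous_intros continuous_on_compose2[OF hol_continuous_on[OF f]] cont\<gamma>)
         (auto simp: \<gamma>0 n\<gamma> intro!: in_S)
    then show "continuous_on (ball x0 r \<times> {0..1}) (\<lambda>(x, t). g x t)"
      by (simp add: g_def split_beta)
    show "cvec_holomorphic (\<lambda>x. g x t) (ball x0 r)" for t
      unfolding g_def
    proof (intro hol_intros hol_compose[OF f])
      show "cvec_holomorphic (\<lambda>x. coord_upd x j (x $ j + \<gamma> t) $ l) (ball x0 r)" for l
        by (cases "l = j") (auto intro!: hol_intros)
    qed (auto simp: \<gamma>0 n\<gamma> intro!: in_S)
  qed simp
  have eq: "integral {0..1} (g x) = partial_deriv j f x" if x: "x \<in> ball x0 r" for x
  proof -
    define h where "h z = f (coord_upd x j (z + x $ j))" for z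
    have "((\<lambda>w. f (coord_upd x j w)) has_field_derivative partial_deriv j f x) (at (0 + x $ j))"
      using hol_coord_deriv[OF f, of x j] in_S[OF x, of 0] r by simp
    then have dh: "deriv h 0 = partial_deriv j f x"
      unfolding h_def DERIV_shift by (rule DERIV_imp_deriv)
    have eqh: "h = (\<lambda>z. f ((x - (x $ j) *s axis j 1 + (x $ j) *s axis j 1) + z *s axis j 1))"
      unfolding h_def coord_upd_eq_axis
      by (intro ext arg_cong[of _ _ f]) (simp add: vec_eq_iff axis_def)
    have "h holomorphic_on cball 0 r"
      unfolding eqh
    proof (rule hol_on_line[OF f])
      fix z :: complex assume z: "z \<in> cball 0 r"
      have "(x - (x $ j) *s axis j 1 + (x $ j) *s axis j 1) + z *s axis j 1 = coord_upd x j (x $ j + z)"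
        unfolding coord_upd_eq_axis by (simp add: vec_eq_iff axis_def)
      then show "(x - (x $ j) *s axis j 1 + (x $ j) *s axis j 1) + z *s axis j 1 \<in> S"
        using in_S[OF x, of z] z by simp
    qed
    then have "((\<lambda>u. h u / (u - 0) ^ Suc 1) has_contour_integral ((2 * pi * \<i>) / (fact 1) * (deriv ^^ 1) h 0)) (circlepath 0 r)"
      using r by (intro Cauchy_has_contour_integral_higher_derivative_circlepath)
        (auto intro: holomorphic_on_imp_continuous_on holomorphic_on_subset)
    then have "contour_integral (circlepath 0 r) (\<lambda>u. h u / u ^ 2) = 2 * pi * \<i> * partial_deriv j f x"
      using contour_integral_unique dh by (simp add: numeral_2_eq_2)
    moreover have "h (\<gamma> t) / (\<gamma> t)\<^sup>2 * vector_derivative (circlepath 0 r) (at t) = (2 * pi * \<i>) * g x t" for t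
    proof -
      have "vector_derivative (circlepath 0 r) (at t) = 2 * pi * \<i> * \<gamma> t"
        by (simp add: vector_derivative_circlepath \<gamma>_def)
      moreover have "h (\<gamma> t) / \<gamma> t = g x t" by (simp add: h_def g_def add.commute)
      ultimately show ?thesis using \<gamma>0[of t] by (simp add: power2_eq_square field_simps)
    qed
    moreover have "circlepath 0 r t = \<gamma> t" for t by (simp add: circlepath \<gamma>_def)
    ultimately have "(2 * pi * \<i>) * integral {0..1} (g x) = 2 * pi * \<i> * partial_deriv j f x"
      by (simp add: contour_integral_integral)
    then show ?thesis by simp
  qed
  have "cvec_holomorphic (partial_deriv j f) (ball x0 r)"
    by (rule hol_cong[OF _ eq hol]) auto
  then show "\<exists>D. (partial_deriv j f has_derivative D) (at x0) \<and> (\<forall>c h. D (c *s h) = c * D h)"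
    using r unfolding cvec_holomorphic_def by simp
qed

section \<open>Identity theorems\<close>

lemma open_nonzero_set:
  assumes "open U" "cvec_holomorphic f U"
  shows "open {x \<in> U. f x \<noteq> 0}"
proof -
  have "open (U \<inter> f -` (- {0}))"
    using hol_continuous_on[OF assms(2)] continuous_open_preimage assms(1) by blast
  moreover have "U \<inter> f -` (- {0}) = {x \<in> U. f x \<noteq> 0}" by auto
  ultimately show ?thesis by simp
qed

lemma line_preimage:
  fixes U :: "(complex ^ 'n) set"
  assumes "convex U" "open U"
  shows "convex {w. b + w *s h \<in> U}" "open {w. b + w *s h \<in> U}"
proof -
  show "convex {w. b + w *s h \<in> U}"
  proof (rule convexI)
    fix v w and s t :: real
    assume *: "v \<in> {w. b + w *s h \<in> U}" "w \<in> {w. b + w *s h \<in> U}" "0 \<le> s" "0 \<le> t" "s + t = 1"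
    have "s *\<^sub>R (b + v *s h) + t *\<^sub>R (b + w *s h) \<in> U"
      using * assms(1) unfolding convex_def by auto
    moreover have "s *\<^sub>R (b + v *s h) + t *\<^sub>R (b + w *s h) = (s + t) *\<^sub>R b + (s *\<^sub>R v + t *\<^sub>R w) *s h"
      by (simp add: vec_eq_iff) (simp add: scaleR_conv_of_real algebra_simps)
    ultimately show "s *\<^sub>R v + t *\<^sub>R w \<in> {w. b + w *s h \<in> U}" using * by simp
  qed
  have "continuous_on UNIV (\<lambda>w. b + w *s h)" by (intro continuous_intros)
  then show "open {w. b + w *s h \<in> U}" using open_vimage[OF assms(2)] by (simp add: vimage_def)
qed

lemma line_from_to: "p + 0 *s (x - p) = (p :: complex ^ 'n)" "p + 1 *s (x - p) = x"
  by (auto simp: vec_eq_iff)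

text \<open>
  The complex line from a point of \<open>W\<close> to \<open>x\<close> meets the convex set \<open>U\<close> in a connected set, where the
  one-variable theorem applies.
\<close>

theorem identity_theorem:
  fixes f :: "complex ^ 'n \<Rightarrow> complex"
  assumes U: "convex U" "open U" and f: "cvec_holomorphic f U"
    and W: "open W" "p \<in> W" "W \<subseteq> U" and zero: "\<And>x. x \<in> W \<Longrightarrow> f x = 0" and x: "x \<in> U"
  shows "f x = 0"
proof -
  let ?l = "\<lambda>w. p + w *s (x - p)"
  let ?T = "{w. ?l w \<in> U}" and ?T' = "{w. ?l w \<in> W}"
  have T: "convex ?T" "open ?T" by (rule line_preimage[OF U])+
  have "continuous_on UNIV ?l" by (intro continuous_intros)
  then have T': "open ?T'" using open_vimage[OF W(1)] by (simp add: vimage_def)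
  have 0: "0 \<in> ?T'" "0 \<in> ?T" "1 \<in> ?T" using W x line_from_to[of p x] by auto
  have "(\<lambda>w. f (?l w)) holomorphic_on ?T" by (rule hol_on_line[OF f]) auto
  then have "f (?l 1) = 0"
    by (rule analytic_continuation_open[OF T' T(2) _ convex_connected[OF T(1)] _ _ holomorphic_on_const, rotated 2])
       (use 0 W zero in \<open>auto simp: subset_eq intro!: exI[of _ 0]\<close>)
  then show ?thesis using line_from_to(2)[of p x] by simp
qed

text \<open>
  On a complex line through a point with \<open>\<psi> \<noteq> 0\<close> the zeros of \<open>\<psi>\<close> are isolated, so removing them from
  the line does not disconnect it. This is the identity theorem for meromorphic functions with denominator \<open>\<psi>\<close>.
\<close>

theorem identity_theorem_off_zeros:
  fixes E \<psi> :: "complex ^ 'n \<Rightarrow> complex"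
  assumes U: "convex U" "open U" and \<psi>: "cvec_holomorphic \<psi> U" and nz: "q \<in> U" "\<psi> q \<noteq> 0"
    and E: "cvec_holomorphic E {x \<in> U. \<psi> x \<noteq> 0}"
    and W: "open W" "p \<in> W" "W \<subseteq> U" and zero: "\<And>x. x \<in> W \<Longrightarrow> \<psi> x \<noteq> 0 \<Longrightarrow> E x = 0"
    and x: "x \<in> U" "\<psi> x \<noteq> 0"
  shows "E x = 0"
proof -
  obtain p' where p': "p' \<in> W" "\<psi> p' \<noteq> 0"
    using identity_theorem[OF U \<psi> W _ nz(1)] nz(2) by blast
  let ?l = "\<lambda>w. p' + w *s (x - p')"
  let ?T = "{w. ?l w \<in> U}"
  let ?Z = "{w \<in> ?T. \<psi> (?l w) = 0}"
  have T: "convex ?T" "open ?T" by (rule line_preimage[OF U])+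
  have 0: "0 \<in> ?T" "1 \<in> ?T" using W x p' line_from_to[of p' x] by auto
  have hol\<psi>: "(\<lambda>w. \<psi> (?l w)) holomorphic_on ?T" by (rule hol_on_line[OF \<psi>]) auto
  have "?Z sparse_in ?T"
    unfolding sparse_in_open[OF T(2)]
  proof safe
    fix w assume w: "?l w \<in> U" "w islimpt ?Z"
    have "\<psi> (?l 1) = 0"
      by (rule analytic_continuation[OF hol\<psi> T(2) convex_connected[OF T(1)] _ _ w(2)]) (use w 0 in auto)
    then show False using x(2) line_from_to(2)[of p' x] by simp
  qed
  then have conn: "connected (?T - ?Z)"
    by (intro sparse_imp_connected convex_connected[OF T(1)] T(2)) simp_all
  have cl: "continuous_on UNIV ?l" by (intro continuous_intros)
  have 1: "?T - ?Z = ?l -` {y \<in> U. \<psi> y \<noteq> 0}" by auto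
  have o1: "open (?T - ?Z)" unfolding 1 using open_vimage[OF open_nonzero_set[OF U(2) \<psi>] cl] by simp
  have o2: "open (?l -` {y \<in> W. \<psi> y \<noteq> 0})" 
    using open_vimage[OF open_nonzero_set[OF W(1) hol_subset[OF \<psi> W(3)]] cl] by simp
  have "(\<lambda>w. E (?l w)) holomorphic_on (?T - ?Z)"
    by (rule hol_on_line[OF E]) auto
  then have "E (?l 1) = 0"
    by (rule analytic_continuation_open[OF o2 o1 _ conn _ _ holomorphic_on_const, rotated 2])
       (use 0 W zero p' x line_from_to[of p' x] in \<open>auto intro!: exI[of _ 0]\<close>)
  then show ?thesis using line_from_to(2)[of p' x] by simp
qed

lemma hol_integral_domain:
  fixes f g :: "complex ^ 'n \<Rightarrow> complex"
  assumes U: "convex U" "open U" and f: "cvec_holomorphic f U" and g: "cvec_holomorphic g U"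
    and prod: "\<And>x. x \<in> U \<Longrightarrow> f x * g x = 0" and nz: "p \<in> U" "g p \<noteq> 0" and x: "x \<in> U"
  shows "f x = 0"
proof -
  show ?thesis
    by (rule identity_theorem[OF U f open_nonzero_set[OF U(2) g], of p]) (use nz prod x in auto)
qed

lemma nonzero_on_subball:
  fixes f :: "complex ^ 'n \<Rightarrow> complex"
  assumes U: "convex U" "open U" "cvec_holomorphic f U" and q: "q \<in> U" "f q \<noteq> 0"
    and x: "ball x e \<subseteq> U" "e > 0"
  obtains y where "y \<in> ball x e" "f y \<noteq> 0"
  using identity_theorem[OF U open_ball, of x x e q] q x by auto

section \<open>Smooth hypersurfaces\<close>

lemma partial_deriv_mult:
  assumes "cvec_holomorphic f S" "cvec_holomorphic g S" "x \<in> S"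
  shows "partial_deriv j (\<lambda>x. f x * g x) x = partial_deriv j f x * g x + f x * partial_deriv j g x"
  by (rule partial_deriv_eqI)
     (auto intro!: derivative_eq_intros hol_coord_deriv[OF assms(1,3)]
       hol_coord_deriv[OF assms(2,3)] simp: algebra_simps)

lemma nonzero_of_partial_deriv:
  assumes "open U" "x \<in> U" "partial_deriv j f x \<noteq> 0"
  obtains y where "y \<in> U" "f y \<noteq> 0"
proof -
  have "\<exists>y\<in>U. f y \<noteq> 0"
  proof (rule ccontr)
    assume "\<not> ?thesis"
    then have "partial_deriv j f x = partial_deriv j (\<lambda>x. 0) x"
      by (intro partial_deriv_cong[OF assms(1) _ assms(2)]) auto
    then show False using assms(3) by (simp add: partial_deriv_def)
  qed
  then show thesis using that by blast
qed

lemma continuous_on_partial_deriv: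
  "open S \<Longrightarrow> cvec_holomorphic f S \<Longrightarrow> continuous_on S (partial_deriv j f)"
  by (intro hol_continuous_on hol_partial_deriv)

lemma bounded_linear_vec_lambda_cvec:
  fixes f :: "'n::finite \<Rightarrow> 'a::real_normed_vector \<Rightarrow> complex"
  assumes "\<And>l. bounded_linear (f l)"
  shows "bounded_linear (\<lambda>h. \<chi> l. f l h :: complex ^ 'n)"
proof -
  have "bounded_linear (\<lambda>h. \<Sum>l\<in>UNIV. f l h *s axis l 1 :: complex ^ 'n)"
    by (intro bounded_linear_sum bounded_linear_compose[OF bounded_linear_smult_axis assms])
  moreover have "(\<Sum>l\<in>UNIV. f l h *s axis l 1) = (\<chi> l. f l h)" for h
    using basis_expansion[of "\<chi> l. f l h"] by simp
  ultimately show ?thesis by simp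
qed

text \<open>
  The map replacing the \<open>j\<close>-th coordinate by \<open>L x\<close> has an invertible differential at \<open>x0\<close>; its local
  inverse \<open>g\<close> is holomorphic because the inverse of a complex linear bijection is complex linear. In the new
  coordinates the hypersurface \<open>L = 0\<close> is a coordinate hyperplane.
\<close>

theorem straighten_hypersurface:
  fixes L :: "complex ^ 'n \<Rightarrow> complex"
  assumes S: "open S" and L: "cvec_holomorphic L S" and x0: "x0 \<in> S" "L x0 = 0"
    and nz: "partial_deriv j L x0 \<noteq> 0"
  obtains U r g where "open U" "x0 \<in> U" "U \<subseteq> S" "r > 0"
    "\<And>y. y \<in> ball (coord_upd x0 j 0) r \<Longrightarrow> g y \<in> U"
    "\<And>x. x \<in> U \<Longrightarrow> coord_upd x j (L x) \<in> ball (coord_upd x0 j 0) r"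
    "\<And>x. x \<in> U \<Longrightarrow> g (coord_upd x j (L x)) = x"
    "\<And>y. y \<in> ball (coord_upd x0 j 0) r \<Longrightarrow> coord_upd (g y) j (L (g y)) = y"
    "\<And>l. cvec_holomorphic (\<lambda>y. g y $ l) (ball (coord_upd x0 j 0) r)"
proof -
  define \<Phi> where "\<Phi> x = coord_upd x j (L x)" for x
  define dL where "dL x h = (\<Sum>i\<in>UNIV. h $ i * partial_deriv i L x)" for x h
  define D where "D x h = (\<chi> l. if l = j then dL x h else h $ l)" for x h
  have dL: "bounded_linear (dL x)" for x
    unfolding dL_def
    by (intro bounded_linear_sum bounded_linear_mult_left[THEN bounded_linear_compose] bounded_linear_vec_nth)
  have D: "bounded_linear (D x)" for x
    unfolding D_def
  proof (rule bounded_linear_vec_lambda_cvec)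
    show "bounded_linear (\<lambda>h. if l = j then dL x h else h $ l)" for l
      using dL[of x] bounded_linear_vec_nth[of l] by (cases "l = j") auto
  qed
  define f' where "f' x = Blinfun (D x)" for x
  have f'[simp]: "blinfun_apply (f' x) = D x" for x
    unfolding f'_def by (rule bounded_linear_Blinfun_apply[OF D])
  have smult: "D x (c *s h) = c *s D x h" for x c h
    by (simp add: D_def dL_def vec_eq_iff sum_distrib_left mult.assoc)
  define a where "a = partial_deriv j L x0"
  \<comment> \<open>The inverse of the differential of \<open>\<Phi>\<close> at \<open>x0\<close>, solved for the \<open>j\<close>-th component.\<close>
  define E where "E k = (\<chi> l. if l = j then (k $ j - (\<Sum>i\<in>UNIV - {j}. k $ i * partial_deriv i L x0)) / a else k $ l)"
    for k :: "complex ^ 'n"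
  have E: "bounded_linear E"
    unfolding E_def
  proof (rule bounded_linear_vec_lambda_cvec)
    have "bounded_linear (\<lambda>k :: complex ^ 'n. (k $ j - (\<Sum>i\<in>UNIV - {j}. k $ i * partial_deriv i L x0)) / a)"
      by (intro bounded_linear_sum bounded_linear_mult_left[THEN bounded_linear_compose]
         bounded_linear_divide[THEN bounded_linear_compose] bounded_linear_sub bounded_linear_vec_nth)
    then show "bounded_linear (\<lambda>k :: complex ^ 'n. if l = j then (k $ j - (\<Sum>i\<in>UNIV - {j}. k $ i * partial_deriv i L x0)) / a else k $ l)" for l
      using bounded_linear_vec_nth[of l] by (cases "l = j") auto
  qed
  have ED: "E (D x0 h) = h" for h
  proof -
    have "dL x0 h = h $ j * a + (\<Sum>i\<in>UNIV - {j}. h $ i * partial_deriv i L x0)"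
      unfolding dL_def a_def by (simp add: sum.remove[of UNIV j])
    moreover have "(\<Sum>i\<in>UNIV - {j}. D x0 h $ i * partial_deriv i L x0) = (\<Sum>i\<in>UNIV - {j}. h $ i * partial_deriv i L x0)"
      by (rule sum.cong) (auto simp: D_def)
    ultimately show ?thesis using nz by (simp add: E_def vec_eq_iff a_def[symmetric]) (simp add: D_def)
  qed
  have der: "(\<Phi> has_derivative blinfun_apply (f' x)) (at x)" if x: "x \<in> S" for x
  proof -
    obtain d where "(L has_derivative d) (at x)" "\<And>h. d h = dL x h"
      using hol_ofD[OF L x] unfolding dL_def by metis
    then have d: "(L has_derivative dL x) (at x)" by (metis ext)
    have "((\<lambda>x. \<Phi> x $ l) has_derivative (\<lambda>h. if l = j then dL x h else h $ l)) (at x)" for l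
      using d bounded_linear_imp_has_derivative[OF bounded_linear_vec_nth[of l]]
      by (cases "l = j") (auto simp: \<Phi>_def)
    from has_derivative_cvec_componentwise[OF this] show ?thesis by (simp add: D_def[abs_def])
  qed
  have cont: "continuous_on S f'"
  proof (rule continuous_on_blinfun_componentwise)
    fix b :: "complex ^ 'n"
    have "continuous_on S (\<lambda>x. if l = j then dL x b else b $ l)" for l
      unfolding dL_def by (cases "l = j")
        (auto intro!: continuous_intros continuous_on_partial_deriv[OF S L])
    then show "continuous_on S (\<lambda>x. blinfun_apply (f' x) b)"
      by (simp add: D_def continuous_on_vec_lambda)
  qed
  have "Blinfun E o\<^sub>L f' x0 = id_blinfun"
    by (rule blinfun_eqI) (simp add: bounded_linear_Blinfun_apply[OF E] ED)
  from inverse_function_theorem[OF S der cont x0(1) this]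
  obtain U' V g g' where U': "open U'" "U' \<subseteq> S" "x0 \<in> U'" and V: "open V" "\<Phi> x0 \<in> V"
    and hom: "homeomorphism U' V \<Phi> g"
    and g': "\<And>y. y \<in> V \<Longrightarrow> (g has_derivative (g' y)) (at y)"
      "\<And>y. y \<in> V \<Longrightarrow> g' y = inv (blinfun_apply (f' (g y)))"
      "\<And>y. y \<in> V \<Longrightarrow> bij (blinfun_apply (f' (g y)))"
    by metis
  have \<Phi>x0: "\<Phi> x0 = coord_upd x0 j 0" by (simp add: \<Phi>_def x0)
  obtain r where r: "r > 0" "ball (coord_upd x0 j 0) r \<subseteq> V"
    using V \<Phi>x0 open_contains_ball by metis
  let ?B = "ball (coord_upd x0 j 0) r"
  define U where "U = U' \<inter> \<Phi> -` ?B"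
  have "continuous_on U' \<Phi>" using hom homeomorphism_def by blast
  then have "open U" unfolding U_def using U'(1) continuous_open_preimage by blast
  have gU: "g y \<in> U'" "\<Phi> (g y) = y" if "y \<in> V" for y
    using hom that by (auto simp: homeomorphism_def)
  have g\<Phi>: "g (\<Phi> x) = x" if "x \<in> U'" for x
    using hom that by (auto simp: homeomorphism_def)
  have hol: "cvec_holomorphic (\<lambda>y. g y $ l) ?B" for l
    unfolding cvec_holomorphic_def
  proof
    fix y assume "y \<in> ?B"
    then have y: "y \<in> V" using r by blast
    have "((\<lambda>y. g y $ l) has_derivative (\<lambda>h. g' y h $ l)) (at y)"
      using g'(1)[OF y] by (rule bounded_linear.has_derivative[OF bounded_linear_vec_nth])
    moreover have "g' y (c *s h) = c *s g' y h" for c h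
    proof -
      have b: "bij (D (g y))" and gy: "g' y = inv (D (g y))" using g'(2,3)[OF y] by auto
      have "D (g y) (c *s g' y h) = c *s h"
        using b by (simp add: smult gy bij_is_surj surj_f_inv_f)
      then have "inv (D (g y)) (c *s h) = c *s g' y h"
        using b by (metis bij_inv_eq_iff)
      then show ?thesis by (simp add: gy)
    qed
    ultimately show "\<exists>D. ((\<lambda>y. g y $ l) has_derivative D) (at y) \<and> (\<forall>c h. D (c *s h) = c * D h)"
      by (intro exI[of _ "\<lambda>h. g' y h $ l"]) simp
  qed
  show thesis
  proof (rule that[OF \<open>open U\<close> _ _ r(1)])
    show "x0 \<in> U" using U' r(1) by (simp add: U_def \<Phi>x0)
    show "U \<subseteq> S" using U' by (auto simp: U_def)
    show "g y \<in> U" if "y \<in> ?B" for y using gU[of y] that r by (auto simp: U_def)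
    show "coord_upd x j (L x) \<in> ?B" if "x \<in> U" for x using that by (simp add: U_def \<Phi>_def)
    show "g (coord_upd x j (L x)) = x" if "x \<in> U" for x
      using that g\<Phi>[of x] by (simp add: U_def \<Phi>_def)
    show "coord_upd (g y) j (L (g y)) = y" if "y \<in> ?B" for y
      using gU(2)[of y] that r by (auto simp: \<Phi>_def)
    show "cvec_holomorphic (\<lambda>y. g y $ l) ?B" for l by (rule hol)
  qed
qed

lemma coord_shrink_in_ball:
  assumes y: "y \<in> ball (coord_upd x j 0) r" and t: "norm t \<le> 1"
  shows "coord_upd y j (t * y $ j) \<in> ball (coord_upd x j 0) r"
proof -
  have "norm (coord_upd x j 0 - coord_upd y j (t * y $ j)) \<le> norm (coord_upd x j 0 - y)"
  proof (rule norm_le_componentwise_cart)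
    fix l show "norm ((coord_upd x j 0 - coord_upd y j (t * y $ j)) $ l) \<le> norm ((coord_upd x j 0 - y) $ l)"
      using t by (cases "l = j") (auto simp: norm_mult mult_left_le_one_le)
  qed
  then show ?thesis using y by (simp add: dist_norm)
qed

text \<open>
  Hadamard's lemma: integrating the \<open>j\<close>-th partial derivative along the segment from the hyperplane
  \<open>y $ j = 0\<close> to \<open>y\<close> produces the quotient.
\<close>

lemma division_by_coordinate:
  fixes F :: "complex ^ 'n \<Rightarrow> complex"
  assumes F: "cvec_holomorphic F (ball (coord_upd x j 0) r)"
    and zero: "\<And>y. y \<in> ball (coord_upd x j 0) r \<Longrightarrow> y $ j = 0 \<Longrightarrow> F y = 0"
  obtains H where "cvec_holomorphic H (ball (coord_upd x j 0) r)"
    "\<And>y. y \<in> ball (coord_upd x j 0) r \<Longrightarrow> F y = y $ j * H y"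
proof -
  let ?B = "ball (coord_upd x j 0) r"
  define g where "g y t = partial_deriv j F (coord_upd y j (of_real t * y $ j))" for y and t :: real
  have in_B: "coord_upd y j (of_real t * y $ j) \<in> ?B" if "y \<in> ?B" "t \<in> {0..1}" for y and t :: real
    using coord_shrink_in_ball[OF that(1), of "of_real t"] that(2) by simp
  have pd: "cvec_holomorphic (partial_deriv j F) ?B"
    by (rule hol_partial_deriv[OF open_ball F])
  show thesis
  proof
    show "cvec_holomorphic (\<lambda>y. integral {0..1} (g y)) ?B"
    proof (rule hol_integral)
      have "continuous_on (?B \<times> {0..1}) (\<lambda>p. partial_deriv j F (coord_upd (fst p) j (of_real (snd p) * fst p $ j)))"
        by (intro continuous_on_compose2[OF hol_continuous_on[OF pd]] continuous_intros)
           (use in_B in auto)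
      then show "continuous_on (?B \<times> {0..1}) (\<lambda>(y, t). g y t)" by (simp add: g_def split_beta)
      show "cvec_holomorphic (\<lambda>y. g y t) ?B" if t: "t \<in> {0..1}" for t
        unfolding g_def
      proof (rule hol_compose[OF pd])
        show "cvec_holomorphic (\<lambda>y. coord_upd y j (of_real t * y $ j) $ l) ?B" for l
          by (cases "l = j") (auto intro!: hol_intros)
      qed (use in_B t in auto)
    qed simp
    show "F y = y $ j * integral {0..1} (g y)" if y: "y \<in> ?B" for y
    proof -
      have "((\<lambda>t. F (coord_upd y j (of_real t * y $ j))) has_vector_derivative y $ j * g y t) (at t within {0..1})"
        if t: "t \<in> {0..1}" for t
      proof -
        have "((\<lambda>w. F (coord_upd y j w)) has_field_derivative g y t) (at (of_real t * y $ j))"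
          using hol_coord_deriv[OF F in_B[OF y t], of j] by (simp add: g_def)
        then have "((\<lambda>s. F (coord_upd y j (s * y $ j))) has_field_derivative g y t * y $ j) (at (of_real t))"
          by (rule DERIV_chain2[where g = "\<lambda>s. s * y $ j"]) (auto intro!: derivative_eq_intros)
        then have "((\<lambda>t. F (coord_upd y j (of_real t * y $ j))) has_vector_derivative g y t * y $ j) (at t)"
          by (rule has_vector_derivative_real_field)
        then show ?thesis by (simp add: has_vector_derivative_at_within mult.commute)
      qed
      then have "((\<lambda>t. y $ j * g y t) has_integral F (coord_upd y j (of_real 1 * y $ j)) - F (coord_upd y j (of_real 0 * y $ j))) {0..1}"
        by (intro fundamental_theorem_of_calculus) auto
      moreover have "F (coord_upd y j 0) = 0" using zero in_B[OF y, of 0] by auto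
      ultimately have "((\<lambda>t. y $ j * g y t) has_integral F y) {0..1}" by simp
      then show ?thesis by (simp add: integral_unique flip: integral_mult_right)
    qed
  qed
qed

text \<open>
  The two properties of the local ring that are needed: the identity theorem on the hypersurface (near
  \<open>x0\<close> it is connected, which makes \<open>L\<close> prime), and the Nullstellensatz for \<open>L\<close> (functions vanishing on \<open>L = 0\<close>
  are multiples of \<open>L\<close>). Both are evident in straightened coordinates.
\<close>

theorem smooth_hypersurface:
  fixes L :: "complex ^ 'n \<Rightarrow> complex"
  assumes S: "open S" and L: "cvec_holomorphic L S" and x0: "x0 \<in> S" "L x0 = 0"
    and nz: "partial_deriv j L x0 \<noteq> 0"
  obtains U where "open U" "x0 \<in> U" "U \<subseteq> S"
    "\<And>f W p x. cvec_holomorphic f U \<Longrightarrow> open W \<Longrightarrow> p \<in> W \<inter> U \<Longrightarrow> L p = 0 \<Longrightarrow>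
       (\<And>x. x \<in> W \<inter> U \<Longrightarrow> L x = 0 \<Longrightarrow> f x = 0) \<Longrightarrow> x \<in> U \<Longrightarrow> L x = 0 \<Longrightarrow> f x = 0"
    "\<And>f. cvec_holomorphic f U \<Longrightarrow> (\<And>x. x \<in> U \<Longrightarrow> L x = 0 \<Longrightarrow> f x = 0) \<Longrightarrow>
       \<exists>h. cvec_holomorphic h U \<and> (\<forall>x\<in>U. f x = L x * h x)"
proof -
  obtain U r g where U: "open U" "x0 \<in> U" "U \<subseteq> S" and "r > 0"
    and gU: "\<And>y. y \<in> ball (coord_upd x0 j 0) r \<Longrightarrow> g y \<in> U"
    and \<Phi>: "\<And>x. x \<in> U \<Longrightarrow> coord_upd x j (L x) \<in> ball (coord_upd x0 j 0) r"
    and g\<Phi>: "\<And>x. x \<in> U \<Longrightarrow> g (coord_upd x j (L x)) = x"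
    and \<Phi>g: "\<And>y. y \<in> ball (coord_upd x0 j 0) r \<Longrightarrow> coord_upd (g y) j (L (g y)) = y"
    and g: "\<And>l. cvec_holomorphic (\<lambda>y. g y $ l) (ball (coord_upd x0 j 0) r)"
    using straighten_hypersurface[OF assms] by blast
  let ?B = "ball (coord_upd x0 j 0) r"
  have Lg: "L (g y) = y $ j" if "y \<in> ?B" for y
    using arg_cong[OF \<Phi>g[OF that], of "\<lambda>v. v $ j"] by simp
  have slice: "coord_upd y j 0 \<in> ?B" if "y \<in> ?B" for y
    using coord_shrink_in_ball[OF that, of 0] by simp
  show thesis
  proof (rule that[OF U])
    fix f W p x
    assume f: "cvec_holomorphic f U" and W: "open W" "p \<in> W \<inter> U" "L p = 0"
      "\<And>x. x \<in> W \<inter> U \<Longrightarrow> L x = 0 \<Longrightarrow> f x = 0" and x: "x \<in> U" "L x = 0"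
    define G where "G y = f (g (coord_upd y j 0))" for y
    have gs: "cvec_holomorphic (\<lambda>y. g (coord_upd y j 0) $ l) ?B" for l
    proof (rule hol_compose[OF g])
      show "cvec_holomorphic (\<lambda>y. coord_upd y j 0 $ i) ?B" for i
        by (cases "i = j") (auto intro!: hol_intros)
    qed (use slice in auto)
    have G: "cvec_holomorphic G ?B"
      unfolding G_def by (rule hol_compose[OF f gs]) (use gU slice in auto)
    have "continuous_on ?B (\<lambda>y. g (coord_upd y j 0))"
      using continuous_on_vec_lambda[of ?B "\<lambda>l y. g (coord_upd y j 0) $ l"]
        hol_continuous_on[OF gs] by simp
    then have "open (?B \<inter> (\<lambda>y. g (coord_upd y j 0)) -` W)"
      using continuous_open_preimage W(1) by blast
    moreover have "coord_upd p j 0 \<in> ?B \<inter> (\<lambda>y. g (coord_upd y j 0)) -` W"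
      using W g\<Phi>[of p] \<Phi>[of p] by simp
    moreover have "G y = 0" if "y \<in> ?B \<inter> (\<lambda>y. g (coord_upd y j 0)) -` W" for y
      unfolding G_def using that Lg[OF slice[of y]] gU[OF slice[of y]] by (intro W(4)) auto
    moreover have "coord_upd x j 0 \<in> ?B" using \<Phi>[of x] x by simp
    ultimately have "G (coord_upd x j 0) = 0"
      using identity_theorem[OF convex_ball open_ball G] by blast
    then show "f x = 0" using g\<Phi>[of x] x by (simp add: G_def)
  next
    fix f assume f: "cvec_holomorphic f U" and zero: "\<And>x. x \<in> U \<Longrightarrow> L x = 0 \<Longrightarrow> f x = 0"
    have "cvec_holomorphic (\<lambda>y. f (g y)) ?B"
      by (rule hol_compose[OF f g]) (use gU in auto)
    then obtain H where H: "cvec_holomorphic H ?B" "\<And>y. y \<in> ?B \<Longrightarrow> f (g y) = y $ j * H y"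
      using division_by_coordinate[of "\<lambda>y. f (g y)" x0 j r] zero Lg gU by auto
    have LU: "cvec_holomorphic L U" using L U hol_subset by blast
    show "\<exists>h. cvec_holomorphic h U \<and> (\<forall>x\<in>U. f x = L x * h x)"
    proof (intro exI conjI ballI)
      show "cvec_holomorphic (\<lambda>x. H (coord_upd x j (L x))) U"
      proof (rule hol_compose[OF H(1)])
        show "cvec_holomorphic (\<lambda>x. coord_upd x j (L x) $ l) U" for l
          using LU by (cases "l = j") (auto intro!: hol_intros)
      qed (use \<Phi> in auto)
      show "f x = L x * H (coord_upd x j (L x))" if "x \<in> U" for x
        using H(2)[OF \<Phi>[OF that]] g\<Phi>[OF that] by simp
    qed
  qed
qed

section \<open>Linear systems along rays\<close>

definition ray_pt :: "complex ^ 'n \<Rightarrow> complex ^ 'n \<Rightarrow> real \<Rightarrow> complex ^ 'n" where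
  "ray_pt z x s = z + of_real s *s (x - z)"

lemma ray_pt_0 [simp]: "ray_pt z x 0 = z" and ray_pt_1 [simp]: "ray_pt z x 1 = x"
  by (simp_all add: ray_pt_def vec_eq_iff)

lemma ray_pt_center [simp]: "ray_pt z z s = z"
  by (simp add: ray_pt_def vec_eq_iff)

lemma ray_pt_in_ball:
  assumes "x \<in> ball z r" "s \<in> {0..1}"
  shows "ray_pt z x s \<in> ball z r"
proof -
  have "norm (z - ray_pt z x s) = s * norm (z - x)"
    using assms(2) norm_vector_smult[of "of_real s" "x - z"]
    by (simp add: ray_pt_def norm_minus_commute)
  also have "\<dots> \<le> norm (z - x)" using assms(2) by (intro mult_left_le_one_le) auto
  finally show ?thesis using assms(1) by (simp add: dist_norm)
qed

lemma continuous_on_ray_pt [continuous_intros]: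
  assumes "continuous_on S f" "continuous_on S g"
  shows "continuous_on S (\<lambda>p. ray_pt z (f p) (g p))"
  unfolding ray_pt_def by (intro continuous_intros assms)

lemma hol_ray_pt: "cvec_holomorphic (\<lambda>x. ray_pt z x s $ l) S"
  unfolding ray_pt_def by (simp, intro hol_intros)

lemma hol_comp_ray_pt:
  assumes "cvec_holomorphic f (ball z r)" "s \<in> {0..1}"
  shows "cvec_holomorphic (\<lambda>x. f (ray_pt z x s)) (ball z r)"
  using assms ray_pt_in_ball
  by (intro hol_compose[OF assms(1)] hol_ray_pt) blast

lemma continuous_on_comp_ray_pt:
  assumes "cvec_holomorphic f (ball z r)" "continuous_on S g" "continuous_on S h"
    "\<And>p. p \<in> S \<Longrightarrow> g p \<in> ball z r" "\<And>p. p \<in> S \<Longrightarrow> h p \<in> {0..1}"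
  shows "continuous_on S (\<lambda>p. f (ray_pt z (g p) (h p)))"
  using assms(4,5) ray_pt_in_ball
  by (intro continuous_on_compose2[OF hol_continuous_on[OF assms(1)]] continuous_intros assms(2,3)) blast

lemma has_vector_derivative_along_ray:
  assumes f: "cvec_holomorphic f (ball z r)" and x: "x \<in> ball z r" and s: "s \<in> {0..1}"
  shows "((\<lambda>s. f (ray_pt z x s)) has_vector_derivative
           (\<Sum>j\<in>UNIV. (x - z) $ j * partial_deriv j f (ray_pt z x s))) (at s within T)"
proof -
  have "((\<lambda>w. f (z + w *s (x - z))) has_field_derivative
      (\<Sum>j\<in>UNIV. (x - z) $ j * partial_deriv j f (z + of_real s *s (x - z)))) (at (of_real s))"
    by (rule hol_line_deriv[OF f]) (use ray_pt_in_ball[OF x s] in \<open>simp add: ray_pt_def\<close>)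
  from has_vector_derivative_real_field[OF this]
  show ?thesis by (simp add: ray_pt_def has_vector_derivative_at_within)
qed

text \<open>
  The Poincare lemma: differentiating \<open>\<integral> \<Sum> (x - z)\<^sub>i G\<^sub>i (z + s (x - z)) ds\<close> under the integral
  and using closedness, the integrand becomes the derivative of \<open>s G\<^sub>j (z + s (x - z))\<close> in \<open>s\<close>.
\<close>

theorem closed_form_primitive:
  fixes G :: "'n \<Rightarrow> complex ^ 'n \<Rightarrow> complex"
  assumes G: "\<And>j. cvec_holomorphic (G j) (ball z r)"
    and closed: "\<And>i j x. x \<in> ball z r \<Longrightarrow> partial_deriv j (G i) x = partial_deriv i (G j) x"
  obtains \<Lambda> where "cvec_holomorphic \<Lambda> (ball z r)" "\<Lambda> z = 0"
    "\<And>j x. x \<in> ball z r \<Longrightarrow> partial_deriv j \<Lambda> x = G j x"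
proof -
  let ?B = "ball z r"
  define f where "f x s = (\<Sum>i\<in>UNIV. (x - z) $ i * G i (ray_pt z x s))" for x and s :: real
  have cont_f: "continuous_on S (\<lambda>p. f (g p) (h p))"
    if "continuous_on S g" "continuous_on S h" "\<And>p. p \<in> S \<Longrightarrow> g p \<in> ?B" "\<And>p. p \<in> S \<Longrightarrow> h p \<in> {0..1}"
    for S :: "'z::topological_space set" and g h
    unfolding f_def
    by (intro continuous_intros continuous_on_comp_ray_pt[OF G] that) (use that in auto)
  define \<Lambda> where "\<Lambda> x = integral {0..1} (f x)" for x
  have pdG: "cvec_holomorphic (partial_deriv j (G i)) ?B" for i j
    by (rule hol_partial_deriv[OF open_ball G])
  show thesis
  proof
    show "cvec_holomorphic \<Lambda> ?B"
      unfolding \<Lambda>_def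
    proof (rule hol_integral)
      show "continuous_on (?B \<times> {0..1}) (\<lambda>(x, t). f x t)"
        unfolding split_beta by (rule cont_f) (auto intro!: continuous_intros)
      show "cvec_holomorphic (\<lambda>x. f x t) ?B" if t: "t \<in> {0..1}" for t
        unfolding f_def vector_minus_component
        by (intro hol_intros hol_comp_ray_pt[OF G t])
    qed simp
    have "f z = (\<lambda>s. 0)" by (simp add: f_def fun_eq_iff)
    then show "\<Lambda> z = 0" by (simp add: \<Lambda>_def)
    show "partial_deriv j \<Lambda> x = G j x" if x: "x \<in> ?B" for j x
    proof -
      obtain d where d: "d > 0" "ball x d \<subseteq> ?B" using x open_contains_ball open_ball by blast
      have in_B: "coord_upd x j w \<in> ?B" if "w \<in> ball (x $ j) d" for w
        using that d dist_coord_upd[of x j w] by (auto simp: dist_commute subset_eq)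
      define f' where "f' w s = G j (ray_pt z (coord_upd x j w) s) +
        (\<Sum>i\<in>UNIV. (coord_upd x j w - z) $ i * (partial_deriv j (G i) (ray_pt z (coord_upd x j w) s) * of_real s))"
        for w and s :: real
      have ray_upd: "ray_pt z (coord_upd x j w) s = coord_upd (ray_pt z x s) j (z $ j + of_real s * (w - z $ j))" for w s
        by (simp add: ray_pt_def vec_eq_iff algebra_simps)
      have dG: "((\<lambda>w. G i (ray_pt z (coord_upd x j w) s)) has_field_derivative
          partial_deriv j (G i) (ray_pt z (coord_upd x j w) s) * of_real s) (at w)"
        if w: "w \<in> ball (x $ j) d" and s: "s \<in> {0..1}" for i w s
      proof -
        let ?y = "ray_pt z (coord_upd x j w) s"
        have "((\<lambda>v. G i (coord_upd ?y j v)) has_field_derivative partial_deriv j (G i) ?y) (at (?y $ j))"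
          by (rule hol_coord_deriv[OF G ray_pt_in_ball[OF in_B[OF w] s]])
        then have "((\<lambda>v. G i (coord_upd (ray_pt z x s) j v)) has_field_derivative partial_deriv j (G i) ?y)
            (at (z $ j + of_real s * (w - z $ j)))"
          by (simp add: ray_upd)
        then show ?thesis
          unfolding ray_upd
          by (rule DERIV_chain2[where g = "\<lambda>w. z $ j + of_real s * (w - z $ j)"])
             (auto intro!: derivative_eq_intros)
      qed
      have "((\<lambda>w. integral (cbox 0 1) (f (coord_upd x j w))) has_field_derivative integral (cbox 0 1) (f' (x $ j)))
          (at (x $ j) within ball (x $ j) d)"
      proof (rule leibniz_rule_field_derivative)
        fix w and s :: real assume w: "w \<in> ball (x $ j) d" and "s \<in> cbox 0 1"
        then have s: "s \<in> {0..1}" by simp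
        have d1: "((\<lambda>w. (coord_upd x j w - z) $ i * G i (ray_pt z (coord_upd x j w) s)) has_field_derivative
            (if i = j then G j (ray_pt z (coord_upd x j w) s) else 0) +
              (coord_upd x j w - z) $ i * (partial_deriv j (G i) (ray_pt z (coord_upd x j w) s) * of_real s)) (at w)" for i
          by (cases "i = j") (auto intro!: derivative_eq_intros dG[OF w s])
        have "((\<lambda>w. f (coord_upd x j w) s) has_field_derivative
            (\<Sum>i\<in>UNIV. (if i = j then G j (ray_pt z (coord_upd x j w) s) else 0) +
              (coord_upd x j w - z) $ i * (partial_deriv j (G i) (ray_pt z (coord_upd x j w) s) * of_real s))) (at w)"
          unfolding f_def by (rule DERIV_sum) (rule d1)
        then have "((\<lambda>w. f (coord_upd x j w) s) has_field_derivative f' w s) (at w)"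
          by (simp add: f'_def sum.distrib)
        then show "((\<lambda>w. f (coord_upd x j w) s) has_field_derivative f' w s) (at w within ball (x $ j) d)"
          by (rule has_field_derivative_at_within)
      next
        fix w assume w: "w \<in> ball (x $ j) d"
        have "continuous_on {0..1} (f (coord_upd x j w))"
          by (rule cont_f[of _ "\<lambda>_. coord_upd x j w" "\<lambda>s. s"]) (use in_B[OF w] in \<open>auto intro: continuous_intros\<close>)
        then show "f (coord_upd x j w) integrable_on cbox 0 1"
          using integrable_continuous_interval by simp
      next
        have "continuous_on (ball (x $ j) d \<times> {0..1}) (\<lambda>p. f' (fst p) (snd p))"
          unfolding f'_def
          by (intro continuous_intros continuous_on_comp_ray_pt[OF G] continuous_on_comp_ray_pt[OF pdG])
             (use in_B in auto)
        then show "continuous_on (ball (x $ j) d \<times> cbox 0 1) (\<lambda>(w, s). f' w s)" by (simp add: split_beta)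
      qed (use d in auto)
      then have "((\<lambda>w. \<Lambda> (coord_upd x j w)) has_field_derivative integral {0..1} (f' (x $ j))) (at (x $ j))"
        using d(1) by (simp add: \<Lambda>_def at_within_open[of "x $ j" "ball (x $ j) d"])
      then have "partial_deriv j \<Lambda> x = integral {0..1} (f' (x $ j))" by (rule partial_deriv_eqI)
      also have "\<dots> = G j x"
      proof (rule integral_unique)
        have "((\<lambda>s. of_real s * G j (ray_pt z x s)) has_vector_derivative f' (x $ j) s) (at s within {0..1})"
          if s: "s \<in> {0..1}" for s
        proof -
          have "((\<lambda>s. of_real s * G j (ray_pt z x s)) has_vector_derivative
              of_real s * (\<Sum>i\<in>UNIV. (x - z) $ i * partial_deriv i (G j) (ray_pt z x s)) +
              of_real 1 * G j (ray_pt z x s)) (at s within {0..1})"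
            by (intro has_vector_derivative_mult has_vector_derivative_along_ray[OF G x s]
                has_vector_derivative_of_real) (auto intro: derivative_eq_intros)
          moreover have "partial_deriv i (G j) (ray_pt z x s) = partial_deriv j (G i) (ray_pt z x s)" for i
            using closed ray_pt_in_ball[OF x s] by metis
          ultimately show ?thesis by (simp add: f'_def sum_distrib_left algebra_simps)
        qed
        then have "(f' (x $ j) has_integral (of_real 1 * G j (ray_pt z x 1) - of_real 0 * G j (ray_pt z x 0))) {0..1}"
          by (intro fundamental_theorem_of_calculus) auto
        then show "(f' (x $ j) has_integral G j x) {0..1}" by simp
      qed
      finally show ?thesis .
    qed
  qed
qed

lemma geometric_bound_tendsto_0: "(\<lambda>n. C / 2 ^ n :: real) \<longlonglongrightarrow> 0"
  using tendsto_mult_right_zero[OF LIMSEQ_realpow_zero[of "1 / 2 :: real"], of C]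
  by (simp add: power_divide)

text \<open>
  A linear system \<open>\<partial>y\<^sub>k/\<partial>x\<^sub>j = \<Sum>\<^sub>l A\<^sub>j\<^sub>k\<^sub>l y\<^sub>l\<close> restricted to rays from \<open>z\<close> becomes an integral equation
  that makes sense whether or not the system is integrable. On a ball with \<open>K r \<le> 1/2\<close> the integral
  operator halves sup norms, so the equation has a unique holomorphic solution on the whole ball for
  every initial value at \<open>z\<close>. The point is that \<open>r\<close> depends on the coefficients only.
\<close>

locale linear_ray_system =
  fixes A :: "'n::finite \<Rightarrow> 'm::finite \<Rightarrow> 'm \<Rightarrow> complex ^ 'n \<Rightarrow> complex"
    and z :: "complex ^ 'n" and r K :: real
  assumes A_hol: "\<And>j k l. cvec_holomorphic (A j k l) (ball z r)"
    and A_bound: "\<And>x k. x \<in> ball z r \<Longrightarrow> (\<Sum>j\<in>UNIV. \<Sum>l\<in>UNIV. norm (A j k l x)) \<le> K"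
    and small: "K * r \<le> 1 / 2"
begin

definition ray_integrand :: "(complex ^ 'n \<Rightarrow> 'm \<Rightarrow> complex) \<Rightarrow> 'm \<Rightarrow> complex ^ 'n \<Rightarrow> real \<Rightarrow> complex" where
  "ray_integrand v k x s =
     (\<Sum>j\<in>UNIV. \<Sum>l\<in>UNIV. (x - z) $ j * A j k l (ray_pt z x s) * v (ray_pt z x s) l)"

definition ray_operator :: "(complex ^ 'n \<Rightarrow> 'm \<Rightarrow> complex) \<Rightarrow> complex ^ 'n \<Rightarrow> 'm \<Rightarrow> complex" where
  "ray_operator v x k = integral {0..1} (ray_integrand v k x)"

lemma A_hol': "\<rho> \<le> r \<Longrightarrow> cvec_holomorphic (A j k l) (ball z \<rho>)"
  by (rule hol_subset[OF A_hol]) auto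

lemma ray_operator_holomorphic:
  assumes "\<rho> \<le> r" and v: "\<And>l. cvec_holomorphic (\<lambda>x. v x l) (ball z \<rho>)"
  shows "cvec_holomorphic (\<lambda>x. ray_operator v x k) (ball z \<rho>)"
  unfolding ray_operator_def
proof (rule hol_integral)
  have "continuous_on (ball z \<rho> \<times> {0..1}) (\<lambda>p. ray_integrand v k (fst p) (snd p))"
    unfolding ray_integrand_def
    by (intro continuous_intros continuous_on_comp_ray_pt[OF A_hol'[OF assms(1)]]
        continuous_on_comp_ray_pt[OF v]) auto
  then show "continuous_on (ball z \<rho> \<times> {0..1}) (\<lambda>(x, t). ray_integrand v k x t)"
    by (simp add: split_beta)
  show "cvec_holomorphic (\<lambda>x. ray_integrand v k x t) (ball z \<rho>)" if t: "t \<in> {0..1}" for t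
    unfolding ray_integrand_def vector_minus_component
    by (intro hol_intros hol_comp_ray_pt[OF v t]
        hol_comp_ray_pt[OF A_hol'[OF assms(1)] t])
qed simp

lemma ray_integrand_integrable:
  assumes "\<rho> \<le> r" and v: "\<And>l. cvec_holomorphic (\<lambda>x. v x l) (ball z \<rho>)" and x: "x \<in> ball z \<rho>"
  shows "ray_integrand v k x integrable_on {0..1}"
proof -
  have "continuous_on {0..1} (ray_integrand v k x)"
    unfolding ray_integrand_def
    by (intro continuous_intros continuous_on_comp_ray_pt[OF A_hol'[OF assms(1)]]
        continuous_on_comp_ray_pt[OF v]) (use x in auto)
  then show ?thesis by (rule integrable_continuous_interval)
qed

lemma ray_operator_bound:
  assumes "\<rho> \<le> r" and v: "\<And>l. cvec_holomorphic (\<lambda>x. v x l) (ball z \<rho>)"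
    and c: "\<And>x l. x \<in> ball z \<rho> \<Longrightarrow> norm (v x l) \<le> c" and x: "x \<in> ball z \<rho>"
  shows "norm (ray_operator v x k) \<le> c / 2"
proof -
  have "norm (ray_integrand v k x s) \<le> c / 2" if s: "s \<in> {0..1}" for s
  proof -
    let ?y = "ray_pt z x s"
    have y: "?y \<in> ball z \<rho>" by (rule ray_pt_in_ball[OF x s])
    then have yr: "?y \<in> ball z r" using assms(1) by auto
    have r0: "r \<ge> 0" using yr by (metis ball_eq_empty empty_iff linorder_le_cases)
    have c0: "c \<ge> 0" using c[OF x] norm_ge_zero order_trans by metis
    have "norm (ray_integrand v k x s) \<le> (\<Sum>j\<in>UNIV. \<Sum>l\<in>UNIV. norm ((x - z) $ j * A j k l ?y * v ?y l))"
      unfolding ray_integrand_def by (intro norm_sum[THEN order_trans] sum_mono order_refl)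
    also have "\<dots> \<le> (\<Sum>j\<in>UNIV. \<Sum>l\<in>UNIV. r * norm (A j k l ?y) * c)"
    proof (intro sum_mono)
      fix j l
      have "norm ((x - z) $ j) \<le> r"
        using cmod_vec_nth_le[of "x - z" j] x assms(1) by (auto simp: dist_norm norm_minus_commute)
      then show "norm ((x - z) $ j * A j k l ?y * v ?y l) \<le> r * norm (A j k l ?y) * c"
        using c[OF y, of l] c0 r0 unfolding norm_mult by (intro mult_mono) auto
    qed
    also have "\<dots> = r * c * (\<Sum>j\<in>UNIV. \<Sum>l\<in>UNIV. norm (A j k l ?y))"
      by (simp add: sum_distrib_left ac_simps)
    also have "\<dots> \<le> r * c * K"
      using A_bound[OF yr, of k] c0 r0 by (intro mult_left_mono) auto
    also have "\<dots> \<le> c / 2"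
      using mult_right_mono[OF small c0] by (simp add: mult.commute mult.left_commute)
    finally show ?thesis .
  qed
  then have "norm (integral {0..1} (ray_integrand v k x)) \<le> integral {0..1} (\<lambda>s::real. c / 2)"
    using ray_integrand_integrable[OF assms(1) v x] by (intro integral_norm_bound_integral) auto
  then show ?thesis by (simp add: ray_operator_def)
qed

lemma ray_operator_diff:
  assumes "\<rho> \<le> r" and v: "\<And>l. cvec_holomorphic (\<lambda>x. v x l) (ball z \<rho>)"
    and w: "\<And>l. cvec_holomorphic (\<lambda>x. w x l) (ball z \<rho>)" and x: "x \<in> ball z \<rho>"
  shows "ray_operator (\<lambda>x l. v x l - w x l) x k = ray_operator v x k - ray_operator w x k"
proof -
  have "ray_integrand (\<lambda>x l. v x l - w x l) k x = (\<lambda>s. ray_integrand v k x s - ray_integrand w k x s)"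
    by (rule ext) (simp only: ray_integrand_def right_diff_distrib sum_subtractf)
  then show ?thesis
    unfolding ray_operator_def
    using integral_diff[OF ray_integrand_integrable[OF assms(1) v x] ray_integrand_integrable[OF assms(1) w x]]
    by simp
qed

text \<open>
  On a smaller closed ball \<open>v\<close> is bounded, and each application of the operator halves the bound.
\<close>

lemma ray_operator_fixpoint_zero:
  assumes "\<rho> \<le> r" and v: "\<And>l. cvec_holomorphic (\<lambda>x. v x l) (ball z \<rho>)"
    and fixed: "\<And>x k. x \<in> ball z \<rho> \<Longrightarrow> v x k = ray_operator v x k" and x: "x \<in> ball z \<rho>"
  shows "v x k = 0"
proof -
  obtain \<rho>' where \<rho>': "dist z x < \<rho>'" "\<rho>' < \<rho>" using x dense by auto
  have sub: "cball z \<rho>' \<subseteq> ball z \<rho>" using \<rho>' by auto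
  have "\<exists>c. \<forall>y\<in>cball z \<rho>'. norm (v y l) \<le> c" for l
  proof -
    have "compact ((\<lambda>x. v x l) ` cball z \<rho>')"
      using hol_continuous_on[OF v] sub
      by (intro compact_continuous_image) (auto intro: continuous_on_subset)
    then show ?thesis using compact_imp_bounded bounded_iff by (metis image_eqI)
  qed
  then obtain c where c: "\<And>l y. y \<in> cball z \<rho>' \<Longrightarrow> norm (v y l) \<le> c l" by metis
  define C where "C = (\<Sum>l\<in>UNIV. \<bar>c l\<bar>)"
  have C: "norm (v y l) \<le> C" if "y \<in> ball z \<rho>'" for y l
  proof -
    have "norm (v y l) \<le> \<bar>c l\<bar>" using c[of y l] that by auto
    also have "\<dots> \<le> C" unfolding C_def by (rule member_le_sum) auto
    finally show ?thesis .
  qed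
  have v': "cvec_holomorphic (\<lambda>x. v x l) (ball z \<rho>')" for l
    by (rule hol_subset[OF v]) (use \<rho>' in auto)
  have le: "norm (v y l) \<le> C / 2 ^ n" if "y \<in> ball z \<rho>'" for y l n
    using that
  proof (induction n arbitrary: y l)
    case 0 then show ?case using C by simp
  next
    case (Suc n)
    have "norm (ray_operator v y l) \<le> (C / 2 ^ n) / 2"
      by (rule ray_operator_bound[of \<rho>']) (use \<rho>' assms(1) v' Suc in auto)
    then show ?case using fixed[of y l] Suc.prems \<rho>' by simp
  qed
  have "norm (v x k) \<le> 0"
    by (rule LIMSEQ_le_const[OF geometric_bound_tendsto_0]) (use le[of x k] \<rho>' in auto)
  then show ?thesis by simp
qed

text \<open>
  A solution of the full system satisfies the integral equation: integrate its derivative along the ray.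
\<close>

lemma ray_operator_pfaffian:
  assumes "\<rho> \<le> r" and v: "\<And>l. cvec_holomorphic (\<lambda>x. v x l) (ball z \<rho>)"
    and pde: "\<And>x j k. x \<in> ball z \<rho> \<Longrightarrow> partial_deriv j (\<lambda>x. v x k) x = (\<Sum>l\<in>UNIV. A j k l x * v x l)"
    and x: "x \<in> ball z \<rho>"
  shows "v x k = v z k + ray_operator v x k"
proof -
  have "((\<lambda>s. v (ray_pt z x s) k) has_vector_derivative ray_integrand v k x s) (at s within {0..1})"
    if s: "s \<in> {0..1}" for s
    using has_vector_derivative_along_ray[OF v x s, of k "{0..1}"] pde[OF ray_pt_in_ball[OF x s]]
    by (simp add: ray_integrand_def sum_distrib_left mult.assoc)
  then have "(ray_integrand v k x has_integral (v (ray_pt z x 1) k - v (ray_pt z x 0) k)) {0..1}"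
    by (intro fundamental_theorem_of_calculus) auto
  then show ?thesis by (simp add: ray_operator_def integral_unique)
qed

text \<open>
  Picard iteration: the \<open>n\<close>-th correction \<open>d n\<close> is bounded by a multiple of \<open>1 / 2 ^ n\<close>, so the series converges
  uniformly on the ball.
\<close>

theorem ray_solution_exists:
  obtains y where "\<And>k. cvec_holomorphic (\<lambda>x. y x k) (ball z r)"
    "\<And>x k. x \<in> ball z r \<Longrightarrow> y x k = y0 k + ray_operator y x k"
proof -
  define d where "d = rec_nat (\<lambda>x. y0) (\<lambda>n v. ray_operator v)"
  have d0: "d 0 = (\<lambda>x. y0)" and dS: "d (Suc n) = ray_operator (d n)" for n
    by (simp_all add: d_def)
  have hol: "cvec_holomorphic (\<lambda>x. d n x k) (ball z r)" for n k
    by (induction n arbitrary: k) (auto simp: d0 dS intro: hol_const ray_operator_holomorphic)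
  define C where "C = (\<Sum>l\<in>UNIV. norm (y0 l))"
  have bound: "norm (d n x k) \<le> C / 2 ^ n" if "x \<in> ball z r" for n x k
    using that
  proof (induction n arbitrary: x k)
    case 0 show ?case unfolding d0 C_def using member_le_sum[of k UNIV "\<lambda>l. norm (y0 l)"] by simp
  next
    case (Suc n)
    have "norm (ray_operator (d n) x k) \<le> (C / 2 ^ n) / 2"
      by (rule ray_operator_bound[of r]) (use hol Suc in auto)
    then show ?case by (simp add: dS)
  qed
  define S where "S N x k = (\<Sum>n<N. d n x k)" for N x k
  define y where "y x k = (\<Sum>n. d n x k)" for x k
  have holS: "cvec_holomorphic (\<lambda>x. S N x k) (ball z r)" for N k
    unfolding S_def by (intro hol_sum hol)
  have summ: "summable (\<lambda>n. C / 2 ^ n)"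
    using summable_mult[OF summable_geometric[of "1 / 2 :: real"], of C] by (simp add: power_divide)
  have ul: "uniform_limit (ball z r) (\<lambda>N x. S N x k) (\<lambda>x. y x k) sequentially" for k
    unfolding S_def y_def by (rule Weierstrass_m_test[OF _ summ]) (use bound in auto)
  have holy: "cvec_holomorphic (\<lambda>x. y x k) (ball z r)" for k
  proof (rule hol_uniform_limit[OF open_ball holS])
    fix x assume "x \<in> ball z r"
    then obtain e where "e > 0" "cball x e \<subseteq> ball z r" using open_contains_cball open_ball by blast
    then show "\<exists>d>0. cball x d \<subseteq> ball z r \<and> uniform_limit (cball x d) (\<lambda>N x. S N x k) (\<lambda>x. y x k) sequentially"
      using uniform_limit_on_subset[OF ul] by blast
  qed
  have tail: "norm (y x k - S N x k) \<le> 2 * C / 2 ^ N" if "x \<in> ball z r" for x k N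
  proof -
    have sd: "summable (\<lambda>n. d n x k)"
      by (rule summable_comparison_test'[OF summ]) (use bound that in auto)
    have "y x k - S N x k = (\<Sum>n. d (n + N) x k)"
      unfolding y_def S_def using suminf_minus_initial_segment[OF sd, of N] by simp
    also have "norm \<dots> \<le> (\<Sum>n. (C / 2 ^ N) * (1 / 2) ^ n)"
    proof (rule norm_suminf_le)
      show "norm (d (n + N) x k) \<le> C / 2 ^ N * (1 / 2) ^ n" for n
        using bound[OF that, of "n + N" k] by (simp add: power_add power_divide mult.commute)
      show "summable (\<lambda>n. (C / 2 ^ N) * (1 / 2) ^ n)" by (intro summable_mult summable_geometric) simp
    qed
    also have "\<dots> = 2 * C / 2 ^ N"
      by (subst suminf_mult) (auto simp: suminf_geometric summable_geometric)
    finally show ?thesis .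
  qed
  have SS: "S (Suc N) x k = y0 k + ray_operator (S N) x k" if x: "x \<in> ball z r" for N x k
  proof -
    have "ray_operator (S N) x k = (\<Sum>n<N. ray_operator (d n) x k)"
    proof (induction N)
      case 0
      have "ray_integrand (S 0) k x = (\<lambda>s. 0)" by (simp add: S_def ray_integrand_def fun_eq_iff)
      then show ?case by (simp add: ray_operator_def)
    next
      case (Suc N)
      have "d N = (\<lambda>x k. S (Suc N) x k - S N x k)" by (simp add: S_def fun_eq_iff)
      then have "ray_operator (d N) x k = ray_operator (\<lambda>x k. S (Suc N) x k - S N x k) x k"
        by (rule arg_cong)
      also have "\<dots> = ray_operator (S (Suc N)) x k - ray_operator (S N) x k"
        by (rule ray_operator_diff[OF order_refl holS holS x])
      finally show ?case using Suc by simp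
    qed
    moreover have "S (Suc N) x k = d 0 x k + (\<Sum>n<N. d (Suc n) x k)"
      unfolding S_def by (rule sum.lessThan_Suc_shift)
    ultimately show ?thesis by (simp add: d0 dS)
  qed
  show thesis
  proof (rule that[OF holy])
    fix x k assume x: "x \<in> ball z r"
    have "norm (y0 k + ray_operator y x k - y x k) \<le> 2 * C / 2 ^ N" for N
    proof -
      have "norm (ray_operator (\<lambda>x l. y x l - S N x l) x k) \<le> (2 * C / 2 ^ N) / 2"
        by (rule ray_operator_bound[of r]) (use tail x in \<open>auto intro: hol_diff holy holS\<close>)
      then have 1: "norm (ray_operator y x k - ray_operator (S N) x k) \<le> C / 2 ^ N"
        using ray_operator_diff[OF order_refl holy holS x] by simp
      have 2: "norm (S (Suc N) x k - y x k) \<le> C / 2 ^ N"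
        using tail[OF x, of k "Suc N"] by (simp add: norm_minus_commute)
      have "y0 k + ray_operator y x k - y x k =
          (ray_operator y x k - ray_operator (S N) x k) + (S (Suc N) x k - y x k)"
        using SS[OF x] by simp
      then have "norm (y0 k + ray_operator y x k - y x k) \<le>
          norm (ray_operator y x k - ray_operator (S N) x k) + norm (S (Suc N) x k - y x k)"
        by (simp only: norm_triangle_ineq)
      then show ?thesis using 1 2 by simp
    qed
    then have "norm (y0 k + ray_operator y x k - y x k) \<le> 0"
      by (intro LIMSEQ_le_const[OF geometric_bound_tendsto_0]) auto
    then show "y x k = y0 k + ray_operator y x k" by simp
  qed
qed

end

section \<open>Linearization of the Riccati system\<close>

text \<open>
  The right-hand side of the linear system in the direction \<open>a\<^sub>j\<close>. The diagonal component is chosen so that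
  the sum of all components is zero, which preserves the relation \<open>\<Sum> y\<^sub>m = 0\<close>.
\<close>

definition residue_flow ::
    "('n::finite + bool \<Rightarrow> complex) \<Rightarrow> 'n \<Rightarrow> complex ^ 'n \<Rightarrow> ('n + bool \<Rightarrow> complex) \<Rightarrow> 'n + bool \<Rightarrow> complex" where
  "residue_flow \<theta> j a y i =
     (let e = (\<lambda>m. (\<theta> (Inl j) * y m - \<theta> m * y (Inl j)) / (sing_pt a m - a $ j))
      in if i = Inl j then - (\<Sum>m\<in>UNIV - {Inl j}. e m) else e i)"

lemma residue_flow_off:
  "i \<noteq> Inl j \<Longrightarrow> residue_flow \<theta> j a y i = (\<theta> (Inl j) * y i - \<theta> i * y (Inl j)) / (sing_pt a i - a $ j)"
  by (simp add: residue_flow_def Let_def)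

lemma residue_flow_diag:
  "residue_flow \<theta> j a y (Inl j) = - (\<Sum>m\<in>UNIV - {Inl j}. residue_flow \<theta> j a y m)"
  unfolding residue_flow_def Let_def by simp

lemma residue_flow_linear:
  "residue_flow \<theta> j a y i = (\<Sum>l\<in>UNIV. residue_flow \<theta> j a (\<lambda>m. of_bool (m = l)) i * y l)"
proof -
  have off: "residue_flow \<theta> j a y i = (\<Sum>l\<in>UNIV. residue_flow \<theta> j a (\<lambda>m. of_bool (m = l)) i * y l)"
    if "i \<noteq> Inl j" for i
  proof -
    have "(\<Sum>l\<in>UNIV. residue_flow \<theta> j a (\<lambda>m. of_bool (m = l)) i * y l) =
        (\<Sum>l\<in>UNIV. (if i = l then \<theta> (Inl j) * y l / (sing_pt a i - a $ j) else 0)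
           - (if Inl j = l then \<theta> i * y l / (sing_pt a i - a $ j) else 0))"
      by (rule sum.cong) (auto simp: residue_flow_off[OF that] diff_divide_distrib)
    also have "\<dots> = \<theta> (Inl j) * y i / (sing_pt a i - a $ j) - \<theta> i * y (Inl j) / (sing_pt a i - a $ j)"
      by (simp add: sum_subtractf)
    finally show ?thesis by (simp add: residue_flow_off[OF that] diff_divide_distrib)
  qed
  show ?thesis
  proof (cases "i = Inl j")
    case True
    have "residue_flow \<theta> j a y (Inl j) =
        - (\<Sum>m\<in>UNIV - {Inl j}. \<Sum>l\<in>UNIV. residue_flow \<theta> j a (\<lambda>m. of_bool (m = l)) m * y l)"
      unfolding residue_flow_diag[of \<theta> j a y] using off by (intro arg_cong[of _ _ uminus] sum.cong) auto
    also have "\<dots> = (\<Sum>l\<in>UNIV. residue_flow \<theta> j a (\<lambda>m. of_bool (m = l)) (Inl j) * y l)"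
      by (subst sum.swap) (simp add: residue_flow_diag[of \<theta> j a "\<lambda>m. of_bool (m = _)"] sum_distrib_right sum_negf)
    finally show ?thesis using True by simp
  qed (rule off)
qed

lemma residue_flow_scale:
  "residue_flow \<theta> j a (\<lambda>m. t * y m) i = t * residue_flow \<theta> j a y i"
  by (subst (1 2) residue_flow_linear) (simp add: sum_distrib_left ac_simps)

lemma sing_pt_simps [simp]:
  "sing_pt a (Inl i) = a $ i" "sing_pt a (Inr False) = 0" "sing_pt a (Inr True) = 1"
  by (simp_all add: sing_pt_def)

lemma sing_pt_inj: "a \<in> garnier_base \<Longrightarrow> sing_pt a l = sing_pt a m \<longleftrightarrow> l = m"
  unfolding garnier_base_def sing_pt_def by (auto split: sum.splits if_splits)

lemma sing_pt_diff_nonzero: "a \<in> garnier_base \<Longrightarrow> m \<noteq> Inl j \<Longrightarrow> sing_pt a m - a $ j \<noteq> 0"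
  using sing_pt_inj[of a m "Inl j"] by simp

lemma hol_sing_pt: "cvec_holomorphic (\<lambda>a. sing_pt a m) S"
  unfolding sing_pt_def by (cases m) (simp_all add: hol_intros)

lemma hol_residue_flow:
  assumes "S \<subseteq> garnier_base" "\<And>m. cvec_holomorphic (y m) S"
  shows "cvec_holomorphic (\<lambda>a. residue_flow \<theta> j a (\<lambda>m. y m a) i) S"
proof -
  have off: "cvec_holomorphic (\<lambda>a. residue_flow \<theta> j a (\<lambda>m. y m a) m) S" if "m \<noteq> Inl j" for m
    unfolding residue_flow_off[OF that]
    by (intro hol_intros hol_sing_pt assms)
       (use sing_pt_diff_nonzero[OF _ that] assms in auto)
  show ?thesis
  proof (cases "i = Inl j")
    case True
    show ?thesis unfolding True residue_flow_diag
      by (intro hol_intros off) auto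
  qed (rule off)
qed

lemma UNIV_plus_bool: "(UNIV :: ('a + bool) set) = insert (Inr False) (insert (Inr True) (range Inl))"
proof -
  have "m = Inr False \<or> m = Inr True \<or> m \<in> range Inl" for m :: "'a + bool"
  proof (cases m)
    case (Inr b)
    then show ?thesis by (cases b) auto
  qed auto
  then show ?thesis by auto
qed

lemma sum_UNIV_plus_bool:
  fixes f :: "'n::finite + bool \<Rightarrow> 'a::comm_monoid_add"
  shows "(\<Sum>m\<in>UNIV. f m) = (\<Sum>i\<in>UNIV. f (Inl i)) + (f (Inr False) + f (Inr True))"
proof -
  have "(\<Sum>m\<in>UNIV. f m) = sum f (insert (Inr False) (insert (Inr True) (range Inl)))"
    by (simp only: UNIV_plus_bool[symmetric])
  also have "\<dots> = f (Inr False) + (f (Inr True) + (\<Sum>i\<in>UNIV. f (Inl i)))"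
    by (subst sum.insert, simp, force)+ (simp add: sum.reindex)
  finally show ?thesis by (simp add: ac_simps)
qed

lemma partial_deriv_sum:
  assumes "\<And>i. i \<in> I \<Longrightarrow> cvec_holomorphic (f i) S" "x \<in> S"
  shows "partial_deriv j (\<lambda>x. \<Sum>i\<in>I. f i x) x = (\<Sum>i\<in>I. partial_deriv j (f i) x)"
  by (rule partial_deriv_eqI) (intro DERIV_sum hol_coord_deriv[OF assms(1) assms(2)])

text \<open>
  The linear lift described at the beginning. The denominator \<open>\<psi>\<close> marks where the meromorphic \<open>G\<^sub>m\<close>
  may have poles, and \<open>x0\<close> is an arbitrary point, possibly a pole.
\<close>

theorem riccati_linearization:
  fixes G :: "'n::finite + bool \<Rightarrow> complex ^ 'n \<Rightarrow> complex"
  assumes r0: "r0 > 0" "ball x0 r0 \<subseteq> garnier_base"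
    and \<psi>: "cvec_holomorphic \<psi> (ball x0 r0)" and q: "q \<in> ball x0 r0" "\<psi> q \<noteq> 0"
    and G: "\<And>m. cvec_holomorphic (G m) {x \<in> ball x0 r0. \<psi> x \<noteq> 0}"
    and sum0: "\<And>x. x \<in> ball x0 r0 \<Longrightarrow> \<psi> x \<noteq> 0 \<Longrightarrow> (\<Sum>m\<in>UNIV. G m x) = 0"
    and sum1: "\<And>x. x \<in> ball x0 r0 \<Longrightarrow> \<psi> x \<noteq> 0 \<Longrightarrow> (\<Sum>m\<in>UNIV. sing_pt x m * G m x) = 1"
    and ric: "\<And>x j i. x \<in> ball x0 r0 \<Longrightarrow> \<psi> x \<noteq> 0 \<Longrightarrow> i \<noteq> Inl j \<Longrightarrow>
       partial_deriv j (G i) x = residue_flow \<theta> j x (\<lambda>m. G m x) i - c * G i x * G (Inl j) x"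
  obtains \<rho> L y where "\<rho> > 0" "\<rho> \<le> r0" "cvec_holomorphic L (ball x0 \<rho>)"
    "\<And>m. cvec_holomorphic (y m) (ball x0 \<rho>)"
    "\<And>x m. x \<in> ball x0 \<rho> \<Longrightarrow> \<psi> x \<noteq> 0 \<Longrightarrow> y m x = L x * G m x"
    "L x0 = 0 \<Longrightarrow> \<exists>j. partial_deriv j L x0 \<noteq> 0"
proof -
  let ?D = "{x \<in> ball x0 r0. \<psi> x \<noteq> 0}"
  have openD: "open ?D" by (rule open_nonzero_set[OF open_ball \<psi>])
  \<comment> \<open>The Riccati equation for \<open>i = j\<close> follows from the others and \<open>\<Sum> G\<^sub>m = 0\<close>.\<close>
  have ric': "partial_deriv j (G i) x = residue_flow \<theta> j x (\<lambda>m. G m x) i - c * G i x * G (Inl j) x"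
    if x: "x \<in> ?D" for x j i
  proof (cases "i = Inl j")
    case True
    have eq: "- (\<Sum>m\<in>UNIV - {Inl j}. G m x) = G (Inl j) x" if "x \<in> ?D" for x
      using sum0[of x] that sum.remove[of UNIV "Inl j" "\<lambda>m. G m x"]
      by (simp add: neg_eq_iff_add_eq_0 add.commute)
    have "partial_deriv j (G (Inl j)) x = partial_deriv j (\<lambda>x. \<Sum>m\<in>UNIV - {Inl j}. (- 1) * G m x) x"
      by (rule partial_deriv_cong[OF openD _ x]) (simp add: eq[symmetric] sum_negf)
    also have "\<dots> = (\<Sum>m\<in>UNIV - {Inl j}. partial_deriv j (\<lambda>x. (- 1) * G m x) x)"
      by (rule partial_deriv_sum[OF _ x]) (intro hol_intros G)
    also have "\<dots> = (\<Sum>m\<in>UNIV - {Inl j}. - partial_deriv j (G m) x)"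
      using partial_deriv_mult[OF hol_const G x, of _ "- 1"]
      by (intro sum.cong refl) (simp add: partial_deriv_def)
    also have "\<dots> = (\<Sum>m\<in>UNIV - {Inl j}. - residue_flow \<theta> j x (\<lambda>m. G m x) m + c * G m x * G (Inl j) x)"
      by (rule sum.cong) (use ric x in auto)
    also have "\<dots> = residue_flow \<theta> j x (\<lambda>m. G m x) (Inl j) + c * (\<Sum>m\<in>UNIV - {Inl j}. G m x) * G (Inl j) x"
      unfolding residue_flow_diag by (simp add: sum.distrib sum_negf sum_subtractf sum_distrib_left sum_distrib_right)
    also have "(\<Sum>m\<in>UNIV - {Inl j}. G m x) = - G (Inl j) x"
      unfolding eq[OF x, symmetric] by simp
    finally show ?thesis using True by simp
  qed (use ric x in auto)
  define A where "A j k l x = residue_flow \<theta> j x (\<lambda>m. of_bool (m = l)) k" for j :: 'n and k l :: "'n + bool" and x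
  have A: "cvec_holomorphic (A j k l) (ball x0 r0)" for j k l
    unfolding A_def[abs_def] by (rule hol_residue_flow[OF r0(2) hol_const])
  have A_flow: "(\<Sum>l\<in>UNIV. A j k l x * v l) = residue_flow \<theta> j x v k" for j k x v
    unfolding A_def by (rule residue_flow_linear[symmetric])
  define N where "N x = (\<Sum>k\<in>UNIV. \<Sum>j\<in>UNIV. \<Sum>l\<in>UNIV. norm (A j k l x))" for x
  have "compact (N ` cball x0 (r0 / 2))"
  proof (rule compact_continuous_image)
    have "continuous_on (cball x0 (r0 / 2)) (A j k l)" for j k l
      using hol_continuous_on[OF A] by (rule continuous_on_subset) (use r0 in auto)
    then show "continuous_on (cball x0 (r0 / 2)) N"
      unfolding N_def by (intro continuous_intros)
  qed simp
  then obtain K where K: "K > 0" "\<And>x. x \<in> cball x0 (r0 / 2) \<Longrightarrow> norm (N x) \<le> K"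
    using compact_imp_bounded bounded_pos by (metis image_eqI)
  define R where "R = min (r0 / 4) (1 / (2 * K))"
  have R: "R > 0" "K * R \<le> 1 / 2" "R \<le> r0 / 4"
    using K r0 by (auto simp: R_def min_def field_simps)
  \<comment> \<open>\<open>R\<close> is fixed before \<open>z\<close>, so a ball of radius \<open>R\<close> around a regular point \<open>z\<close> close to \<open>x0\<close>
    still contains a neighbourhood of \<open>x0\<close>.\<close>
  obtain z where z: "z \<in> ball x0 (R / 3)" "\<psi> z \<noteq> 0"
    by (rule nonzero_on_subball[OF convex_ball open_ball \<psi> q, of x0 "R / 3"]) (use R in auto)
  have subR: "ball z R \<subseteq> cball x0 (r0 / 2)"
  proof
    fix x assume "x \<in> ball z R"
    then show "x \<in> cball x0 (r0 / 2)" using z R dist_triangle[of x0 x z] by auto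
  qed
  then have subR': "ball z R \<subseteq> ball x0 r0" using r0 by auto
  interpret rs: linear_ray_system A z R K
  proof
    show "cvec_holomorphic (A j k l) (ball z R)" for j k l
      by (rule hol_subset[OF A subR'])
    show "(\<Sum>j\<in>UNIV. \<Sum>l\<in>UNIV. norm (A j k l x)) \<le> K" if "x \<in> ball z R" for x k
    proof -
      have "(\<Sum>j\<in>UNIV. \<Sum>l\<in>UNIV. norm (A j k l x)) \<le> N x"
        unfolding N_def by (rule member_le_sum) (auto intro!: sum_nonneg)
      also have "\<dots> \<le> K" using K(2)[of x] subR that by auto
      finally show ?thesis .
    qed
  qed (use R in auto)
  have zD: "z \<in> ?D" using z R by auto
  then obtain \<rho>0 where "\<rho>0 > 0" "ball z \<rho>0 \<subseteq> ?D" using openD open_contains_ball by blast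
  then obtain \<rho>' where \<rho>': "\<rho>' > 0" "\<rho>' \<le> R" "ball z \<rho>' \<subseteq> ?D"
    using R(1) by (intro that[of "min \<rho>0 R"]) auto
  have G\<rho>: "cvec_holomorphic (G m) (ball z \<rho>')" for m
    using G \<rho>'(3) hol_subset by blast
  \<comment> \<open>The form \<open>\<Sum> G\<^sub>j da\<^sub>j\<close> is closed: both \<open>(\<theta>\<^sub>j G\<^sub>i - \<theta>\<^sub>i G\<^sub>j) / (a\<^sub>i - a\<^sub>j)\<close> and \<open>c G\<^sub>i G\<^sub>j\<close> are
    symmetric in \<open>i\<close> and \<open>j\<close>.\<close>
  obtain \<Lambda> where \<Lambda>: "cvec_holomorphic \<Lambda> (ball z \<rho>')" "\<Lambda> z = 0"
    "\<And>j x. x \<in> ball z \<rho>' \<Longrightarrow> partial_deriv j \<Lambda> x = G (Inl j) x"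
  proof (rule closed_form_primitive[of "\<lambda>j. G (Inl j)" z \<rho>'])
    show "partial_deriv j (G (Inl i)) x = partial_deriv i (G (Inl j)) x" if "x \<in> ball z \<rho>'" for i j x
    proof (cases "i = j")
      case False
      then have ne: "Inl i \<noteq> (Inl j :: 'n + bool)" "Inl j \<noteq> (Inl i :: 'n + bool)" by auto
      have x: "x \<in> ?D" using that \<rho>' by auto
      have flip: "(p - r) / (b - d) = (r - p) / (d - b)" for p r b d :: complex
        by (metis minus_diff_eq minus_divide_divide)
      show ?thesis
        unfolding ric'[OF x] residue_flow_off[OF ne(1)] residue_flow_off[OF ne(2)]
        using flip[of "\<theta> (Inl j) * G (Inl i) x" "\<theta> (Inl i) * G (Inl j) x" "x $ i" "x $ j"] by simp
    qed simp
  qed (use G\<rho> in auto)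
  define Lt where "Lt x = exp (c * \<Lambda> x)" for x
  have Lt: "cvec_holomorphic Lt (ball z \<rho>')"
    unfolding Lt_def by (intro hol_intros \<Lambda>)
  have dLt: "partial_deriv j Lt x = c * G (Inl j) x * Lt x" if x: "x \<in> ball z \<rho>'" for j x
  proof (rule partial_deriv_eqI)
    show "((\<lambda>w. Lt (coord_upd x j w)) has_field_derivative c * G (Inl j) x * Lt x) (at (x $ j))"
      unfolding Lt_def using hol_coord_deriv[OF \<Lambda>(1) x, of j] \<Lambda>(3)[OF x]
      by (auto intro!: derivative_eq_intros)
  qed
  define yt where "yt x m = Lt x * G m x" for x m
  have yt: "cvec_holomorphic (\<lambda>x. yt x m) (ball z \<rho>')" for m
    unfolding yt_def by (intro hol_intros Lt G\<rho>)
  have dyt: "partial_deriv j (\<lambda>x. yt x k) x = (\<Sum>l\<in>UNIV. A j k l x * yt x l)" if x: "x \<in> ball z \<rho>'" for x j k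
  proof -
    have "x \<in> ?D" using x \<rho>'(3) by blast
    then have "partial_deriv j (\<lambda>x. yt x k) x = Lt x * residue_flow \<theta> j x (\<lambda>m. G m x) k"
      unfolding yt_def using partial_deriv_mult[OF Lt G\<rho> x] dLt[OF x]
      by (simp add: ric' algebra_simps)
    then show ?thesis unfolding A_flow yt_def by (simp add: residue_flow_scale)
  qed
  obtain y where y: "\<And>k. cvec_holomorphic (\<lambda>x. y x k) (ball z R)"
    and y_eq: "\<And>x k. x \<in> ball z R \<Longrightarrow> y x k = G k z + rs.ray_operator y x k"
    using rs.ray_solution_exists[of "\<lambda>k. G k z"] by blast
  have y\<rho>: "cvec_holomorphic (\<lambda>x. y x k) (ball z \<rho>')" for k
    by (rule hol_subset[OF y]) (use \<rho>' in auto)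
  \<comment> \<open>The extended solution agrees with \<open>Lt G\<close> near \<open>z\<close> by uniqueness; all relations between the
    two then spread by the identity theorem.\<close>
  have near: "y x k = yt x k" if x: "x \<in> ball z \<rho>'" for x k
  proof -
    have "y x k - yt x k = 0"
    proof (rule rs.ray_operator_fixpoint_zero[OF \<rho>'(2) _ _ x])
      show "cvec_holomorphic (\<lambda>x. y x l - yt x l) (ball z \<rho>')" for l
        by (intro hol_intros y\<rho> yt)
      show "y x k - yt x k = rs.ray_operator (\<lambda>x l. y x l - yt x l) x k" if x: "x \<in> ball z \<rho>'" for x k
      proof -
        have "yt x k = yt z k + rs.ray_operator yt x k"
          by (rule rs.ray_operator_pfaffian[OF \<rho>'(2) yt dyt x])
        moreover have "yt z k = G k z" by (simp add: yt_def Lt_def \<Lambda>(2))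
        moreover have "y x k = G k z + rs.ray_operator y x k" using y_eq x \<rho>' by auto
        ultimately show ?thesis using rs.ray_operator_diff[OF \<rho>'(2) y\<rho> yt x] by simp
      qed
    qed
    then show ?thesis by simp
  qed
  have ident: "f x = 0" if "cvec_holomorphic f (ball z R)" "\<And>x. x \<in> ball z \<rho>' \<Longrightarrow> f x = 0" "x \<in> ball z R" for f x
    by (rule identity_theorem[OF convex_ball open_ball that(1), of "ball z \<rho>'" z]) (use that \<rho>' in auto)
  define L where "L x = (\<Sum>m\<in>UNIV. sing_pt x m * y x m)" for x
  have L: "cvec_holomorphic L (ball z R)"
    unfolding L_def by (intro hol_intros hol_sing_pt y)
  have L_near: "L x = Lt x" if x: "x \<in> ball z \<rho>'" for x
  proof -
    have "L x = Lt x * (\<Sum>m\<in>UNIV. sing_pt x m * G m x)"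
      unfolding L_def near[OF x] yt_def by (simp add: sum_distrib_left ac_simps)
    then show ?thesis using sum1[of x] x \<rho>'(3) by auto
  qed
  have Lz: "L z = 1" using L_near[of z] \<rho>' by (simp add: Lt_def \<Lambda>(2))
  have y_flow: "partial_deriv j (\<lambda>x. y x k) x = (\<Sum>l\<in>UNIV. A j k l x * y x l)" if "x \<in> ball z R" for x j k
  proof -
    have "partial_deriv j (\<lambda>x. y x k) x - (\<Sum>l\<in>UNIV. A j k l x * y x l) = 0"
    proof (rule ident[OF _ _ that])
      show "cvec_holomorphic (\<lambda>x. partial_deriv j (\<lambda>x. y x k) x - (\<Sum>l\<in>UNIV. A j k l x * y x l)) (ball z R)"
        by (intro hol_intros hol_partial_deriv y rs.A_hol open_ball)
      show "partial_deriv j (\<lambda>x. y x k) x - (\<Sum>l\<in>UNIV. A j k l x * y x l) = 0" if x: "x \<in> ball z \<rho>'" for x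
        using dyt[OF x] near[OF x] partial_deriv_cong[OF open_ball near x] by simp
    qed
    then show ?thesis by simp
  qed
  have dL: "partial_deriv j L x = c * y x (Inl j)" if "x \<in> ball z R" for x j
  proof -
    have "partial_deriv j L x - c * y x (Inl j) = 0"
    proof (rule ident[OF _ _ that])
      show "cvec_holomorphic (\<lambda>x. partial_deriv j L x - c * y x (Inl j)) (ball z R)"
        by (intro hol_intros hol_partial_deriv y L open_ball)
      show "partial_deriv j L x - c * y x (Inl j) = 0" if x: "x \<in> ball z \<rho>'" for x
        using dLt[OF x] near[OF x] partial_deriv_cong[OF open_ball L_near x] by (simp add: yt_def)
    qed
    then show ?thesis by simp
  qed
  have sumy: "(\<Sum>m\<in>UNIV. y x m) = 0" if "x \<in> ball z R" for x
  proof (rule ident[OF _ _ that])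
    show "cvec_holomorphic (\<lambda>x. \<Sum>m\<in>UNIV. y x m) (ball z R)" by (intro hol_intros y)
    show "(\<Sum>m\<in>UNIV. y x m) = 0" if x: "x \<in> ball z \<rho>'" for x
      unfolding near[OF x] yt_def using sum0[of x] x \<rho>'(3) by (auto simp flip: sum_distrib_left)
  qed
  have yLG: "y x m = L x * G m x" if x: "x \<in> ball z R" "\<psi> x \<noteq> 0" for x m
  proof -
    have sub: "{x \<in> ball z R. \<psi> x \<noteq> 0} \<subseteq> ?D" using subR' by blast
    have "y x m - L x * G m x = 0"
    proof (rule identity_theorem_off_zeros[OF convex_ball open_ball, of \<psi> z R z _ "ball z \<rho>'" z])
      show "cvec_holomorphic \<psi> (ball z R)" by (rule hol_subset[OF \<psi> subR'])
      show "cvec_holomorphic (\<lambda>x. y x m - L x * G m x) {x \<in> ball z R. \<psi> x \<noteq> 0}"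
        by (intro hol_intros hol_subset[OF y] hol_subset[OF L]
            hol_subset[OF G sub]) auto
      show "y x m - L x * G m x = 0" if x: "x \<in> ball z \<rho>'" for x
        using near[OF x] L_near[OF x] by (simp add: yt_def)
    qed (use \<rho>' R z x in auto)
    then show ?thesis by simp
  qed
  define \<rho> where "\<rho> = 2 * R / 3"
  have sub: "ball x0 \<rho> \<subseteq> ball z R"
  proof
    fix x assume "x \<in> ball x0 \<rho>"
    then show "x \<in> ball z R" using z dist_triangle[of z x x0] by (simp add: \<rho>_def dist_commute)
  qed
  have x0R: "x0 \<in> ball z R" using z R by (simp add: dist_commute)
  show thesis
  proof (rule that[of \<rho> L "\<lambda>m x. y x m"])
    show "\<rho> > 0" "\<rho> \<le> r0" using R by (auto simp: \<rho>_def)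
    show "cvec_holomorphic L (ball x0 \<rho>)" by (rule hol_subset[OF L sub])
    show "cvec_holomorphic (\<lambda>x. y x m) (ball x0 \<rho>)" for m by (rule hol_subset[OF y sub])
    show "y x m = L x * G m x" if "x \<in> ball x0 \<rho>" "\<psi> x \<noteq> 0" for x m using yLG that sub by blast
    show "\<exists>j. partial_deriv j L x0 \<noteq> 0" if Lx0: "L x0 = 0"
    proof (rule ccontr)
      assume no: "\<nexists>j. partial_deriv j L x0 \<noteq> 0"
      have "c \<noteq> 0"
      proof
        assume "c = 0"
        have "L x0 - 1 = 0"
          by (rule ident[OF _ _ x0R]) (auto intro!: hol_intros L simp: L_near Lt_def \<open>c = 0\<close>)
        with Lx0 show False by simp
      qed
      then have yj: "y x0 (Inl j) = 0" for j using dL[OF x0R, of j] no by auto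
      have y1: "y x0 (Inr True) = 0" using Lx0 yj by (simp add: L_def sum_UNIV_plus_bool)
      then have "y x0 (Inr False) = 0" using sumy[OF x0R] yj by (simp add: sum_UNIV_plus_bool)
      then have y0: "y x0 m = 0" for m
      proof (cases m)
        case (Inr b)
        then show ?thesis using y1 \<open>y x0 (Inr False) = 0\<close> by (cases b) auto
      qed (use yj in auto)
      \<comment> \<open>A solution of the linear system vanishing at \<open>x0\<close> vanishes on the ball around \<open>x0\<close>, which
        contains \<open>z\<close>, although \<open>L z = 1\<close>.\<close>
      interpret rx: linear_ray_system A x0 \<rho> K
      proof
        show "cvec_holomorphic (A j k l) (ball x0 \<rho>)" for j k l
          by (rule hol_subset[OF rs.A_hol sub])
        show "(\<Sum>j\<in>UNIV. \<Sum>l\<in>UNIV. norm (A j k l x)) \<le> K" if "x \<in> ball x0 \<rho>" for x k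
          using rs.A_bound that sub by blast
        show "K * \<rho> \<le> 1 / 2" using R(2) by (simp add: \<rho>_def)
      qed
      have yx: "cvec_holomorphic (\<lambda>x. y x k) (ball x0 \<rho>)" for k by (rule hol_subset[OF y sub])
      have flow: "partial_deriv j (\<lambda>x. y x k) x = (\<Sum>l\<in>UNIV. A j k l x * y x l)" if "x \<in> ball x0 \<rho>" for x j k
        using y_flow that sub by blast
      have "y x k = 0" if "x \<in> ball x0 \<rho>" for x k
      proof (rule rx.ray_operator_fixpoint_zero[OF order_refl yx _ that])
        show "y x k = rx.ray_operator y x k" if x: "x \<in> ball x0 \<rho>" for x k
          using rx.ray_operator_pfaffian[OF order_refl yx flow x] y0 by simp
      qed
      moreover have "z \<in> ball x0 \<rho>" using z R by (simp add: \<rho>_def)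
      ultimately have "L z = 0" by (simp add: L_def)
      with Lz show False by simp
    qed
  qed
qed

section \<open>Interpolation and symmetric functions\<close>

definition node_poly :: "('m \<Rightarrow> complex) \<Rightarrow> 'm set \<Rightarrow> complex poly" where
  "node_poly t S = (\<Prod>l\<in>S. [:- t l, 1:])"

text \<open>
  The residue at \<open>t m\<close> of the rational function \<open>q(x) / \<Prod>\<^sub>l (x - t l)\<close>.
\<close>

definition node_residue :: "('m::finite \<Rightarrow> complex) \<Rightarrow> complex poly \<Rightarrow> 'm \<Rightarrow> complex" where
  "node_residue t q m = poly q (t m) / (\<Prod>l\<in>UNIV - {m}. t m - t l)"

lemma poly_node_poly: "poly (node_poly t S) x = (\<Prod>l\<in>S. x - t l)"
  by (simp add: node_poly_def poly_prod)

lemma node_poly_insert: "finite S \<Longrightarrow> l \<notin> S \<Longrightarrow> node_poly t (insert l S) = [:- t l, 1:] * node_poly t S"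
  by (simp add: node_poly_def)

lemma node_poly_degree:
  assumes "finite S"
  shows "degree (node_poly t S) = card S \<and> coeff (node_poly t S) (card S) = 1"
  using assms
proof (induction S rule: finite_induct)
  case (insert l S)
  then have "node_poly t S \<noteq> 0" by auto
  then have "degree (node_poly t (insert l S)) = Suc (card S)"
    using insert by (simp add: node_poly_insert degree_mult_eq del: mult_pCons_left)
  moreover have "lead_coeff (node_poly t (insert l S)) = 1"
    using insert by (simp add: node_poly_insert lead_coeff_mult del: mult_pCons_left)
  ultimately show ?case using insert by simp
qed (simp add: node_poly_def)

theorem lagrange_interpolation:
  fixes t :: "'m::finite \<Rightarrow> complex"
  assumes t: "inj t" and q: "degree q < CARD('m)"
  shows "q = (\<Sum>m\<in>UNIV. smult (node_residue t q m) (node_poly t (UNIV - {m})))"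
proof (rule poly_eqI_degree[of "range t"])
  have card: "card (range t) = CARD('m)" by (rule card_image[OF t])
  show "degree q < card (range t)" using q card by simp
  have "degree (\<Sum>m\<in>UNIV. smult (node_residue t q m) (node_poly t (UNIV - {m}))) \<le> CARD('m) - 1"
    by (intro degree_sum_le) (auto intro!: degree_smult_le[THEN order_trans] simp: node_poly_degree)
  then show "degree (\<Sum>m\<in>UNIV. smult (node_residue t q m) (node_poly t (UNIV - {m}))) < card (range t)"
    using q card by simp
  fix x assume "x \<in> range t"
  then obtain m where m: "x = t m" by blast
  have "(\<Prod>l\<in>UNIV - {k}. t m - t l) = 0" if "k \<noteq> m" for k
    using that by (intro prod_zero) auto
  then have "poly (\<Sum>k\<in>UNIV. smult (node_residue t q k) (node_poly t (UNIV - {k}))) x =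
      node_residue t q m * (\<Prod>l\<in>UNIV - {m}. t m - t l)"
    unfolding poly_sum poly_smult poly_node_poly m
    by (subst sum.remove[of _ m], simp, simp, subst sum.neutral) simp_all
  moreover have "(\<Prod>l\<in>UNIV - {m}. t m - t l) \<noteq> 0" using t by (auto simp: inj_eq)
  ultimately show "poly q x = poly (\<Sum>k\<in>UNIV. smult (node_residue t q k) (node_poly t (UNIV - {k}))) x"
    by (simp add: node_residue_def m)
qed

text \<open>
  Compare leading coefficients in the interpolation formula.
\<close>

lemma sum_node_residue:
  fixes t :: "'m::finite \<Rightarrow> complex"
  assumes t: "inj t" and q: "degree q < CARD('m)"
  shows "(\<Sum>m\<in>UNIV. node_residue t q m) = coeff q (CARD('m) - 1)"
proof -
  have "coeff (node_poly t (UNIV - {m})) (CARD('m) - 1) = 1" for m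
    using node_poly_degree[of "UNIV - {m}" t] by simp
  then show ?thesis
    using arg_cong[OF lagrange_interpolation[OF assms], of "\<lambda>p. coeff p (CARD('m) - 1)"]
    by (simp add: coeff_sum)
qed

text \<open>
  With \<open>e 0 = 1\<close> and \<open>e i\<close> the elementary symmetric functions, the monic polynomial with the given roots.
\<close>

definition signed_poly :: "nat \<Rightarrow> (nat \<Rightarrow> complex) \<Rightarrow> complex poly" where
  "signed_poly n e = (\<Sum>i\<le>n. monom ((- 1) ^ i * e i) (n - i))"

lemma degree_signed_poly: "degree (signed_poly n e) \<le> n"
  unfolding signed_poly_def by (intro degree_sum_le) (auto intro: degree_monom_le[THEN order_trans])

lemma coeff_signed_poly: "i \<le> n \<Longrightarrow> coeff (signed_poly n e) (n - i) = (- 1) ^ i * e i"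
proof -
  assume i: "i \<le> n"
  have "coeff (signed_poly n e) (n - i) = (\<Sum>k\<le>n. if k = i then (- 1) ^ k * e k else 0)"
    unfolding signed_poly_def coeff_sum by (rule sum.cong) (use i in auto)
  then show ?thesis using i by simp
qed

lemma poly_signed_poly: "poly (signed_poly n e) x = (\<Sum>i\<le>n. (- 1) ^ i * e i * x ^ (n - i))"
  by (simp add: signed_poly_def poly_sum poly_monom)

lemma signed_poly_elem_sym:
  fixes u :: "complex ^ 'n"
  shows "signed_poly CARD('n) (\<lambda>i. elem_sym i u) = node_poly (\<lambda>k. u $ k) UNIV"
proof -
  let ?n = "CARD('n)"
  have "poly (node_poly (\<lambda>k. u $ k) UNIV) x = poly (signed_poly ?n (\<lambda>i. elem_sym i u)) x" for x
  proof -
    have "poly (node_poly (\<lambda>k. u $ k) UNIV) x = (\<Prod>k\<in>UNIV. - u $ k + x)"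
      by (simp add: poly_node_poly)
    also have "\<dots> = (\<Sum>X\<in>Pow UNIV. (\<Prod>k\<in>X. - u $ k) * (\<Prod>k\<in>UNIV - X. x))"
      by (rule prod_add) simp
    also have "\<dots> = (\<Sum>X\<in>Pow UNIV. (- 1) ^ card X * (\<Prod>k\<in>X. u $ k) * x ^ (?n - card X))"
      by (intro sum.cong refl) (simp add: prod_uminus card_Diff_subset)
    also have "\<dots> = (\<Sum>i\<le>?n. \<Sum>X\<in>{X \<in> Pow UNIV. card X = i}. (- 1) ^ card X * (\<Prod>k\<in>X. u $ k) * x ^ (?n - card X))"
      by (rule sum.group[symmetric]) (auto intro: card_mono)
    also have "\<dots> = poly (signed_poly ?n (\<lambda>i. elem_sym i u)) x"
      by (simp add: poly_signed_poly elem_sym_def sum_distrib_left sum_distrib_right ac_simps)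
    finally show ?thesis .
  qed
  then show ?thesis by (simp add: poly_eq_poly_eq_iff[symmetric] fun_eq_iff)
qed

lemma elem_sym_0 [simp]: "elem_sym 0 u = 1"
proof -
  have "{S. S \<subseteq> UNIV \<and> card S = 0} = {{} :: 'a set}" by auto
  then show ?thesis by (simp add: elem_sym_def)
qed

text \<open>
  The algebraic core of the passage from \<open>u\<close> to residues, at one point \<open>(a, u)\<close>, where \<open>U\<close> is the
  derivative of \<open>u\<close> with respect to \<open>a\<^sub>j\<close>. The derivative of \<open>Q\<close> is the polynomial \<open>T\<close>; the Riccati
  equation predicts the polynomial \<open>V\<close>. Both have degree less than \<open>n\<close> and they agree at the \<open>n\<close> distinct
  roots \<open>u\<^sub>l\<close>, hence they are equal, and evaluation at \<open>a\<^sub>i\<close> gives the claim. The case \<open>u\<^sub>l = a\<^sub>j\<close> is allowed.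
\<close>

lemma riccati_at_point:
  fixes a u U :: "complex ^ 'n" and \<theta> :: "'n + bool \<Rightarrow> complex" and j :: 'n
  defines "J \<equiv> UNIV - {Inl j :: 'n + bool}" and "s \<equiv> sing_pt a"
    and "Q \<equiv> node_poly (\<lambda>k. u $ k) UNIV" and "c \<equiv> 1 - (\<Sum>m\<in>UNIV. \<theta> m)"
  defines "\<beta> \<equiv> node_residue s Q"
  assumes a: "a \<in> garnier_base" and u: "\<And>k l. k \<noteq> l \<Longrightarrow> u $ k \<noteq> u $ l"
    and U: "\<And>l. U $ l * (\<Prod>k\<in>UNIV - {l}. u $ l - u $ k) =
       \<beta> (Inl j) * (\<Sum>m\<in>J. \<theta> m * (\<Prod>m'\<in>J - {m}. u $ l - s m'))
       - (\<theta> (Inl j) - 1) * ((\<Prod>k\<in>UNIV - {l}. a $ j - u $ k) / (\<Prod>m\<in>J. a $ j - s m)) * (\<Prod>m\<in>J. u $ l - s m)"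
    and i: "i \<in> J"
  shows "- (\<Sum>l\<in>UNIV. U $ l * (\<Prod>k\<in>UNIV - {l}. s i - u $ k)) =
    (\<theta> (Inl j) - 1) * \<beta> i * (\<Prod>m\<in>J - {i}. s i - s m)
    - \<beta> (Inl j) * \<theta> i * (\<Prod>m\<in>J - {i}. s i - s m)
    - c * \<beta> (Inl j) * \<beta> i * (\<Prod>m\<in>UNIV - {i}. s i - s m)"
proof -
  let ?n = "CARD('n)"
  have inj: "inj s" using sing_pt_inj[OF a] by (auto simp: inj_on_def s_def)
  have sj: "s (Inl j) = a $ j" by (simp add: s_def)
  have cardM: "CARD('n + bool) = ?n + 2" by simp
  have cardJ: "card J = ?n + 1" by (simp add: J_def)
  have n: "?n > 0" by simp
  have Qdeg: "degree Q = ?n" "coeff Q ?n = 1"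
    using node_poly_degree[of "UNIV :: 'n set" "\<lambda>k. u $ k"] by (auto simp: Q_def)
  define Sj where "Sj = (\<Sum>m\<in>J. smult (\<beta> m) (node_poly s (J - {m})))"
  define T where "T = - (\<Sum>l\<in>UNIV. smult (U $ l) (node_poly (\<lambda>k. u $ k) (UNIV - {l})))"
  define V where "V = smult (\<theta> (Inl j) - 1) Sj - smult (\<beta> (Inl j)) (\<Sum>m\<in>J. smult (\<theta> m) (node_poly s (J - {m})))
      - smult (c * \<beta> (Inl j)) Q"
  have dJ: "degree (node_poly s (J - {m})) = ?n" "coeff (node_poly s (J - {m})) ?n = 1" if "m \<in> J" for m
    using node_poly_degree[of "J - {m}" s] that cardJ by auto
  \<comment> \<open>\<open>Sj\<close> is \<open>Q\<close> with the residue at \<open>a\<^sub>j\<close> split off and the factor \<open>x - a\<^sub>j\<close> removed.\<close>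
  have Qexp: "Q = smult (\<beta> (Inl j)) (node_poly s J) + [:- (a $ j), 1:] * Sj"
  proof -
    have "Q = (\<Sum>m\<in>UNIV. smult (\<beta> m) (node_poly s (UNIV - {m})))"
      unfolding \<beta>_def by (rule lagrange_interpolation[OF inj]) (simp add: Qdeg)
    also have "\<dots> = smult (\<beta> (Inl j)) (node_poly s J) + (\<Sum>m\<in>J. smult (\<beta> m) (node_poly s (UNIV - {m})))"
      unfolding J_def by (subst sum.remove[of _ "Inl j"]) auto
    also have "(\<Sum>m\<in>J. smult (\<beta> m) (node_poly s (UNIV - {m}))) = [:- (a $ j), 1:] * Sj"
      unfolding Sj_def sum_distrib_left
    proof (rule sum.cong)
      fix m assume m: "m \<in> J"
      then have "UNIV - {m} = insert (Inl j) (J - {m})" by (auto simp: J_def)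
      then have "node_poly s (UNIV - {m}) = [:- (a $ j), 1:] * node_poly s (J - {m})"
        using node_poly_insert[of "J - {m}" "Inl j" s] by (simp add: J_def sj)
      then show "smult (\<beta> m) (node_poly s (UNIV - {m})) = [:- (a $ j), 1:] * smult (\<beta> m) (node_poly s (J - {m}))"
        by (simp only: mult_smult_right)
    qed simp
    finally show ?thesis .
  qed
  have sum\<beta>: "(\<Sum>m\<in>UNIV. \<beta> m) = 0"
    unfolding \<beta>_def using sum_node_residue[OF inj, of Q] Qdeg by (simp add: coeff_eq_0)
  then have sum\<beta>J: "(\<Sum>m\<in>J. \<beta> m) = - \<beta> (Inl j)"
    unfolding J_def by (subst (asm) sum.remove[of _ "Inl j"]) (auto simp: add_eq_0_iff)
  have sum\<theta>J: "(\<Sum>m\<in>J. \<theta> m) = 1 - c - \<theta> (Inl j)"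
    unfolding J_def c_def by (subst sum.remove[of UNIV "Inl j" \<theta>]) auto
  have "T = V"
  proof (rule poly_eqI_degree_lead_coeff[of T ?n V "(\<lambda>k. u $ k) ` UNIV"])
    have "degree (\<Sum>l\<in>UNIV. smult (U $ l) (node_poly (\<lambda>k. u $ k) (UNIV - {l}))) \<le> ?n - 1"
      by (intro degree_sum_le) (auto intro!: degree_smult_le[THEN order_trans] simp: node_poly_degree)
    then have dT: "degree T \<le> ?n - 1" by (simp add: T_def)
    then show "degree T \<le> ?n" by simp
    have "coeff T ?n = 0" using dT n by (intro coeff_eq_0) linarith
    moreover have "coeff V ?n = 0"
    proof -
      have h1: "coeff Sj ?n = - \<beta> (Inl j)"
        unfolding Sj_def coeff_sum using dJ sum\<beta>J by simp
      have h2: "coeff (\<Sum>m\<in>J. smult (\<theta> m) (node_poly s (J - {m}))) ?n = 1 - c - \<theta> (Inl j)"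
        unfolding coeff_sum using dJ sum\<theta>J by simp
      show ?thesis
        by (simp only: V_def coeff_diff coeff_smult Qdeg h1 h2) (simp add: algebra_simps)
    qed
    ultimately show "coeff T ?n = coeff V ?n" by simp
    have "inj (\<lambda>k. u $ k)" using u by (auto simp: inj_on_def)
    then show "?n \<le> card ((\<lambda>k. u $ k) ` UNIV)" by (simp add: card_image)
    show "degree V \<le> ?n"
      unfolding V_def Sj_def
      by (intro degree_diff_le degree_sum_le degree_smult_le[THEN order_trans]) (auto simp: dJ Qdeg)
    fix x assume "x \<in> (\<lambda>k. u $ k) ` UNIV"
    then obtain l where x: "x = u $ l" by blast
    define \<gamma> where "\<gamma> = (\<Prod>k\<in>UNIV - {l}. a $ j - u $ k) / (\<Prod>m\<in>J. a $ j - s m)"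
    define Ql where "Ql = node_poly (\<lambda>k. u $ k) (UNIV - {l})"
    have QQl: "Q = [:- (u $ l), 1:] * Ql"
      unfolding Q_def Ql_def using node_poly_insert[of "UNIV - {l}" l "\<lambda>k. u $ k"] by (simp add: insert_absorb)
    have nzJ: "(\<Prod>m\<in>J. a $ j - s m) \<noteq> 0"
      using sing_pt_inj[OF a, of "Inl j"] by (auto simp: J_def s_def)
    have \<beta>j: "\<beta> (Inl j) = (a $ j - u $ l) * \<gamma>"
      unfolding \<beta>_def node_residue_def QQl by (simp add: sj Ql_def poly_node_poly \<gamma>_def J_def left_diff_distrib)
    \<comment> \<open>If \<open>u\<^sub>l = a\<^sub>j\<close>, dividing the values at \<open>u\<^sub>l\<close> by \<open>u\<^sub>l - a\<^sub>j\<close> is impossible; then \<open>\<beta>\<^sub>j = 0\<close>, and the factor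
      cancels in the polynomial identity instead.\<close>
    have Sjl: "poly Sj x = \<gamma> * (\<Prod>m\<in>J. x - s m)"
    proof (cases "x = a $ j")
      case True
      then have "\<beta> (Inl j) = 0" using \<beta>j x by simp
      then have "[:- (a $ j), 1:] * Ql = [:- (a $ j), 1:] * Sj" using Qexp QQl True x by simp
      then have "Ql = Sj" by (subst (asm) mult_cancel_left) simp
      then have "poly Sj x = poly Ql x" by simp
      also have "\<dots> = (\<Prod>k\<in>UNIV - {l}. a $ j - u $ k)" by (simp add: Ql_def poly_node_poly True)
      finally show ?thesis using True nzJ by (simp add: \<gamma>_def)
    next
      case False
      have "poly Q x = 0" by (simp add: QQl x)
      then have "\<beta> (Inl j) * (\<Prod>m\<in>J. x - s m) + (x - a $ j) * poly Sj x = 0"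
        unfolding Qexp by (simp add: poly_node_poly algebra_simps)
      then have "(x - a $ j) * poly Sj x = (x - a $ j) * (\<gamma> * (\<Prod>m\<in>J. x - s m))"
        by (simp add: \<beta>j x algebra_simps)
      then show ?thesis using False by simp
    qed
    have "poly T x = - (U $ l * (\<Prod>k\<in>UNIV - {l}. u $ l - u $ k))"
    proof -
      have "(\<Prod>k\<in>UNIV - {k'}. u $ l - u $ k) = 0" if "k' \<noteq> l" for k'
        using that by (intro prod_zero) auto
      then show ?thesis
        unfolding T_def poly_minus poly_sum poly_smult poly_node_poly x
        by (subst sum.remove[of _ l], simp, simp, subst sum.neutral) simp_all
    qed
    also have "\<dots> = (\<theta> (Inl j) - 1) * poly Sj x - \<beta> (Inl j) * (\<Sum>m\<in>J. \<theta> m * (\<Prod>m'\<in>J - {m}. x - s m'))"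
      unfolding U Sjl by (simp add: \<gamma>_def x)
    also have "\<dots> = poly V x"
      by (simp add: V_def poly_sum poly_node_poly QQl x)
    finally show "poly T x = poly V x" .
  qed
  then have "poly T (s i) = poly V (s i)" by simp
  moreover have "poly T (s i) = - (\<Sum>l\<in>UNIV. U $ l * (\<Prod>k\<in>UNIV - {l}. s i - u $ k))"
    by (simp add: T_def poly_sum poly_node_poly)
  moreover have "poly V (s i) = (\<theta> (Inl j) - 1) * \<beta> i * (\<Prod>m\<in>J - {i}. s i - s m)
    - \<beta> (Inl j) * \<theta> i * (\<Prod>m\<in>J - {i}. s i - s m)
    - c * \<beta> (Inl j) * \<beta> i * (\<Prod>m\<in>UNIV - {i}. s i - s m)"
  proof -
    have z: "(\<Prod>m'\<in>J - {m}. s i - s m') = 0" if "m \<noteq> i" for m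
      using that i by (intro prod_zero) auto
    have single: "(\<Sum>m\<in>J. f m * (\<Prod>m'\<in>J - {m}. s i - s m')) = f i * (\<Prod>m\<in>J - {i}. s i - s m)" for f
      using i z by (subst sum.remove[of _ i], simp, simp, subst sum.neutral) simp_all
    have "(\<Prod>m\<in>UNIV - {i}. s i - s m) \<noteq> 0" using inj by (auto simp: inj_eq)
    then have "poly Q (s i) = \<beta> i * (\<Prod>m\<in>UNIV - {i}. s i - s m)"
      by (simp add: \<beta>_def node_residue_def)
    then show ?thesis
      by (simp add: V_def Sj_def poly_sum poly_node_poly single)
  qed
  ultimately show ?thesis by simp
qed

section \<open>The Garnier system at zero momenta\<close>

text \<open>
  The coefficient \<open>M\<^sub>j M\<^sup>k\<^sup>,\<^sup>j / (u\<^sub>k - a\<^sub>m)\<close> of the Hamiltonian \<open>H\<^sub>j\<close> after cancellation. For \<open>m = j\<close> the factor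
  \<open>u\<^sub>k - a\<^sub>j\<close> cancels against \<open>M\<^sub>j\<close>, with a change of sign, otherwise \<open>u\<^sub>k - a\<^sub>m\<close> cancels against \<open>M\<^sup>k\<^sup>,\<^sup>j\<close>.
\<close>

definition garnier_T :: "'n \<Rightarrow> 'n \<Rightarrow> 'n + bool \<Rightarrow> complex ^ 'n \<Rightarrow> complex ^ 'n \<Rightarrow> complex" where
  "garnier_T j k m a u =
     (if m = Inl j then
        (\<Prod>l\<in>UNIV - {k}. a $ j - u $ l) * (\<Prod>m'\<in>UNIV - {Inl j}. u $ k - sing_pt a m')
      else - (\<Prod>l\<in>UNIV. a $ j - u $ l) * (\<Prod>m'\<in>UNIV - {Inl j} - {m}. u $ k - sing_pt a m')) /
     ((\<Prod>m'\<in>UNIV - {Inl j}. a $ j - sing_pt a m') * (\<Prod>l\<in>UNIV - {k}. u $ k - u $ l))"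

definition garnier_H_regular ::
    "('n + bool \<Rightarrow> complex) \<Rightarrow> 'n \<Rightarrow> (complex ^ 'n) \<times> (complex ^ 'n) \<times> (complex ^ 'n) \<Rightarrow> complex" where
  "garnier_H_regular \<theta> j = (\<lambda>(a, u, v).
     \<Sum>k\<in>UNIV. - (\<Prod>l\<in>UNIV. a $ j - u $ l) * (\<Prod>m\<in>UNIV - {Inl j}. u $ k - sing_pt a m) /
         ((\<Prod>m\<in>UNIV - {Inl j}. a $ j - sing_pt a m) * (\<Prod>l\<in>UNIV - {k}. u $ k - u $ l)) * (v $ k)\<^sup>2
       - (\<Sum>m\<in>UNIV. (\<theta> m - (if m = Inl j then 1 else 0)) * garnier_T j k m a u) * v $ k)"

lemma prod_sing_pt:
  fixes a :: "complex ^ 'n"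
  shows "(\<Prod>m\<in>UNIV. x - sing_pt a m) = x * (x - 1) * (\<Prod>l\<in>UNIV. x - a $ l)"
proof -
  have "(\<Prod>m\<in>UNIV. x - sing_pt a m) = (\<Prod>m\<in>insert (Inr False) (insert (Inr True) (range Inl)). x - sing_pt a m)"
    by (simp only: UNIV_plus_bool[symmetric])
  also have "\<dots> = x * ((x - 1) * (\<Prod>l\<in>UNIV. x - a $ l))"
    by (subst prod.insert, simp, force)+ (simp add: prod.reindex)
  finally show ?thesis by simp
qed

lemma garnier_H_expr_regular:
  fixes a u v :: "complex ^ 'n"
  assumes kappa: "garnier_kappa \<theta> \<theta>inf = 0" and gen: "(a, u, v) \<in> garnier_generic"
  shows "garnier_H_expr \<theta> \<theta>inf j (a, u, v) = garnier_H_regular \<theta> j (a, u, v)"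
proof -
  let ?P = "\<Prod>m\<in>UNIV - {Inl j}. a $ j - sing_pt a m"
  let ?A = "\<Prod>l\<in>UNIV. a $ j - u $ l"
  let ?J = "UNIV - {Inl j :: 'n + bool}"
  have nz: "u $ k - sing_pt a m \<noteq> 0" for k m using gen by (simp add: garnier_generic_def)
  have term_eq: "garnier_M a u j * (garnier_MM a u k j *
      ((v $ k)\<^sup>2 - (\<Sum>m\<in>UNIV. \<tau> m / (u $ k - sing_pt a m)) * v $ k)) =
      - ?A * (\<Prod>m\<in>?J. u $ k - sing_pt a m) / (?P * (\<Prod>l\<in>UNIV - {k}. u $ k - u $ l)) * (v $ k)\<^sup>2
        - (\<Sum>m\<in>UNIV. \<tau> m * garnier_T j k m a u) * v $ k" for k and \<tau> :: "'n + bool \<Rightarrow> complex"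
  proof -
    let ?U = "\<Prod>l\<in>UNIV - {k}. u $ k - u $ l"
    let ?N = "\<Prod>m\<in>?J. u $ k - sing_pt a m"
    have "u $ k * (u $ k - 1) * (\<Prod>l\<in>UNIV. u $ k - a $ l) = (u $ k - a $ j) * ?N"
      unfolding prod_sing_pt[symmetric] by (subst prod.remove[of _ "Inl j"]) auto
    then have MM: "garnier_MM a u k j = ?N / ?U"
      using nz[of k "Inl j"] by (simp add: garnier_MM_def)
    have cancel: "- (A / P) * (N / V) / d = A' * N / (P * V)" if "A = - d * A'" "d \<noteq> 0" for A A' P N V d :: complex
      using that by simp
    have cancel': "- (A / P) * (N / V) / d = - A * N' / (P * V)" if "N = d * N'" "d \<noteq> 0" for A N' P N V d :: complex
      using that by simp
    have T: "- (?A / ?P) * (?N / ?U) / (u $ k - sing_pt a m) = garnier_T j k m a u" for m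
    proof (cases "m = Inl j")
      case True
      have "?A = - (u $ k - sing_pt a m) * (\<Prod>l\<in>UNIV - {k}. a $ j - u $ l)"
        unfolding True by (subst prod.remove[of _ k]) auto
      from cancel[OF this nz] show ?thesis unfolding garnier_T_def if_P[OF True] .
    next
      case False
      then have "?N = (u $ k - sing_pt a m) * (\<Prod>m'\<in>?J - {m}. u $ k - sing_pt a m')"
        by (subst prod.remove[of _ m]) auto
      from cancel'[OF this nz] show ?thesis unfolding garnier_T_def if_not_P[OF False] .
    qed
    have expand: "p * (w * (x - (\<Sum>m\<in>I. f m / g m) * y)) = p * w * x - (\<Sum>m\<in>I. f m * (p * w / g m)) * y"
      for p w x y :: complex and f g :: "'n + bool \<Rightarrow> complex" and I
      by (simp add: right_diff_distrib sum_distrib_left sum_distrib_right ac_simps)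
    have "garnier_M a u j * (garnier_MM a u k j *
        ((v $ k)\<^sup>2 - (\<Sum>m\<in>UNIV. \<tau> m / (u $ k - sing_pt a m)) * v $ k)) =
        (- (?A / ?P) * (?N / ?U)) * (v $ k)\<^sup>2
        - (\<Sum>m\<in>UNIV. \<tau> m * (- (?A / ?P) * (?N / ?U) / (u $ k - sing_pt a m))) * v $ k"
      unfolding MM garnier_M_def by (rule expand)
    then show ?thesis unfolding T by simp
  qed
  show ?thesis
    unfolding garnier_H_expr_def garnier_H_regular_def prod.case kappa sum_distrib_left
    using term_eq[of _ "\<lambda>m. \<theta> m - (if m = Inl j then 1 else 0)"] by simp
qed

lemma tendsto_sing_pt [tendsto_intros]:
  "(f \<longlongrightarrow> a) F \<Longrightarrow> ((\<lambda>x. sing_pt (f x) m) \<longlongrightarrow> sing_pt a m) F"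
  unfolding sing_pt_def by (cases m) (auto intro: tendsto_intros)

text \<open>
  Shifting all \<open>u\<^sub>k\<close> by the same small real \<open>t\<close> keeps them distinct, and only finitely many \<open>t\<close> make some
  \<open>u\<^sub>k\<close> hit some \<open>a\<^sub>m\<close>.
\<close>

lemma garnier_generic_islimpt:
  fixes a u v :: "complex ^ 'n"
  assumes a: "a \<in> garnier_base" and u: "\<And>k l. k \<noteq> l \<Longrightarrow> u $ k \<noteq> u $ l"
  shows "(a, u, v) islimpt garnier_generic"
  unfolding islimpt_approachable
proof (intro allI impI)
  fix e :: real assume e: "e > 0"
  let ?bad = "(\<lambda>(k, m). Re (sing_pt a m - u $ k)) ` (UNIV :: ('n \<times> ('n + bool)) set)"
  define d where "d = e / (norm (1 :: complex ^ 'n) + 1)"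
  have d: "d > 0" using e by (simp add: d_def add_nonneg_pos)
  have "infinite ({0<..<d} - ?bad)" using d by (simp add: infinite_Ioo)
  then obtain t where t: "t \<in> {0<..<d}" "t \<notin> ?bad" by (metis DiffE finite.emptyI ex_in_conv)
  let ?u = "u + of_real t *s 1"
  have "?u $ k \<noteq> sing_pt a m" for k m
  proof
    assume "?u $ k = sing_pt a m"
    then have "t = Re (sing_pt a m - u $ k)" by (simp flip: \<open>?u $ k = sing_pt a m\<close>)
    then show False using t(2) by auto
  qed
  then have "(a, ?u, v) \<in> garnier_generic"
    unfolding garnier_generic_def using a u by simp
  moreover have "(a, ?u, v) \<noteq> (a, u, v)" using t by (auto simp: vec_eq_iff)
  moreover have "dist (a, ?u, v) (a, u, v) < e"
  proof -
    have "dist (a, ?u, v) (a, u, v) = t * norm (1 :: complex ^ 'n)"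
      using t(1) norm_vector_smult[of "of_real t" "1 :: complex ^ 'n"] by (simp add: dist_Pair_Pair dist_norm)
    also have "\<dots> \<le> t * (norm (1 :: complex ^ 'n) + 1)" using t(1) by (intro mult_left_mono) auto
    also have "\<dots> < d * (norm (1 :: complex ^ 'n) + 1)" using t(1) by (intro mult_strict_right_mono) (auto simp: add_nonneg_pos)
    also have "\<dots> = e" using norm_ge_zero[of "1 :: complex ^ 'n"] by (simp add: d_def del: norm_ge_zero)
    finally show ?thesis .
  qed
  ultimately show "\<exists>x'\<in>garnier_generic. x' \<noteq> (a, u, v) \<and> dist x' (a, u, v) < e" by blast
qed

text \<open>
  The cancelled expression is continuous wherever the \<open>u\<^sub>k\<close> are distinct, and agrees with the original one
  on the generic set, which accumulates at every such point.
\<close>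

lemma garnier_H_eq_regular:
  fixes a u v :: "complex ^ 'n"
  assumes kappa: "garnier_kappa \<theta> \<theta>inf = 0"
    and a: "a \<in> garnier_base" and u: "\<And>k l. k \<noteq> l \<Longrightarrow> u $ k \<noteq> u $ l"
  shows "garnier_H \<theta> \<theta>inf j (a, u, v) = garnier_H_regular \<theta> j (a, u, v)"
  unfolding garnier_H_def
proof (rule tendsto_Lim)
  let ?F = "at (a, u, v) within garnier_generic"
  show "\<not> trivial_limit ?F"
    using garnier_generic_islimpt[OF a u] by (simp add: trivial_limit_within)
  have nz: "(\<Prod>m\<in>UNIV - {Inl j}. a $ j - sing_pt a m) * (\<Prod>l\<in>UNIV - {k}. u $ k - u $ l) \<noteq> 0" for k
    using sing_pt_inj[OF a, of "Inl j"] u by auto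
  have 1: "(fst \<longlongrightarrow> a) ?F" "((\<lambda>p. fst (snd p)) \<longlongrightarrow> u) ?F" "((\<lambda>p. snd (snd p)) \<longlongrightarrow> v) ?F"
    using tendsto_fst[OF tendsto_ident_at, of "(a, u, v)"] tendsto_snd[OF tendsto_ident_at, of "(a, u, v)"]
    by (auto dest!: spec simp: tendsto_fst[of snd "(u, v)", simplified] tendsto_snd[of snd "(u, v)", simplified])
  have "((\<lambda>p. garnier_T j k m (fst p) (fst (snd p))) \<longlongrightarrow> garnier_T j k m a u) ?F" for k m
    unfolding garnier_T_def using nz[of k]
    by (cases "m = Inl j") (auto intro!: tendsto_intros 1)
  then have "((\<lambda>p. garnier_H_regular \<theta> j p) \<longlongrightarrow> garnier_H_regular \<theta> j (a, u, v)) ?F"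
    unfolding garnier_H_regular_def split_beta
    by (intro tendsto_intros) (use 1 nz in \<open>auto intro!: tendsto_intros\<close>)
  then show "(garnier_H_expr \<theta> \<theta>inf j \<longlongrightarrow> garnier_H_regular \<theta> j (a, u, v)) ?F"
  proof (rule Lim_transform_eventually)
    have "\<forall>\<^sub>F p in ?F. p \<in> garnier_generic" by (auto simp: eventually_at_filter)
    then show "\<forall>\<^sub>F p in ?F. garnier_H_regular \<theta> j p = garnier_H_expr \<theta> \<theta>inf j p"
      by eventually_elim (use garnier_H_expr_regular[OF kappa] in auto)
  qed
qed

lemma garnier_kappa_zero:
  assumes "(\<Sum>m\<in>UNIV. \<theta> m) - 1 = \<theta>inf \<or> (\<Sum>m\<in>UNIV. \<theta> m) - 1 = - \<theta>inf"
  shows "garnier_kappa \<theta> \<theta>inf = 0"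
  using assms by (auto simp: garnier_kappa_def)

text \<open>
  For \<open>\<kappa> = 0\<close> the Hamiltonian as a function of \<open>v\<^sub>i\<close> alone, the other momenta being zero, is a quadratic polynomial
  without constant term; its linear coefficient is the derivative at \<open>v = 0\<close>.
\<close>

lemma garnier_solution_zero_momentum:
  fixes u :: "complex ^ 'n \<Rightarrow> complex ^ 'n"
  assumes kappa: "garnier_kappa \<theta> \<theta>inf = 0"
    and sol: "garnier_solution \<theta> \<theta>inf D u (\<lambda>a. 0)" and a: "a \<in> D"
  shows "((\<lambda>w. u (coord_upd a j w) $ i) has_field_derivative
     - (\<Sum>m\<in>UNIV. (\<theta> m - (if m = Inl j then 1 else 0)) * garnier_T j i m a (u a))) (at (a $ j))"
proof -
  have base: "a \<in> garnier_base" and dist: "\<And>k l. k \<noteq> l \<Longrightarrow> u a $ k \<noteq> u a $ l"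
    and der: "((\<lambda>w. u (coord_upd a j w) $ i) has_field_derivative
           deriv (\<lambda>w. garnier_H \<theta> \<theta>inf j (a, u a, coord_upd 0 i w)) 0) (at (a $ j))"
    using sol a unfolding garnier_solution_def by auto
  define \<tau> where "\<tau> = (\<Sum>m\<in>UNIV. (\<theta> m - (if m = Inl j then 1 else 0)) * garnier_T j i m a (u a))"
  obtain C where H: "garnier_H \<theta> \<theta>inf j (a, u a, coord_upd 0 i w) = C * w\<^sup>2 - \<tau> * w" for w
  proof -
    have reg: "garnier_H \<theta> \<theta>inf j (a, u a, coord_upd 0 i w) = garnier_H_regular \<theta> j (a, u a, coord_upd 0 i w)" for w
      by (rule garnier_H_eq_regular[OF kappa base]) (use dist in auto)
    have "garnier_H \<theta> \<theta>inf j (a, u a, coord_upd 0 i w) = (- (\<Prod>l\<in>UNIV. a $ j - u a $ l) * (\<Prod>m\<in>UNIV - {Inl j}. u a $ i - sing_pt a m) /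
         ((\<Prod>m\<in>UNIV - {Inl j}. a $ j - sing_pt a m) * (\<Prod>l\<in>UNIV - {i}. u a $ i - u a $ l))) * w\<^sup>2 - \<tau> * w" for w
      unfolding reg garnier_H_regular_def prod.case \<tau>_def
      by (subst sum.remove[of _ i]) (auto intro!: sum.neutral)
    then show thesis by (rule that)
  qed
  have "deriv (\<lambda>w. garnier_H \<theta> \<theta>inf j (a, u a, coord_upd 0 i w)) 0 = - \<tau>"
    unfolding H by (rule DERIV_imp_deriv) (auto intro!: derivative_eq_intros)
  then show ?thesis using der by (simp add: \<tau>_def)
qed

text \<open>
  For fixed \<open>i \<noteq> j\<close> the point \<open>a\<^sub>i\<close> does not move with \<open>a\<^sub>j\<close>, so the derivative of \<open>\<beta>\<^sub>i\<close> comes from the roots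
  \<open>u\<^sub>l\<close> and from the single factor \<open>a\<^sub>i - a\<^sub>j\<close> of the denominator.
\<close>

theorem garnier_riccati:
  fixes u :: "complex ^ 'n \<Rightarrow> complex ^ 'n" and \<theta> :: "'n + bool \<Rightarrow> complex"
  assumes kappa: "garnier_kappa \<theta> \<theta>inf = 0"
    and sol: "garnier_solution \<theta> \<theta>inf D u (\<lambda>a. 0)" and a: "a \<in> D" and i: "i \<noteq> Inl j"
  defines "\<beta> \<equiv> \<lambda>a. node_residue (sing_pt a) (node_poly (\<lambda>k. u a $ k) UNIV)"
  shows "partial_deriv j (\<lambda>a. \<beta> a i) a =
    residue_flow \<theta> j a (\<beta> a) i - (1 - (\<Sum>m\<in>UNIV. \<theta> m)) * \<beta> a i * \<beta> a (Inl j)"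
proof -
  have base: "a \<in> garnier_base" and dist: "\<And>k l. k \<noteq> l \<Longrightarrow> u a $ k \<noteq> u a $ l"
    using sol a unfolding garnier_solution_def by auto
  let ?J = "UNIV - {Inl j :: 'n + bool}"
  let ?s = "sing_pt a"
  define U where "U = (\<chi> l. - (\<Sum>m\<in>UNIV. (\<theta> m - (if m = Inl j then 1 else 0)) * garnier_T j l m a (u a)))"
  have du: "((\<lambda>w. u (coord_upd a j w) $ l) has_field_derivative U $ l) (at (a $ j))" for l
    using garnier_solution_zero_momentum[OF kappa sol a, of j l] by (simp add: U_def)
  have nzJ: "(\<Prod>m\<in>?J. a $ j - ?s m) \<noteq> 0"
    using sing_pt_inj[OF base, of "Inl j"] by auto
  have \<beta>j: "\<beta> a (Inl j) = (\<Prod>l\<in>UNIV. a $ j - u a $ l) / (\<Prod>m\<in>?J. a $ j - ?s m)"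
    by (simp add: \<beta>_def node_residue_def poly_node_poly)
  have Ueq: "U $ l * (\<Prod>k\<in>UNIV - {l}. u a $ l - u a $ k) =
       \<beta> a (Inl j) * (\<Sum>m\<in>?J. \<theta> m * (\<Prod>m'\<in>?J - {m}. u a $ l - ?s m'))
       - (\<theta> (Inl j) - 1) * ((\<Prod>k\<in>UNIV - {l}. a $ j - u a $ k) / (\<Prod>m\<in>?J. a $ j - ?s m)) * (\<Prod>m\<in>?J. u a $ l - ?s m)" for l
  proof -
    let ?U = "\<Prod>k\<in>UNIV - {l}. u a $ l - u a $ k"
    have nzU: "?U \<noteq> 0" using dist by auto
    have TJ: "garnier_T j l m a (u a) * ?U = - (\<beta> a (Inl j) * (\<Prod>m'\<in>?J - {m}. u a $ l - ?s m'))" if "m \<in> ?J" for m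
      using that nzU by (simp add: garnier_T_def \<beta>j)
    have Tj: "garnier_T j l (Inl j) a (u a) * ?U =
        ((\<Prod>k\<in>UNIV - {l}. a $ j - u a $ k) / (\<Prod>m\<in>?J. a $ j - ?s m)) * (\<Prod>m\<in>?J. u a $ l - ?s m)"
      using nzU by (simp add: garnier_T_def)
    have "U $ l * ?U = - (\<Sum>m\<in>UNIV. (\<theta> m - (if m = Inl j then 1 else 0)) * (garnier_T j l m a (u a) * ?U))"
      by (simp add: U_def sum_distrib_right mult.assoc)
    also have "\<dots> = - ((\<theta> (Inl j) - 1) * (garnier_T j l (Inl j) a (u a) * ?U)
        + (\<Sum>m\<in>?J. \<theta> m * (garnier_T j l m a (u a) * ?U)))"
      by (subst sum.remove[of _ "Inl j"]) auto
    also have "(\<Sum>m\<in>?J. \<theta> m * (garnier_T j l m a (u a) * ?U)) =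
        - (\<beta> a (Inl j) * (\<Sum>m\<in>?J. \<theta> m * (\<Prod>m'\<in>?J - {m}. u a $ l - ?s m')))"
      unfolding sum_distrib_left sum_negf[symmetric] by (rule sum.cong) (use TJ in auto)
    finally show ?thesis unfolding Tj by (simp add: algebra_simps)
  qed
  have key: "- (\<Sum>l\<in>UNIV. U $ l * (\<Prod>k\<in>UNIV - {l}. ?s i - u a $ k)) =
    (\<theta> (Inl j) - 1) * \<beta> a i * (\<Prod>m\<in>?J - {i}. ?s i - ?s m)
    - \<beta> a (Inl j) * \<theta> i * (\<Prod>m\<in>?J - {i}. ?s i - ?s m)
    - (1 - (\<Sum>m\<in>UNIV. \<theta> m)) * \<beta> a (Inl j) * \<beta> a i * (\<Prod>m\<in>UNIV - {i}. ?s i - ?s m)"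
    unfolding \<beta>_def using i Ueq unfolding \<beta>_def
    by (intro riccati_at_point[OF base dist]) auto
  define r where "r = (\<Prod>m\<in>?J - {i}. ?s i - ?s m)"
  have upd: "sing_pt (coord_upd a j w) m = (if m = Inl j then w else ?s m)" for w m
    by (auto simp: sing_pt_def split: sum.splits)
  have split: "UNIV - {i} = insert (Inl j) (?J - {i})" using i by auto
  have Ri: "(\<Prod>m\<in>UNIV - {i}. sing_pt (coord_upd a j w) i - sing_pt (coord_upd a j w) m) = (?s i - w) * r" for w
    unfolding split r_def using i by (subst prod.insert) (auto simp: upd intro!: prod.cong)
  have Ri': "(\<Prod>m\<in>UNIV - {i}. ?s i - ?s m) = (?s i - a $ j) * r"
    using Ri[of "a $ j"] by simp
  have nz: "?s i - a $ j \<noteq> 0" "r \<noteq> 0"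
    using sing_pt_diff_nonzero[OF base i] sing_pt_inj[OF base, of i] by (auto simp: r_def)
  define B where "B = (\<Prod>l\<in>UNIV. ?s i - u a $ l)"
  have \<beta>i: "\<beta> a i = B / ((?s i - a $ j) * r)"
    by (simp add: \<beta>_def node_residue_def poly_node_poly B_def Ri')
  have \<beta>w: "\<beta> (coord_upd a j w) i = (\<Prod>l\<in>UNIV. ?s i - u (coord_upd a j w) $ l) / ((?s i - w) * r)" for w
    unfolding \<beta>_def node_residue_def poly_node_poly Ri using i by (simp add: upd)
  define S where "S = - (\<Sum>l\<in>UNIV. U $ l * (\<Prod>k\<in>UNIV - {l}. ?s i - u a $ k))"
  have dB: "((\<lambda>w. \<Prod>l\<in>UNIV. ?s i - u (coord_upd a j w) $ l) has_field_derivative S) (at (a $ j))"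
  proof -
    have "((\<lambda>w. \<Prod>l\<in>UNIV. ?s i - u (coord_upd a j w) $ l) has_field_derivative
        (\<Sum>l\<in>UNIV. (0 - U $ l) * (\<Prod>k\<in>UNIV - {l}. ?s i - u (coord_upd a j (a $ j)) $ k))) (at (a $ j))"
      by (intro has_field_derivative_prod DERIV_diff DERIV_const du)
    then show ?thesis by (simp add: S_def sum_negf)
  qed
  have "((\<lambda>w. \<beta> (coord_upd a j w) i) has_field_derivative S / ((?s i - a $ j) * r) + \<beta> a i / (?s i - a $ j)) (at (a $ j))"
  proof -
    define d where "d = ?s i - a $ j"
    have "((\<lambda>w. (?s i - w) * r) has_field_derivative - r) (at (a $ j))"
      by (auto intro!: derivative_eq_intros)
    from DERIV_divide[OF dB this]
    have "((\<lambda>w. \<beta> (coord_upd a j w) i) has_field_derivative (S * (d * r) - B * - r) / ((d * r) * (d * r))) (at (a $ j))"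
      unfolding \<beta>w using nz by (simp add: B_def d_def)
    moreover have "(S * (d * r) - B * - r) / ((d * r) * (d * r)) = S / (d * r) + B / (d * r) / d"
      using nz unfolding d_def[symmetric] by (simp add: field_simps)
    ultimately show ?thesis unfolding \<beta>i d_def by simp
  qed
  then have "partial_deriv j (\<lambda>a. \<beta> a i) a = S / ((?s i - a $ j) * r) + \<beta> a i / (?s i - a $ j)"
    by (rule partial_deriv_eqI)
  also have "\<dots> = (\<theta> (Inl j) * \<beta> a i - \<theta> i * \<beta> a (Inl j)) / (?s i - a $ j)
      - (1 - (\<Sum>m\<in>UNIV. \<theta> m)) * \<beta> a i * \<beta> a (Inl j)"
  proof -
    have "((t - 1) * b * r - bj * th * r - C * bj * b * (d * r)) / (d * r) + b / d
        = (t * b - th * bj) / d - C * b * bj" if "d \<noteq> 0" "r \<noteq> 0" for t b bj th C d r :: complex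
      using that by (simp add: field_simps)
    from this[OF nz] show ?thesis unfolding S_def key Ri' r_def[symmetric] .
  qed
  finally show ?thesis by (simp add: residue_flow_off[OF i])
qed

section \<open>Charts and germs on the cover\<close>

text \<open>
  Charts with a ball as image: convexity is what the identity theorems need.
\<close>

definition ball_chart ::
    "'z::topological_space set \<Rightarrow> ('z \<Rightarrow> complex ^ 'n) \<Rightarrow> 'z \<Rightarrow> real \<Rightarrow> (complex ^ 'n \<Rightarrow> 'z) \<Rightarrow> bool" where
  "ball_chart Z p z r q \<longleftrightarrow> r > 0 \<and> q (p z) = z \<and> openin (top_of_set Z) (q ` ball (p z) r) \<and>
     homeomorphism (q ` ball (p z) r) (ball (p z) r) p q"

lemma ball_chartD:
  assumes "ball_chart Z p z r q"
  shows "r > 0" "q (p z) = z" "openin (top_of_set Z) (q ` ball (p z) r)"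
    "continuous_on (ball (p z) r) q" "\<And>x. x \<in> ball (p z) r \<Longrightarrow> p (q x) = x"
    "\<And>x. x \<in> ball (p z) r \<Longrightarrow> q x \<in> Z" "z \<in> q ` ball (p z) r"
proof -
  show 1: "r > 0" "q (p z) = z" "openin (top_of_set Z) (q ` ball (p z) r)"
    using assms by (auto simp: ball_chart_def)
  have h: "homeomorphism (q ` ball (p z) r) (ball (p z) r) p q"
    using assms by (auto simp: ball_chart_def)
  then show "continuous_on (ball (p z) r) q" "\<And>x. x \<in> ball (p z) r \<Longrightarrow> p (q x) = x"
    by (auto simp: homeomorphism_def)
  show "q x \<in> Z" if "x \<in> ball (p z) r" for x
    using openin_imp_subset[OF 1(3)] that by blast
  show "z \<in> q ` ball (p z) r" using 1 by (metis centre_in_ball image_eqI)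
qed

lemma ball_chart_openin:
  assumes c: "ball_chart Z p z r q" and X: "open X" "X \<subseteq> ball (p z) r"
  shows "openin (top_of_set Z) (q ` X)" "homeomorphism (q ` X) X p q"
proof -
  have h: "homeomorphism (q ` ball (p z) r) (ball (p z) r) p q"
    using c by (auto simp: ball_chart_def)
  have "openin (top_of_set (ball (p z) r)) X" using X by (simp add: openin_open_eq)
  then have "openin (top_of_set (q ` ball (p z) r)) (q ` X)"
    using homeomorphism_imp_open_map[OF homeomorphism_symD[OF h]] by blast
  then show "openin (top_of_set Z) (q ` X)"
    using ball_chartD(3)[OF c] openin_trans by blast
  show "homeomorphism (q ` X) X p q"
    by (rule homeomorphism_of_subsets[OF h]) (use X ball_chartD(5)[OF c] in \<open>auto simp: image_iff subset_eq\<close>)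
qed

lemma ball_chart_sub:
  assumes c: "ball_chart Z p z r q" and x: "ball x s \<subseteq> ball (p z) r" "s > 0"
  shows "ball_chart Z p (q x) s q" "p (q x) = x"
proof -
  have "x \<in> ball (p z) r" using x centre_in_ball by blast
  then show px: "p (q x) = x" by (rule ball_chartD(5)[OF c])
  show "ball_chart Z p (q x) s q"
    using ball_chart_openin[OF c open_ball x(1)] x(2) by (simp add: ball_chart_def px)
qed

lemma ball_chart_smaller:
  assumes c: "ball_chart Z p z r q" and "0 < s" "s \<le> r"
  shows "ball_chart Z p z s q"
  using ball_chart_sub(1)[OF c, of "p z" s] assms ball_chartD(2)[OF c] subset_ball[of s r "p z"] by simp

lemma ball_chart_preimage_open:
  assumes c: "ball_chart Z p z r q" and W: "openin (top_of_set Z) W"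
  shows "open {x \<in> ball (p z) r. q x \<in> W}"
proof -
  obtain T where T: "open T" "W = Z \<inter> T" using W by (auto simp: openin_open)
  have "open (ball (p z) r \<inter> q -` T)"
    using continuous_open_preimage[OF ball_chartD(4)[OF c] open_ball T(1)] .
  moreover have "ball (p z) r \<inter> q -` T = {x \<in> ball (p z) r. q x \<in> W}"
    using T ball_chartD(6)[OF c] by auto
  ultimately show ?thesis by simp
qed

lemma open_garnier_base: "open (garnier_base :: (complex ^ 'n) set)"
proof -
  have "garnier_base = (\<Inter>i. {a :: complex ^ 'n. a $ i \<noteq> 0} \<inter> {a. a $ i \<noteq> 1}) \<inter>
      (\<Inter>i. \<Inter>j\<in>UNIV - {i}. {a. a $ i \<noteq> a $ j})"
    by (auto simp: garnier_base_def)
  moreover have "open \<dots>"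
    by (intro open_Int open_INT ballI open_Collect_neq continuous_intros) auto
  ultimately show ?thesis by simp
qed

lemma ball_chart_exists:
  assumes cov: "covering_space Z p S" and S: "open S" and z: "z \<in> Z"
  obtains r q where "ball_chart Z p z r q"
proof -
  have "p z \<in> S" using cov z by (auto simp: covering_space_def)
  then obtain T v where T: "p z \<in> T" "openin (top_of_set S) T" and v: "\<Union> v = Z \<inter> p -` T"
    "\<forall>u\<in>v. openin (top_of_set Z) u" "\<forall>u\<in>v. \<exists>q. homeomorphism u T p q"
    using cov unfolding covering_space_def by meson
  then obtain u where u: "u \<in> v" "z \<in> u" using z by blast
  then obtain q where h: "homeomorphism u T p q" using v by blast
  have "open T" using T(2) S by (simp add: openin_open_eq)
  then obtain r where r: "r > 0" "ball (p z) r \<subseteq> T" using T(1) open_contains_ball by blast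
  have "openin (top_of_set T) (ball (p z) r)" using r \<open>open T\<close> by (simp add: openin_open_eq)
  then have "openin (top_of_set u) (q ` ball (p z) r)"
    using homeomorphism_imp_open_map[OF homeomorphism_symD[OF h]] by blast
  then have o: "openin (top_of_set Z) (q ` ball (p z) r)"
    using v(2) u(1) openin_trans by blast
  have "p (q x) = x" if "x \<in> ball (p z) r" for x
    using h that r by (auto simp: homeomorphism_def)
  then have "p ` q ` ball (p z) r = ball (p z) r" by (force simp: image_image)
  moreover have "q ` ball (p z) r \<subseteq> u" using h r(2) by (auto simp: homeomorphism_def)
  ultimately have "homeomorphism (q ` ball (p z) r) (ball (p z) r) p q"
    using homeomorphism_of_subsets[OF h] r(2) by blast
  moreover have "q (p z) = z" using h u(2) by (auto simp: homeomorphism_def)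
  ultimately show thesis using r(1) o by (intro that[of r q]) (simp add: ball_chart_def)
qed

text \<open>
  Two local inverses of \<open>p\<close> agree wherever both are defined near a common point, so holomorphy does not depend on
  the chart.
\<close>

lemma cover_holomorphic_chart:
  assumes f: "cover_holomorphic Z p f W" and c: "ball_chart Z p z r q"
    and X: "open X" "X \<subseteq> ball (p z) r" "\<And>x. x \<in> X \<Longrightarrow> q x \<in> W"
  shows "cvec_holomorphic (\<lambda>x. f (q x)) X"
  unfolding cvec_holomorphic_def
proof
  fix x assume x: "x \<in> X"
  then obtain V q' where V: "cover_chart Z p V q'" "q x \<in> V" and hol: "cvec_holomorphic (f \<circ> q') (p ` V)"
    using f X(3) unfolding cover_holomorphic_def by blast
  define Y where "Y = X \<inter> {x \<in> ball (p z) r. q x \<in> V}"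
  have Y: "open Y" "x \<in> Y"
    using ball_chart_preimage_open[OF c] V x X by (auto simp: Y_def cover_chart_def)
  have eq: "q' y = q y \<and> y \<in> p ` V" if "y \<in> Y" for y
  proof -
    have y: "p (q y) = y" "q y \<in> V" using that ball_chartD(5)[OF c] by (auto simp: Y_def)
    then have "q' y = q y" using V(1) by (metis cover_chart_def homeomorphism_def)
    then show ?thesis using y by (metis imageI)
  qed
  have "cvec_holomorphic (f \<circ> q') Y" by (rule hol_subset[OF hol]) (use eq in blast)
  then have "cvec_holomorphic (\<lambda>x. f (q x)) Y"
    by (rule hol_cong[OF Y(1), rotated]) (use eq in auto)
  then show "\<exists>D. ((\<lambda>x. f (q x)) has_derivative D) (at x) \<and> (\<forall>c h. D (c *s h) = c * D h)"
    using Y(2) unfolding cvec_holomorphic_def by blast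
qed

lemma chart_cover_holomorphic:
  assumes c: "ball_chart Z p z r q" and X: "open X" "X \<subseteq> ball (p z) r"
    and f: "cvec_holomorphic (\<lambda>x. f (q x)) X"
  shows "cover_holomorphic Z p f (q ` X)"
proof -
  have pq: "p ` q ` X = X"
    using X(2) ball_chartD(5)[OF c] by (force simp: image_image)
  then have "cover_chart Z p (q ` X) q"
    using ball_chart_openin[OF c X] X(1) by (simp add: cover_chart_def)
  then show ?thesis using f pq unfolding cover_holomorphic_def o_def by fastforce
qed

lemma hol_germ_iff:
  assumes c: "ball_chart Z p z r q"
  shows "hol_germ Z p z f \<longleftrightarrow> (\<exists>X. open X \<and> p z \<in> X \<and> X \<subseteq> ball (p z) r \<and> cvec_holomorphic (\<lambda>x. f (q x)) X)"
proof
  assume "hol_germ Z p z f"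
  then obtain W where W: "nbhd_in Z z W" "cover_holomorphic Z p f W" by (auto simp: hol_germ_def)
  let ?X = "{x \<in> ball (p z) r. q x \<in> W}"
  have "open ?X" "p z \<in> ?X"
    using ball_chart_preimage_open[OF c] W ball_chartD(1,2)[OF c] by auto
  moreover have "cvec_holomorphic (\<lambda>x. f (q x)) ?X"
    by (rule cover_holomorphic_chart[OF W(2) c \<open>open ?X\<close>]) auto
  ultimately show "\<exists>X. open X \<and> p z \<in> X \<and> X \<subseteq> ball (p z) r \<and> cvec_holomorphic (\<lambda>x. f (q x)) X" by blast
next
  assume "\<exists>X. open X \<and> p z \<in> X \<and> X \<subseteq> ball (p z) r \<and> cvec_holomorphic (\<lambda>x. f (q x)) X"
  then obtain X where X: "open X" "p z \<in> X" "X \<subseteq> ball (p z) r" "cvec_holomorphic (\<lambda>x. f (q x)) X" by blast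
  have "z \<in> q ` X" using X(2) ball_chartD(2)[OF c] by (metis image_eqI)
  then show "hol_germ Z p z f"
    unfolding hol_germ_def
    using chart_cover_holomorphic[OF c X(1,3,4)] ball_chart_openin(1)[OF c X(1,3)] by blast
qed

lemma nbhd_iff:
  assumes c: "ball_chart Z p z r q"
  shows "(\<exists>W. nbhd_in Z z W \<and> (\<forall>w\<in>W. A w)) \<longleftrightarrow>
     (\<exists>X. open X \<and> p z \<in> X \<and> X \<subseteq> ball (p z) r \<and> (\<forall>x\<in>X. A (q x)))"
proof
  assume "\<exists>W. nbhd_in Z z W \<and> (\<forall>w\<in>W. A w)"
  then obtain W where W: "nbhd_in Z z W" "\<forall>w\<in>W. A w" by blast
  let ?X = "{x \<in> ball (p z) r. q x \<in> W}"
  have "open ?X" "p z \<in> ?X"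
    using ball_chart_preimage_open[OF c] W ball_chartD(1,2)[OF c] by auto
  then show "\<exists>X. open X \<and> p z \<in> X \<and> X \<subseteq> ball (p z) r \<and> (\<forall>x\<in>X. A (q x))" using W by blast
next
  assume "\<exists>X. open X \<and> p z \<in> X \<and> X \<subseteq> ball (p z) r \<and> (\<forall>x\<in>X. A (q x))"
  then obtain X where X: "open X" "p z \<in> X" "X \<subseteq> ball (p z) r" "\<forall>x\<in>X. A (q x)" by blast
  have "z \<in> q ` X" using X(2) ball_chartD(2)[OF c] by (metis image_eqI)
  then show "\<exists>W. nbhd_in Z z W \<and> (\<forall>w\<in>W. A w)"
    using ball_chart_openin(1)[OF c X(1,3)] X(4) by blast
qed

lemma hol_germ_comp_proj:
  assumes c: "ball_chart Z p z r q" and V: "open V" "p z \<in> V" and h: "cvec_holomorphic h V"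
  shows "hol_germ Z p z (\<lambda>w. h (p w))"
  unfolding hol_germ_iff[OF c]
proof (intro exI conjI)
  let ?X = "V \<inter> ball (p z) r"
  show "open ?X" "p z \<in> ?X" "?X \<subseteq> ball (p z) r" using V ball_chartD(1)[OF c] by auto
  show "cvec_holomorphic (\<lambda>x. h (p (q x))) ?X"
    by (rule hol_cong[OF \<open>open ?X\<close> _ hol_subset[OF h]])
       (use ball_chartD(5)[OF c] in auto)
qed

section \<open>The order of a polar divisor\<close>

text \<open>
  Uniqueness of the order in the local ring at \<open>x0\<close>, where \<open>\<phi> / \<psi> = N / L\<close> and \<open>L\<close> does not divide \<open>N\<close>. From
  \<open>\<phi> L = N \<psi>\<close> and since \<open>L\<close> is prime, \<open>\<psi> = L \<psi>'\<close> and \<open>\<phi> = N \<psi>'\<close>; coprimality makes \<open>\<psi>'\<close> a unit. The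
  irreducible \<open>g\<close> has the same zeros as \<open>L\<close>, so it is \<open>L\<close> times a unit. Hence \<open>g\<close> divides \<open>\<psi>\<close> exactly once.
\<close>

lemma polar_order_unique_core:
  fixes L N \<phi> \<psi> g h :: "complex ^ 'n \<Rightarrow> complex"
  assumes \<rho>: "\<rho> > 0"
    and hol: "cvec_holomorphic L (ball x0 \<rho>)" "cvec_holomorphic N (ball x0 \<rho>)"
      "cvec_holomorphic \<phi> (ball x0 \<rho>)" "cvec_holomorphic \<psi> (ball x0 \<rho>)"
      "cvec_holomorphic g (ball x0 \<rho>)" "cvec_holomorphic h (ball x0 \<rho>)"
    and L0: "L x0 = 0" "partial_deriv j L x0 \<noteq> 0"
    and Nnz: "\<And>V. open V \<Longrightarrow> x0 \<in> V \<Longrightarrow> V \<subseteq> ball x0 \<rho> \<Longrightarrow> \<exists>x\<in>V. L x = 0 \<and> N x \<noteq> 0"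
    and rel: "\<And>x. x \<in> ball x0 \<rho> \<Longrightarrow> L x \<noteq> 0 \<Longrightarrow> \<psi> x \<noteq> 0 \<Longrightarrow> \<phi> x * L x = N x * \<psi> x"
    and \<psi>nz: "x1 \<in> ball x0 \<rho>" "\<psi> x1 \<noteq> 0"
    and gz: "\<And>x. x \<in> ball x0 \<rho> \<Longrightarrow> g x = 0 \<longleftrightarrow> L x = 0"
    and coprime: "\<And>V h h1 h2. open V \<Longrightarrow> x0 \<in> V \<Longrightarrow> V \<subseteq> ball x0 \<rho> \<Longrightarrow> cvec_holomorphic h V \<Longrightarrow>
       cvec_holomorphic h1 V \<Longrightarrow> cvec_holomorphic h2 V \<Longrightarrow> (\<And>x. x \<in> V \<Longrightarrow> \<phi> x = h x * h1 x) \<Longrightarrow>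
       (\<And>x. x \<in> V \<Longrightarrow> \<psi> x = h x * h2 x) \<Longrightarrow> h x0 \<noteq> 0"
    and irred: "\<And>V h1 h2. open V \<Longrightarrow> x0 \<in> V \<Longrightarrow> V \<subseteq> ball x0 \<rho> \<Longrightarrow>
       cvec_holomorphic h1 V \<Longrightarrow> cvec_holomorphic h2 V \<Longrightarrow> (\<And>x. x \<in> V \<Longrightarrow> g x = h1 x * h2 x) \<Longrightarrow>
       h1 x0 \<noteq> 0 \<or> h2 x0 \<noteq> 0"
    and dvd: "\<And>x. x \<in> ball x0 \<rho> \<Longrightarrow> \<psi> x = g x ^ k * h x"
    and ndvd: "\<And>V h. open V \<Longrightarrow> x0 \<in> V \<Longrightarrow> V \<subseteq> ball x0 \<rho> \<Longrightarrow> cvec_holomorphic h V \<Longrightarrow>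
       (\<And>x. x \<in> V \<Longrightarrow> \<psi> x = g x ^ Suc k * h x) \<Longrightarrow> False"
  shows "k = 1"
proof -
  let ?B = "ball x0 \<rho>"
  have x0: "x0 \<in> ?B" using \<rho> by simp
  obtain x2 where x2: "x2 \<in> ?B" "L x2 \<noteq> 0"
    by (rule nonzero_of_partial_deriv[OF open_ball x0 L0(2)])
  have rel': "\<phi> x * L x - N x * \<psi> x = 0" if x: "x \<in> ?B" for x
  proof -
    have 1: "(\<phi> x * L x - N x * \<psi> x) * \<psi> x = 0" if x: "x \<in> ?B" for x
    proof (rule hol_integral_domain[OF convex_ball open_ball _ hol(1) _ x2 x])
      show "cvec_holomorphic (\<lambda>x. (\<phi> x * L x - N x * \<psi> x) * \<psi> x) ?B"
        by (intro hol_intros hol)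
      show "(\<phi> x * L x - N x * \<psi> x) * \<psi> x * L x = 0" if "x \<in> ?B" for x
        using rel[OF that] by auto
    qed
    show ?thesis
      by (rule hol_integral_domain[OF convex_ball open_ball _ hol(4) 1 \<psi>nz x])
         (intro hol_intros hol)
  qed
  obtain U where U: "open U" "x0 \<in> U" "U \<subseteq> ?B"
    and ident: "\<And>f W p x. cvec_holomorphic f U \<Longrightarrow> open W \<Longrightarrow> p \<in> W \<inter> U \<Longrightarrow> L p = 0 \<Longrightarrow>
       (\<And>x. x \<in> W \<inter> U \<Longrightarrow> L x = 0 \<Longrightarrow> f x = 0) \<Longrightarrow> x \<in> U \<Longrightarrow> L x = 0 \<Longrightarrow> f x = 0"
    and divi: "\<And>f. cvec_holomorphic f U \<Longrightarrow> (\<And>x. x \<in> U \<Longrightarrow> L x = 0 \<Longrightarrow> f x = 0) \<Longrightarrow>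
       \<exists>h. cvec_holomorphic h U \<and> (\<forall>x\<in>U. f x = L x * h x)"
    using smooth_hypersurface[OF open_ball hol(1) x0 L0] by blast
  note holU = hol[THEN hol_subset, OF U(3)]
  obtain p where p: "p \<in> U" "L p = 0" "N p \<noteq> 0" using Nnz[OF U] by blast
  have "\<psi> x = 0" if "x \<in> U" "L x = 0" for x
  proof (rule ident[OF holU(4) _ _ p(2) _ that])
    show "open {x \<in> U. N x \<noteq> 0}" by (rule open_nonzero_set[OF U(1) holU(2)])
    show "p \<in> {x \<in> U. N x \<noteq> 0} \<inter> U" using p by auto
    show "\<psi> x = 0" if "x \<in> {x \<in> U. N x \<noteq> 0} \<inter> U" "L x = 0" for x
      using rel'[of x] that U by auto
  qed
  then obtain \<psi>' where \<psi>': "cvec_holomorphic \<psi>' U" "\<And>x. x \<in> U \<Longrightarrow> \<psi> x = L x * \<psi>' x"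
    using divi[OF holU(4)] by blast
  obtain e where e: "e > 0" "ball x0 e \<subseteq> U" using U open_contains_ball by blast
  obtain x3 where x3: "x3 \<in> ball x0 e" "L x3 \<noteq> 0"
    by (rule nonzero_on_subball[OF convex_ball open_ball hol(1) x2, of x0 e]) (use e U in auto)
  have \<phi>': "\<phi> x - N x * \<psi>' x = 0" if "x \<in> ball x0 e" for x
  proof -
    show ?thesis
    proof (rule hol_integral_domain[OF convex_ball open_ball _ hol_subset[OF holU(1) e(2)] _ x3 that])
      show "cvec_holomorphic (\<lambda>x. \<phi> x - N x * \<psi>' x) (ball x0 e)"
        by (intro hol_intros hol_subset[OF _ e(2)] holU \<psi>')
      show "(\<phi> x - N x * \<psi>' x) * L x = 0" if "x \<in> ball x0 e" for x
      proof -
        have "x \<in> U" "x \<in> ?B" using that e(2) U(3) by blast+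
        then show ?thesis using rel'[of x] \<psi>'(2)[of x] by (simp add: algebra_simps)
      qed
    qed
  qed
  have eB: "ball x0 e \<subseteq> ?B" using e U by blast
  have x0e: "x0 \<in> ball x0 e" using e by simp
  have \<psi>'0: "\<psi>' x0 \<noteq> 0"
  proof (rule coprime[OF open_ball x0e eB])
    show "cvec_holomorphic \<psi>' (ball x0 e)" "cvec_holomorphic N (ball x0 e)" "cvec_holomorphic L (ball x0 e)"
      by (rule hol_subset[OF _ e(2)], fact \<psi>' holU)+
    show "\<phi> x = \<psi>' x * N x" if "x \<in> ball x0 e" for x using \<phi>'[OF that] by (simp add: mult.commute)
    show "\<psi> x = \<psi>' x * L x" if "x \<in> ball x0 e" for x using \<psi>'(2)[of x] that e by (auto simp: mult.commute)
  qed
  obtain g' where g': "cvec_holomorphic g' U" "\<And>x. x \<in> U \<Longrightarrow> g x = L x * g' x"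
    using divi[OF holU(5)] gz U by blast
  have g'0: "g' x0 \<noteq> 0" using irred[OF U holU(1) g'(1) g'(2)] L0 by auto
  show "k = 1"
  proof (rule ccontr)
    assume "k \<noteq> 1"
    then consider "k = 0" | "k \<ge> 2" by linarith
    then show False
    proof cases
      case 1
      define V where "V = {x \<in> U. g' x \<noteq> 0}"
      have "open V" unfolding V_def by (rule open_nonzero_set[OF U(1) g'(1)])
      moreover have "cvec_holomorphic (\<lambda>x. \<psi>' x / g' x) V"
        by (intro hol_intros hol_subset[OF g'(1)] hol_subset[OF \<psi>'(1)])
           (auto simp: V_def)
      moreover have "\<psi> x = g x ^ Suc k * (\<psi>' x / g' x)" if "x \<in> V" for x
        using \<psi>'(2)[of x] g'(2)[of x] that 1 by (auto simp: V_def)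
      ultimately show False
        using ndvd[of V "\<lambda>x. \<psi>' x / g' x"] U g'0 by (auto simp: V_def)
    next
      case 2
      then obtain l where l: "k = Suc (Suc l)" by (metis Suc_le_D numeral_2_eq_2 Suc_le_mono)
      define H where "H x = \<psi>' x - L x ^ Suc l * g' x ^ k * h x" for x
      have "H x0 = 0"
      proof -
        show ?thesis
        proof (rule hol_integral_domain[OF convex_ball open_ball _ hol_subset[OF holU(1) e(2)] _ x3 x0e])
          show "cvec_holomorphic H (ball x0 e)"
            unfolding H_def
            by (intro hol_intros hol_subset[OF _ e(2)] holU \<psi>' g')
          show "H x * L x = 0" if "x \<in> ball x0 e" for x
          proof -
            have "x \<in> U" "x \<in> ?B" using that e eB by auto
            then have "L x * \<psi>' x = (L x * g' x) ^ k * h x"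
              using dvd[of x] \<psi>'(2)[of x] g'(2)[of x] by simp
            then show ?thesis by (simp add: H_def l power_mult_distrib algebra_simps)
          qed
        qed
      qed
      then show False using \<psi>'0 L0 by (simp add: H_def)
    qed
  qed
qed

text \<open>
  The negation of this is the maximality condition on the points of a polar locus.
\<close>

definition hol_extends :: "'z::topological_space set \<Rightarrow> ('z \<Rightarrow> complex ^ 'n) \<Rightarrow> ('z \<Rightarrow> complex) \<Rightarrow> 'z set \<Rightarrow> 'z \<Rightarrow> bool" where
  "hol_extends Z p f P z \<longleftrightarrow>
     (\<exists>W g. nbhd_in Z z W \<and> cover_holomorphic Z p g W \<and> (\<forall>w\<in>W - P. g w = f w))"

lemma hol_extendsI:
  assumes c: "ball_chart Z p z r q" and X: "open X" "x \<in> X" "X \<subseteq> ball (p z) r"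
    and h: "cvec_holomorphic h X" and eq: "\<And>y. y \<in> X \<Longrightarrow> q y \<notin> P \<Longrightarrow> h y = f (q y)"
  shows "hol_extends Z p f P (q x)"
  unfolding hol_extends_def
proof (intro exI conjI)
  have pq: "p (q y) = y" if "y \<in> X" for y using ball_chartD(5)[OF c] X(3) that by blast
  show "openin (top_of_set Z) (q ` X)" by (rule ball_chart_openin(1)[OF c X(1,3)])
  show "q x \<in> q ` X" using X(2) by blast
  show "cover_holomorphic Z p (\<lambda>w. h (p w)) (q ` X)"
  proof (rule chart_cover_holomorphic[OF c X(1,3)])
    show "cvec_holomorphic (\<lambda>x. h (p (q x))) X"
      by (rule hol_cong[OF X(1) _ h]) (simp add: pq)
  qed
  show "\<forall>w\<in>q ` X - P. h (p w) = f w" using eq pq by auto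
qed

text \<open>
  If \<open>N\<close> vanished on \<open>L = 0\<close> near \<open>z\<close>, then \<open>L\<close> would divide \<open>N\<close> and \<open>f\<close> would extend to the pole \<open>z\<close>. So it
  does not, and by the identity theorem on the hypersurface it does not vanish identically on any open
  piece of it; hence no point of \<open>L = 0\<close> near \<open>z\<close> is regular for \<open>f\<close>, and \<open>P\<close> is \<open>L = 0\<close> near \<open>z\<close>.
\<close>

theorem polar_divisor_smooth_order_one:
  fixes L N :: "complex ^ 'n \<Rightarrow> complex"
  assumes c: "ball_chart Z p z r q"
    and L: "cvec_holomorphic L (ball (p z) r)" and N: "cvec_holomorphic N (ball (p z) r)"
    and grad: "L (p z) = 0 \<Longrightarrow> \<exists>j. partial_deriv j L (p z) \<noteq> 0"
    and closed: "closedin (top_of_set Z) P" and f: "cover_holomorphic Z p f (Z - P)"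
    and eq: "\<And>x. x \<in> ball (p z) r \<Longrightarrow> q x \<notin> P \<Longrightarrow> f (q x) * L x = N x"
    and z: "z \<in> P" and polar: "\<And>w. w \<in> P \<Longrightarrow> \<not> hol_extends Z p f P w"
  shows "regular_point Z p P z \<and> polar_order Z p f P z = -1"
proof -
  let ?B = "ball (p z) r"
  let ?x0 = "p z"
  have x0: "?x0 \<in> ?B" "q ?x0 = z" using ball_chartD(1,2)[OF c] by auto
  have pq: "p (q x) = x" if "x \<in> ?B" for x using ball_chartD(5)[OF c that] .
  have openP: "openin (top_of_set Z) (Z - P)" using closed by (simp add: openin_diff)
  have offP: "open {x \<in> ?B. q x \<notin> P}"
  proof -
    have "{x \<in> ?B. q x \<notin> P} = {x \<in> ?B. q x \<in> Z - P}" using ball_chartD(6)[OF c] by auto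
    then show ?thesis using ball_chart_preimage_open[OF c openP] by simp
  qed
  have fq: "cvec_holomorphic (\<lambda>x. f (q x)) {x \<in> ?B. q x \<notin> P}"
    by (rule cover_holomorphic_chart[OF f c offP]) (use ball_chartD(6)[OF c] in auto)
  have P_zero: "L x = 0" if "x \<in> ?B" "q x \<in> P" for x
  proof (rule ccontr)
    assume nz: "L x \<noteq> 0"
    let ?X = "{x \<in> ?B. L x \<noteq> 0}"
    have "hol_extends Z p f P (q x)"
    proof (rule hol_extendsI[OF c, of ?X])
      show "open ?X" by (rule open_nonzero_set[OF open_ball L])
      show "cvec_holomorphic (\<lambda>x. N x / L x) ?X"
        by (intro hol_intros hol_subset[OF L] hol_subset[OF N]) auto
      show "N y / L y = f (q y)" if "y \<in> ?X" "q y \<notin> P" for y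
        using eq[of y] that by (auto simp: field_simps)
    qed (use that nz in auto)
    then show False using polar that by blast
  qed
  have L0: "L ?x0 = 0" using P_zero x0 z by simp
  then obtain j where j: "partial_deriv j L ?x0 \<noteq> 0" using grad by blast
  obtain y0 where y0: "y0 \<in> ?B" "L y0 \<noteq> 0"
    by (rule nonzero_of_partial_deriv[OF open_ball x0(1) j])
  note Lnz = nonzero_on_subball[OF convex_ball open_ball L y0]
  obtain U where U: "open U" "?x0 \<in> U" "U \<subseteq> ?B"
    and ident: "\<And>f W p x. cvec_holomorphic f U \<Longrightarrow> open W \<Longrightarrow> p \<in> W \<inter> U \<Longrightarrow> L p = 0 \<Longrightarrow>
       (\<And>x. x \<in> W \<inter> U \<Longrightarrow> L x = 0 \<Longrightarrow> f x = 0) \<Longrightarrow> x \<in> U \<Longrightarrow> L x = 0 \<Longrightarrow> f x = 0"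
    and divi: "\<And>f. cvec_holomorphic f U \<Longrightarrow> (\<And>x. x \<in> U \<Longrightarrow> L x = 0 \<Longrightarrow> f x = 0) \<Longrightarrow>
       \<exists>h. cvec_holomorphic h U \<and> (\<forall>x\<in>U. f x = L x * h x)"
    using smooth_hypersurface[OF open_ball L x0(1) L0 j] by blast
  note LU = hol_subset[OF L U(3)] and NU = hol_subset[OF N U(3)]
  have N_not_zero: "\<exists>x\<in>U. L x = 0 \<and> N x \<noteq> 0"
  proof (rule ccontr)
    assume "\<not> ?thesis"
    then obtain h where h: "cvec_holomorphic h U" "\<And>x. x \<in> U \<Longrightarrow> N x = L x * h x"
      using divi[OF NU] by blast
    have "h x = f (q x)" if x: "x \<in> U" "q x \<notin> P" for x
    proof -
      have "open (U \<inter> {x \<in> ?B. q x \<notin> P})" using U(1) offP by blast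
      then obtain e where e: "e > 0" "ball x e \<subseteq> U \<inter> {x \<in> ?B. q x \<notin> P}"
        using x U(3) open_contains_ball by (metis (no_types, lifting) IntI mem_Collect_eq subsetD)
      then have eB: "ball x e \<subseteq> ?B" by blast
      obtain x3 where x3: "x3 \<in> ball x e" "L x3 \<noteq> 0" using Lnz[OF eB e(1)] .
      have "h x - f (q x) = 0"
      proof (rule hol_integral_domain[OF convex_ball open_ball _ hol_subset[OF L eB] _ x3])
        show "cvec_holomorphic (\<lambda>x. h x - f (q x)) (ball x e)"
          by (intro hol_diff hol_subset[OF h(1)] hol_subset[OF fq])
             (use e in auto)
        show "(h y - f (q y)) * L y = 0" if "y \<in> ball x e" for y
        proof -
          have "y \<in> U" "y \<in> ?B" "q y \<notin> P" using that e(2) by blast+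
          then show ?thesis using eq[of y] h(2)[of y] by auto
        qed
      qed (use e in simp)
      then show ?thesis by simp
    qed
    then have "hol_extends Z p f P (q ?x0)"
      by (intro hol_extendsI[OF c U h(1)]) auto
    then show False using polar z x0 by simp
  qed
  have N_not_zero': "\<exists>x\<in>V. L x = 0 \<and> N x \<noteq> 0" if V: "open V" "?x0 \<in> V" for V
  proof (rule ccontr)
    assume no: "\<not> ?thesis"
    have "N x = 0" if "x \<in> U" "L x = 0" for x
      by (rule ident[OF NU V(1) _ L0 _ that]) (use V U no in auto)
    then show False using N_not_zero by blast
  qed
  have PU: "q x \<in> P \<longleftrightarrow> L x = 0" if x: "x \<in> U" for x
  proof
    show "L x = 0" if "q x \<in> P" using P_zero that x U(3) by blast
    show "q x \<in> P" if Lx: "L x = 0"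
    proof (rule ccontr)
      assume nP: "q x \<notin> P"
      have "N y = 0" if "y \<in> U" "L y = 0" for y
      proof (rule ident[OF NU offP _ Lx _ that])
        show "x \<in> {x \<in> ?B. q x \<notin> P} \<inter> U" using x nP U(3) by auto
        show "N y = 0" if "y \<in> {x \<in> ?B. q x \<notin> P} \<inter> U" "L y = 0" for y
          using eq[of y] that by auto
      qed
      then show False using N_not_zero by blast
    qed
  qed
  have reg: "regular_point Z p P z"
    unfolding regular_point_def
  proof (intro conjI exI)
    have pqU: "p ` q ` U = U" using U(3) pq by (force simp: image_image)
    show "cover_chart Z p (q ` U) q"
      using ball_chart_openin[OF c U(1,3)] U(1) pqU by (simp add: cover_chart_def)
    show "z \<in> q ` U" using U(2) x0(2) by (metis image_eqI)
    have LpU: "cvec_holomorphic (\<lambda>x. L (p (q x))) U"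
      by (rule hol_cong[OF U(1) _ LU]) (use pq U(3) in auto)
    show "\<forall>k<1. cover_holomorphic Z p ((\<lambda>(k::nat) w. L (p w)) k) (q ` U)"
      using chart_cover_holomorphic[OF c U(1,3) LpU] by simp
    have "L (p (q x)) = L x" if "x \<in> U" for x using pq U(3) that by auto
    then show "P \<inter> q ` U = {w \<in> q ` U. \<forall>k<1. (\<lambda>(k::nat) w. L (p w)) k w = 0}"
      using PU by auto
    show "\<forall>cf :: nat \<Rightarrow> complex. (\<forall>i. (\<Sum>k<1. cf k * deriv (\<lambda>x. L (p (q (coord_upd (p z) i x)))) (p z $ i)) = 0)
             \<longrightarrow> (\<forall>k<1. cf k = 0)"
    proof (intro allI impI)
      fix cf :: "nat \<Rightarrow> complex" and k :: nat
      assume 0: "\<forall>i. (\<Sum>k<1. cf k * deriv (\<lambda>x. L (p (q (coord_upd (p z) i x)))) (p z $ i)) = 0" and k: "k < 1"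
      have "deriv (\<lambda>x. L (p (q (coord_upd (p z) j x)))) (p z $ j) = partial_deriv j (\<lambda>x. L (p (q x))) ?x0"
        by (simp add: partial_deriv_def)
      also have "\<dots> = partial_deriv j L ?x0"
        by (rule partial_deriv_cong[OF U(1) _ U(2)]) (use pq U(3) in auto)
      finally show "cf k = 0" using spec[OF 0, of j] j k by simp
    qed
  qed (rule z)
  note hg = hol_germ_iff[OF c] and ge = nbhd_iff[OF c]
  have germL: "hol_germ Z p z (\<lambda>w. L (p w))" and germN: "hol_germ Z p z (\<lambda>w. N (p w))"
    by (rule hol_germ_comp_proj[OF c open_ball x0(1)], fact L N)+
  \<comment> \<open>A product of two non-units has vanishing differential, so \<open>L\<close> is irreducible.\<close>
  have L_prime: "h1 ?x0 \<noteq> 0 \<or> h2 ?x0 \<noteq> 0"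
    if V: "open V" "?x0 \<in> V" and h: "cvec_holomorphic h1 V" "cvec_holomorphic h2 V"
      and e: "\<And>x. x \<in> V \<Longrightarrow> L x = h1 x * h2 x" for V h1 h2
  proof (rule ccontr)
    assume "\<not> ?thesis"
    moreover have "partial_deriv j L ?x0 = partial_deriv j (\<lambda>x. h1 x * h2 x) ?x0"
      by (rule partial_deriv_cong[OF V(1) e V(2)])
    ultimately show False using j partial_deriv_mult[OF h V(2), of j] by simp
  qed
  have factor: "\<exists>V. open V \<and> ?x0 \<in> V \<and> V \<subseteq> ?B \<and> cvec_holomorphic (\<lambda>x. h (q x)) V \<and> (\<forall>x\<in>V. b (q x) = a (q x) * h (q x))"
    if hh: "hol_germ Z p z h" and bb: "germ_eq Z z b (\<lambda>w. a w * h w)" for h a b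
  proof -
    obtain X where X: "open X" "?x0 \<in> X" "X \<subseteq> ?B" "cvec_holomorphic (\<lambda>x. h (q x)) X"
      using hh unfolding hg by blast
    obtain Y where Y: "open Y" "?x0 \<in> Y" "Y \<subseteq> ?B" "\<forall>x\<in>Y. b (q x) = a (q x) * h (q x)"
      using bb unfolding germ_eq_def ge by blast
    show ?thesis
      by (intro exI[of _ "X \<inter> Y"]) (use X Y in \<open>auto intro: hol_subset[OF X(4)]\<close>)
  qed
  \<comment> \<open>\<open>N / L\<close> is in lowest terms and \<open>L\<close> is its own irreducible factor, with exponent \<open>1\<close>.\<close>
  have order_exists: "local_quotient Z p f P z (\<lambda>w. N (p w)) (\<lambda>w. L (p w)) \<and>
      germ_coprime Z p z (\<lambda>w. N (p w)) (\<lambda>w. L (p w)) \<and>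
      germ_irreducible Z p z (\<lambda>w. L (p w)) \<and>
      (\<exists>W. nbhd_in Z z W \<and> {w \<in> W. L (p w) = 0} = P \<inter> W) \<and>
      germ_dvd Z p z (\<lambda>w. L (p w) ^ 1) (\<lambda>w. L (p w)) \<and>
      \<not> germ_dvd Z p z (\<lambda>w. L (p w) ^ Suc 1) (\<lambda>w. L (p w))"
  proof (intro conjI)
    show "local_quotient Z p f P z (\<lambda>w. N (p w)) (\<lambda>w. L (p w))"
      unfolding local_quotient_def
    proof (intro conjI germL germN)
      show "\<not> germ_eq Z z (\<lambda>w. L (p w)) (\<lambda>_. 0)"
      proof
        assume "germ_eq Z z (\<lambda>w. L (p w)) (\<lambda>_. 0)"
        then obtain X where X: "open X" "?x0 \<in> X" "X \<subseteq> ?B" "\<forall>x\<in>X. L (p (q x)) = 0"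
          unfolding germ_eq_def ge by blast
        then obtain e where e: "e > 0" "ball ?x0 e \<subseteq> X" using open_contains_ball by blast
        obtain y where y: "y \<in> ball ?x0 e" "L y \<noteq> 0" using Lnz[OF subset_trans[OF e(2) X(3)] e(1)] .
        then have "y \<in> X" "y \<in> ?B" using e(2) X(3) by blast+
        then show False using X(4) pq[of y] y(2) by auto
      qed
      show "\<exists>W. nbhd_in Z z W \<and> (\<forall>w\<in>W - P. L (p w) \<noteq> 0 \<longrightarrow> f w = N (p w) / L (p w))"
      proof (intro exI conjI)
        show "openin (top_of_set Z) (q ` ?B)" "z \<in> q ` ?B" using ball_chartD(3,7)[OF c] by auto
        show "\<forall>w\<in>q ` ?B - P. L (p w) \<noteq> 0 \<longrightarrow> f w = N (p w) / L (p w)"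
          using eq pq by (auto simp: field_simps)
      qed
    qed
    show "germ_coprime Z p z (\<lambda>w. N (p w)) (\<lambda>w. L (p w))"
      unfolding germ_coprime_def
    proof (intro allI impI notI)
      fix h assume "hol_germ Z p z h \<and> germ_dvd Z p z h (\<lambda>w. N (p w)) \<and> germ_dvd Z p z h (\<lambda>w. L (p w))" and hz: "h z = 0"
      then obtain h1 h2 where h: "hol_germ Z p z h" "hol_germ Z p z h1" "germ_eq Z z (\<lambda>w. N (p w)) (\<lambda>w. h w * h1 w)"
        "hol_germ Z p z h2" "germ_eq Z z (\<lambda>w. L (p w)) (\<lambda>w. h w * h2 w)"
        unfolding germ_dvd_def by blast
      obtain X where X: "open X" "?x0 \<in> X" "X \<subseteq> ?B" "cvec_holomorphic (\<lambda>x. h (q x)) X"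
        using h(1) unfolding hg by blast
      obtain V1 where V1: "open V1" "?x0 \<in> V1" "V1 \<subseteq> ?B" "\<forall>x\<in>V1. N (p (q x)) = h (q x) * h1 (q x)"
        using factor[OF h(2,3)] by blast
      obtain V2 where V2: "open V2" "?x0 \<in> V2" "V2 \<subseteq> ?B" "cvec_holomorphic (\<lambda>x. h2 (q x)) V2"
        "\<forall>x\<in>V2. L (p (q x)) = h (q x) * h2 (q x)"
        using factor[OF h(4,5)] by blast
      have "h (q ?x0) \<noteq> 0 \<or> h2 (q ?x0) \<noteq> 0"
      proof (rule L_prime[of "X \<inter> V2"])
        show "L x = h (q x) * h2 (q x)" if x: "x \<in> X \<inter> V2" for x
          proof -
            have "p (q x) = x" using x X(3) pq by blast
            then show ?thesis using x V2(5) by auto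
          qed
      qed (use X V2 in \<open>auto intro: hol_subset\<close>)
      then have "h2 (q ?x0) \<noteq> 0" using hz x0 by simp
      moreover define V where "V = V1 \<inter> {x \<in> V2. h2 (q x) \<noteq> 0}"
      have "open V"
        unfolding V_def using V1(1) open_nonzero_set[OF V2(1,4)] by blast
      ultimately obtain x where x: "x \<in> V" "L x = 0" "N x \<noteq> 0"
        using N_not_zero'[of V] V1 V2 by (auto simp: V_def)
      moreover have "x \<in> ?B" "p (q x) = x" using x(1) V1(3) pq by (auto simp: V_def)
      ultimately have "N x = h (q x) * h1 (q x)" "L x = h (q x) * h2 (q x)" "h2 (q x) \<noteq> 0"
        using bspec[OF V1(4), of x] bspec[OF V2(5), of x] by (auto simp: V_def)
      with x show False by simp
    qed
    show "germ_irreducible Z p z (\<lambda>w. L (p w))"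
      unfolding germ_irreducible_def
    proof (intro conjI allI impI germL)
      show "L (p z) = 0" by (rule L0)
      fix h1 h2 assume "hol_germ Z p z h1 \<and> hol_germ Z p z h2 \<and> germ_eq Z z (\<lambda>w. L (p w)) (\<lambda>w. h1 w * h2 w)"
      then have h: "hol_germ Z p z h1" "hol_germ Z p z h2" "germ_eq Z z (\<lambda>w. L (p w)) (\<lambda>w. h1 w * h2 w)" by auto
      obtain X where X: "open X" "?x0 \<in> X" "X \<subseteq> ?B" "cvec_holomorphic (\<lambda>x. h1 (q x)) X"
        using h(1) unfolding hg by blast
      obtain V2 where V2: "open V2" "?x0 \<in> V2" "V2 \<subseteq> ?B" "cvec_holomorphic (\<lambda>x. h2 (q x)) V2"
        "\<forall>x\<in>V2. L (p (q x)) = h1 (q x) * h2 (q x)"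
        using factor[OF h(2,3)] by blast
      show "h1 z \<noteq> 0 \<or> h2 z \<noteq> 0"
      proof -
        have "h1 (q ?x0) \<noteq> 0 \<or> h2 (q ?x0) \<noteq> 0"
        proof (rule L_prime[of "X \<inter> V2"])
          show "L x = h1 (q x) * h2 (q x)" if x: "x \<in> X \<inter> V2" for x
            proof -
              have "p (q x) = x" using x X(3) pq by blast
              then show ?thesis using x V2(5) by auto
            qed
        qed (use X V2 in \<open>auto intro: hol_subset\<close>)
        then show ?thesis using x0 by simp
      qed
    qed
    show "\<exists>W. nbhd_in Z z W \<and> {w \<in> W. L (p w) = 0} = P \<inter> W"
    proof (intro exI conjI)
      show "openin (top_of_set Z) (q ` U)" by (rule ball_chart_openin(1)[OF c U(1,3)])
      show "z \<in> q ` U" using U(2) x0(2) by (metis image_eqI)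
      have "L (p (q x)) = L x" if "x \<in> U" for x using pq U(3) that by auto
      then show "{w \<in> q ` U. L (p w) = 0} = P \<inter> q ` U" using PU by auto
    qed
    have "hol_germ Z p z (\<lambda>w. 1)"
      using hol_germ_comp_proj[OF c open_ball x0(1) hol_const[of 1]] .
    then show "germ_dvd Z p z (\<lambda>w. L (p w) ^ 1) (\<lambda>w. L (p w))"
      unfolding germ_dvd_def germ_eq_def using ball_chartD(3,7)[OF c]
      by (intro exI[of _ "\<lambda>w. 1"]) auto
    show "\<not> germ_dvd Z p z (\<lambda>w. L (p w) ^ Suc 1) (\<lambda>w. L (p w))"
    proof
      assume "germ_dvd Z p z (\<lambda>w. L (p w) ^ Suc 1) (\<lambda>w. L (p w))"
      then obtain h where h: "hol_germ Z p z h" "germ_eq Z z (\<lambda>w. L (p w)) (\<lambda>w. L (p w) ^ Suc 1 * h w)"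
        unfolding germ_dvd_def by blast
      obtain V where V: "open V" "?x0 \<in> V" "V \<subseteq> ?B" "cvec_holomorphic (\<lambda>x. h (q x)) V"
        "\<forall>x\<in>V. L (p (q x)) = L (p (q x)) ^ Suc 1 * h (q x)"
        using factor[OF h] by blast
      have LV: "cvec_holomorphic L V" by (rule hol_subset[OF L V(3)])
      have e: "L x = L x * (L x * h (q x))" if "x \<in> V" for x
      proof -
        have "p (q x) = x" using that V(3) pq by blast
        then show ?thesis using bspec[OF V(5) that] by simp
      qed
      have "L ?x0 \<noteq> 0 \<or> L ?x0 * h (q ?x0) \<noteq> 0"
        by (rule L_prime[OF V(1,2) LV _ e]) (intro hol_mult LV V(4))
      then show False using L0 by simp
    qed
  qed
  have order_unique: "k = 1"
    if lq: "local_quotient Z p f P z \<phi> \<psi>" and co: "germ_coprime Z p z \<phi> \<psi>"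
      and ir: "germ_irreducible Z p z g" and gP: "\<exists>W. nbhd_in Z z W \<and> {w \<in> W. g w = 0} = P \<inter> W"
      and dv: "germ_dvd Z p z (\<lambda>w. g w ^ k) \<psi>" and ndv: "\<not> germ_dvd Z p z (\<lambda>w. g w ^ Suc k) \<psi>"
    for \<phi> \<psi> g k
  proof -
    have \<phi>: "hol_germ Z p z \<phi>" and \<psi>: "hol_germ Z p z \<psi>" and \<psi>nz: "\<not> germ_eq Z z \<psi> (\<lambda>_. 0)"
      and quo: "\<exists>W. nbhd_in Z z W \<and> (\<forall>w\<in>W. w \<notin> P \<longrightarrow> \<psi> w \<noteq> 0 \<longrightarrow> f w = \<phi> w / \<psi> w)"
      using lq unfolding local_quotient_def by auto
    have gg: "hol_germ Z p z g" using ir unfolding germ_irreducible_def by blast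
    obtain h where h: "hol_germ Z p z h" "germ_eq Z z \<psi> (\<lambda>w. g w ^ k * h w)"
      using dv unfolding germ_dvd_def by blast
    obtain X1 where X1: "open X1" "?x0 \<in> X1" "X1 \<subseteq> ?B" "cvec_holomorphic (\<lambda>x. \<phi> (q x)) X1"
      using \<phi> unfolding hg by blast
    obtain X2 where X2: "open X2" "?x0 \<in> X2" "X2 \<subseteq> ?B" "cvec_holomorphic (\<lambda>x. \<psi> (q x)) X2"
      using \<psi> unfolding hg by blast
    obtain X3 where X3: "open X3" "?x0 \<in> X3" "X3 \<subseteq> ?B" "cvec_holomorphic (\<lambda>x. g (q x)) X3"
      using gg unfolding hg by blast
    obtain X4 where X4: "open X4" "?x0 \<in> X4" "X4 \<subseteq> ?B" "\<forall>x\<in>X4. q x \<notin> P \<longrightarrow> \<psi> (q x) \<noteq> 0 \<longrightarrow> f (q x) = \<phi> (q x) / \<psi> (q x)"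
      using quo unfolding ge by blast
    have "\<exists>W. nbhd_in Z z W \<and> (\<forall>w\<in>W. g w = 0 \<longleftrightarrow> w \<in> P)" using gP by blast
    then obtain X5 where X5: "open X5" "?x0 \<in> X5" "X5 \<subseteq> ?B" "\<forall>x\<in>X5. g (q x) = 0 \<longleftrightarrow> q x \<in> P"
      unfolding ge by blast
    obtain X6 where X6: "open X6" "?x0 \<in> X6" "X6 \<subseteq> ?B" "cvec_holomorphic (\<lambda>x. h (q x)) X6"
        "\<forall>x\<in>X6. \<psi> (q x) = g (q x) ^ k * h (q x)"
      using factor[OF h] by blast
    have "open (U \<inter> X1 \<inter> X2 \<inter> X3 \<inter> X4 \<inter> X5 \<inter> X6)"
      by (intro open_Int U(1) X1(1) X2(1) X3(1) X4(1) X5(1) X6(1))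
    moreover have "?x0 \<in> U \<inter> X1 \<inter> X2 \<inter> X3 \<inter> X4 \<inter> X5 \<inter> X6"
      by (intro IntI U(2) X1(2) X2(2) X3(2) X4(2) X5(2) X6(2))
    ultimately obtain \<rho> where \<rho>: "\<rho> > 0" and sub: "ball ?x0 \<rho> \<subseteq> U \<inter> X1 \<inter> X2 \<inter> X3 \<inter> X4 \<inter> X5 \<inter> X6"
      using open_contains_ball by blast
    let ?C = "ball ?x0 \<rho>"
    have CB: "?C \<subseteq> ?B" using sub U(3) by blast
    have toZ: "hol_germ Z p z (\<lambda>w. h (p w))" if "open V" "?x0 \<in> V" "cvec_holomorphic h V" for V h
      by (rule hol_germ_comp_proj[OF c that])
    have eqZ: "germ_eq Z z a b" if "open V" "?x0 \<in> V" "V \<subseteq> ?C" "\<And>x. x \<in> V \<Longrightarrow> a (q x) = b (q x)" for V a b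
      unfolding germ_eq_def ge using that CB by blast
    have \<psi>1: "\<exists>x\<in>?C. \<psi> (q x) \<noteq> 0"
    proof (rule ccontr)
      assume "\<not> ?thesis"
      then have "germ_eq Z z \<psi> (\<lambda>_. 0)"
        by (intro eqZ[of ?C]) (use \<rho> in auto)
      then show False using \<psi>nz by blast
    qed
    then obtain x1 where x1: "x1 \<in> ?C" "\<psi> (q x1) \<noteq> 0" by blast
    show "k = 1"
    proof (rule polar_order_unique_core[OF \<rho>, where L = L and N = N and \<phi> = "\<lambda>x. \<phi> (q x)" and \<psi> = "\<lambda>x. \<psi> (q x)"
          and g = "\<lambda>x. g (q x)" and h = "\<lambda>x. h (q x)" and j = j, OF _ _ _ _ _ _ L0 j])
      show "cvec_holomorphic L ?C" "cvec_holomorphic N ?C"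
        using hol_subset[OF L CB] hol_subset[OF N CB] by auto
      show "cvec_holomorphic (\<lambda>x. \<phi> (q x)) ?C" by (rule hol_subset[OF X1(4)]) (use sub in blast)
      show "cvec_holomorphic (\<lambda>x. \<psi> (q x)) ?C" by (rule hol_subset[OF X2(4)]) (use sub in blast)
      show "cvec_holomorphic (\<lambda>x. g (q x)) ?C" by (rule hol_subset[OF X3(4)]) (use sub in blast)
      show "cvec_holomorphic (\<lambda>x. h (q x)) ?C" by (rule hol_subset[OF X6(4)]) (use sub in blast)
      show "\<exists>x\<in>V. L x = 0 \<and> N x \<noteq> 0" if "open V" "?x0 \<in> V" for V using N_not_zero'[OF that] .
      show "\<phi> (q x) * L x = N x * \<psi> (q x)" if x: "x \<in> ?C" "L x \<noteq> 0" "\<psi> (q x) \<noteq> 0" for x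
      proof -
        have "x \<in> U" "x \<in> X4" "x \<in> ?B" using x(1) sub CB by blast+
        then have "q x \<notin> P" "f (q x) = \<phi> (q x) / \<psi> (q x)" using PU x X4(4) by auto
        then have "\<phi> (q x) = f (q x) * \<psi> (q x)" "N x = f (q x) * L x"
          using eq[OF \<open>x \<in> ?B\<close>] x(3) by auto
        then show ?thesis by simp
      qed
      show "x1 \<in> ?C" "\<psi> (q x1) \<noteq> 0" by fact+
      show "g (q x) = 0 \<longleftrightarrow> L x = 0" if x: "x \<in> ?C" for x
      proof -
        have "x \<in> U" "x \<in> X5" using x sub by blast+
        then show ?thesis using PU X5(4) by auto
      qed
      show "h' ?x0 \<noteq> 0" if V: "open V" "?x0 \<in> V" "V \<subseteq> ?C" and hh: "cvec_holomorphic h' V"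
          "cvec_holomorphic h1 V" "cvec_holomorphic h2 V"
          and e: "\<And>x. x \<in> V \<Longrightarrow> \<phi> (q x) = h' x * h1 x" "\<And>x. x \<in> V \<Longrightarrow> \<psi> (q x) = h' x * h2 x" for V h' h1 h2
      proof -
        have pV: "p (q x) = x" if "x \<in> V" for x using that V(3) CB pq by blast
        have "germ_dvd Z p z (\<lambda>w. h' (p w)) \<phi>" "germ_dvd Z p z (\<lambda>w. h' (p w)) \<psi>"
          unfolding germ_dvd_def using toZ[OF V(1,2) hh(2)] toZ[OF V(1,2) hh(3)]
            eqZ[OF V, of \<phi> "\<lambda>w. h' (p w) * h1 (p w)"] eqZ[OF V, of \<psi> "\<lambda>w. h' (p w) * h2 (p w)"] e pV by auto
        then show ?thesis using co toZ[OF V(1,2) hh(1)] unfolding germ_coprime_def by blast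
      qed
      show "h1 ?x0 \<noteq> 0 \<or> h2 ?x0 \<noteq> 0" if V: "open V" "?x0 \<in> V" "V \<subseteq> ?C" and hh:
          "cvec_holomorphic h1 V" "cvec_holomorphic h2 V"
          and e: "\<And>x. x \<in> V \<Longrightarrow> g (q x) = h1 x * h2 x" for V h1 h2
      proof -
        have pV: "p (q x) = x" if "x \<in> V" for x using that V(3) CB pq by blast
        have "germ_eq Z z g (\<lambda>w. h1 (p w) * h2 (p w))" by (rule eqZ[OF V]) (simp add: e pV)
        then show ?thesis using ir toZ[OF V(1,2) hh(1)] toZ[OF V(1,2) hh(2)]
          unfolding germ_irreducible_def by blast
      qed
      show "\<psi> (q x) = g (q x) ^ k * h (q x)" if "x \<in> ?C" for x
        using X6(5) that sub by blast
      show False if V: "open V" "?x0 \<in> V" "V \<subseteq> ?C" and hh: "cvec_holomorphic h' V"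
          and e: "\<And>x. x \<in> V \<Longrightarrow> \<psi> (q x) = g (q x) ^ Suc k * h' x" for V h'
      proof -
        have pV: "p (q x) = x" if "x \<in> V" for x using that V(3) CB pq by blast
        have "germ_eq Z z \<psi> (\<lambda>w. g w ^ Suc k * h' (p w))"
          by (rule eqZ[OF V]) (simp add: e pV del: power_Suc)
        then show False using ndv toZ[OF V(1,2) hh] unfolding germ_dvd_def by blast
      qed
    qed
  qed
  have "polar_order Z p f P z = -1"
    unfolding polar_order_def
  proof (rule the_equality)
    show "\<exists>\<phi> \<psi> g k. local_quotient Z p f P z \<phi> \<psi> \<and> germ_coprime Z p z \<phi> \<psi> \<and>
     germ_irreducible Z p z g \<and> (\<exists>W. nbhd_in Z z W \<and> {w \<in> W. g w = 0} = P \<inter> W) \<and>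
     germ_dvd Z p z (\<lambda>w. g w ^ k) \<psi> \<and> \<not> germ_dvd Z p z (\<lambda>w. g w ^ Suc k) \<psi> \<and>
     - 1 = - int k"
      using order_exists
      by (intro exI[of _ "\<lambda>w. N (p w)"] exI[of _ "\<lambda>w. L (p w)"] exI[of _ "1::nat"]) (simp only: of_nat_1 simp_thms)
  next
    fix m :: int
    assume "\<exists>\<phi> \<psi> g k. local_quotient Z p f P z \<phi> \<psi> \<and> germ_coprime Z p z \<phi> \<psi> \<and>
     germ_irreducible Z p z g \<and> (\<exists>W. nbhd_in Z z W \<and> {w \<in> W. g w = 0} = P \<inter> W) \<and>
     germ_dvd Z p z (\<lambda>w. g w ^ k) \<psi> \<and> \<not> germ_dvd Z p z (\<lambda>w. g w ^ Suc k) \<psi> \<and>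
     m = - int k"
    then obtain \<phi> \<psi> g k where k: "local_quotient Z p f P z \<phi> \<psi>" "germ_coprime Z p z \<phi> \<psi>"
     "germ_irreducible Z p z g" "\<exists>W. nbhd_in Z z W \<and> {w \<in> W. g w = 0} = P \<inter> W"
     "germ_dvd Z p z (\<lambda>w. g w ^ k) \<psi>" "\<not> germ_dvd Z p z (\<lambda>w. g w ^ Suc k) \<psi>" "m = - int k"
      by blast
    then have "k = 1" by (intro order_unique[OF k(1-6)])
    then show "m = -1" using k(7) by simp
  qed
  with reg show ?thesis by blast
qed

section \<open>Polar loci of the symmetric functions\<close>

text \<open>
  The residues \<open>\<beta>\<^sub>m\<close> as functions of the symmetric functions \<open>e 1, \<dots>, e n\<close>; the value \<open>e 0\<close> is replaced by \<open>1\<close>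
  to make the polynomial monic.
\<close>

definition residue_of_syms :: "complex ^ 'n \<Rightarrow> (nat \<Rightarrow> complex) \<Rightarrow> 'n + bool \<Rightarrow> complex" where
  "residue_of_syms a e = node_residue (sing_pt a) (signed_poly CARD('n) (e(0 := 1)))"

text \<open>
  The inverse map, extended linearly to arbitrary \<open>y\<close>: for \<open>y = L \<beta>\<close> it yields \<open>L e i\<close>, which is the
  numerator belonging to the denominator \<open>L\<close>.
\<close>

definition sym_of_residues :: "complex ^ 'n \<Rightarrow> ('n + bool \<Rightarrow> complex) \<Rightarrow> nat \<Rightarrow> complex" where
  "sym_of_residues a y i =
     (\<Sum>m\<in>UNIV. (- 1) ^ i * y m * coeff (node_poly (sing_pt a) (UNIV - {m})) (CARD('n) - i))"

lemma inj_sing_pt: "a \<in> garnier_base \<Longrightarrow> inj (sing_pt a)"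
  using sing_pt_inj by (auto simp: inj_on_def)

text \<open>
  The first relation is the vanishing of the coefficient of degree \<open>n + 1\<close> of the polynomial \<open>q\<close>, the second says that \<open>q\<close>
  is monic of degree \<open>n\<close>, read off from \<open>x q(x)\<close>.
\<close>

lemma sum_residue_of_syms:
  fixes a :: "complex ^ 'n"
  assumes a: "a \<in> garnier_base"
  shows "(\<Sum>m\<in>UNIV. residue_of_syms a e m) = 0"
    and "(\<Sum>m\<in>UNIV. sing_pt a m * residue_of_syms a e m) = 1"
proof -
  let ?n = "CARD('n)"
  let ?q = "signed_poly ?n (e(0 := 1))"
  have deg: "degree ?q \<le> ?n" by (rule degree_signed_poly)
  show "(\<Sum>m\<in>UNIV. residue_of_syms a e m) = 0"
    unfolding residue_of_syms_def using sum_node_residue[OF inj_sing_pt[OF a], of ?q] deg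
    by (simp add: coeff_eq_0)
  have "node_residue (sing_pt a) (pCons 0 ?q) m = sing_pt a m * residue_of_syms a e m" for m
    by (simp add: residue_of_syms_def node_residue_def)
  then have "(\<Sum>m\<in>UNIV. sing_pt a m * residue_of_syms a e m) = (\<Sum>m\<in>UNIV. node_residue (sing_pt a) (pCons 0 ?q) m)"
    by simp
  also have "\<dots> = coeff (pCons 0 ?q) (?n + 1)"
    using sum_node_residue[OF inj_sing_pt[OF a], of "pCons 0 ?q"] deg
    by (simp add: degree_pCons_eq_if del: degree_pCons_eq)
  also have "\<dots> = 1" using coeff_signed_poly[of 0 ?n "e(0 := 1)"] by simp
  finally show "(\<Sum>m\<in>UNIV. sing_pt a m * residue_of_syms a e m) = 1" .
qed

lemma sym_of_residue_of_syms:
  fixes a :: "complex ^ 'n"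
  assumes a: "a \<in> garnier_base" and i: "i \<in> {1..CARD('n)}"
  shows "sym_of_residues a (residue_of_syms a e) i = e i"
proof -
  let ?n = "CARD('n)"
  let ?q = "signed_poly ?n (e(0 := 1))"
  have "degree ?q < CARD('n + bool)" using degree_signed_poly[of ?n "e(0 := 1)"] by simp
  from lagrange_interpolation[OF inj_sing_pt[OF a] this]
  have "coeff ?q (?n - i) = (\<Sum>m\<in>UNIV. residue_of_syms a e m * coeff (node_poly (sing_pt a) (UNIV - {m})) (?n - i))"
    unfolding residue_of_syms_def by (metis (no_types, lifting) coeff_smult coeff_sum sum.cong)
  moreover have "coeff ?q (?n - i) = (- 1) ^ i * e i" using coeff_signed_poly[of i ?n "e(0 := 1)"] i by simp
  ultimately have "(- 1) ^ i * ((- 1) ^ i * e i) = sym_of_residues a (residue_of_syms a e) i"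
    by (simp add: sym_of_residues_def sum_distrib_left mult.assoc)
  moreover have "(- 1 :: complex) ^ i * (- 1) ^ i = 1" by (simp flip: power_mult_distrib)
  ultimately show ?thesis by (metis mult.assoc mult_1)
qed

lemma sym_of_residues_scale: "sym_of_residues a (\<lambda>m. t * y m) i = t * sym_of_residues a y i"
  by (simp add: sym_of_residues_def sum_distrib_left ac_simps)

lemma residue_of_syms_elem_sym:
  fixes a u :: "complex ^ 'n"
  assumes "\<And>i. i \<in> {1..CARD('n)} \<Longrightarrow> e i = elem_sym i u"
  shows "residue_of_syms a e = node_residue (sing_pt a) (node_poly (\<lambda>k. u $ k) UNIV)"
proof -
  have "signed_poly CARD('n) (e(0 := 1)) = signed_poly CARD('n) (\<lambda>i. elem_sym i u)"
    unfolding signed_poly_def by (rule sum.cong) (use assms in auto)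
  then show ?thesis by (simp add: residue_of_syms_def signed_poly_elem_sym)
qed

lemma hol_coeff_node_poly:
  assumes "finite M"
  shows "cvec_holomorphic (\<lambda>a. coeff (node_poly (sing_pt a) M) k) S"
  using assms
proof (induction M arbitrary: k rule: finite_induct)
  case empty
  show ?case by (simp add: node_poly_def hol_const)
next
  case (insert l M)
  have "coeff (node_poly (sing_pt a) (insert l M)) k =
      (if k = 0 then 0 else coeff (node_poly (sing_pt a) M) (k - 1)) - sing_pt a l * coeff (node_poly (sing_pt a) M) k" for a
    using insert.hyps by (cases k) (simp_all add: node_poly_insert)
  then show ?case
    by (cases "k = 0") (auto intro!: hol_intros hol_sing_pt insert.IH)
qed

lemma hol_sym_of_residues:
  assumes "\<And>m. cvec_holomorphic (y m) S"
  shows "cvec_holomorphic (\<lambda>a. sym_of_residues a (\<lambda>m. y m a) i) S"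
  unfolding sym_of_residues_def
  by (intro hol_intros hol_coeff_node_poly assms) simp

lemma hol_residue_of_syms:
  fixes e :: "nat \<Rightarrow> complex ^ 'n \<Rightarrow> complex"
  assumes S: "S \<subseteq> garnier_base" and e: "\<And>i. i \<in> {1..CARD('n)} \<Longrightarrow> cvec_holomorphic (e i) S"
  shows "cvec_holomorphic (\<lambda>a. residue_of_syms a (\<lambda>i. e i a) m) S"
  unfolding residue_of_syms_def node_residue_def poly_signed_poly
proof (intro hol_intros hol_sing_pt)
  show "cvec_holomorphic (\<lambda>a. ((\<lambda>i. e i a)(0 := 1)) i) S" if "i \<in> {..CARD('n)}" for i
    using e[of i] that by (cases "i = 0") (auto intro: hol_const)
  show "(\<Prod>l\<in>UNIV - {m}. sing_pt a m - sing_pt a l) \<noteq> 0" if "a \<in> S" for a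
    using sing_pt_inj[of a] S that by auto
qed

text \<open>
  Near any point the finitely many meromorphic functions are holomorphic off the zeros of a single function
  \<open>\<psi>\<close>, the product of local denominators: where a denominator does not vanish, the quotient extends the
  function, so there is no pole.
\<close>

lemma common_denominator:
  fixes p :: "'z::topological_space \<Rightarrow> complex ^ 'n"
  assumes c: "ball_chart Z p z r q" and z: "z \<in> Z" and fin: "finite I"
    and mero: "\<And>i. i \<in> I \<Longrightarrow> meromorphic_with_polar_locus Z p (F i) (P i)"
  shows "\<exists>s \<psi> x. 0 < s \<and> s \<le> r \<and> cvec_holomorphic \<psi> (ball (p z) s) \<and> x \<in> ball (p z) s \<and> \<psi> x \<noteq> 0 \<and>
     (\<forall>x\<in>ball (p z) s. \<psi> x \<noteq> 0 \<longrightarrow> (\<forall>i\<in>I. q x \<notin> P i))"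
  using fin mero
proof (induction I rule: finite_induct)
  case empty
  show ?case
    using ball_chartD(1)[OF c] by (intro exI[of _ r] exI[of _ "\<lambda>x. 1"] exI[of _ "p z"]) (auto intro: hol_const)
next
  case (insert i I)
  obtain s \<psi> x where s: "0 < s" "s \<le> r" and \<psi>: "cvec_holomorphic \<psi> (ball (p z) s)" "x \<in> ball (p z) s" "\<psi> x \<noteq> 0"
    and off: "\<And>x. x \<in> ball (p z) s \<Longrightarrow> \<psi> x \<noteq> 0 \<Longrightarrow> \<forall>i\<in>I. q x \<notin> P i"
    using insert.IH insert.prems by auto
  have m: "meromorphic_with_polar_locus Z p (F i) (P i)" using insert.prems by simp
  have closed: "closedin (top_of_set Z) (P i)" using m by (simp add: meromorphic_with_polar_locus_def)
  have "\<exists>X \<eta>. open X \<and> p z \<in> X \<and> X \<subseteq> ball (p z) r \<and> cvec_holomorphic \<eta> X \<and>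
      (\<forall>e. e > 0 \<and> ball (p z) e \<subseteq> X \<longrightarrow> (\<exists>x\<in>ball (p z) e. \<eta> x \<noteq> 0)) \<and> (\<forall>x\<in>X. \<eta> x \<noteq> 0 \<longrightarrow> q x \<notin> P i)"
  proof (cases "z \<in> P i")
    case False
    have "openin (top_of_set Z) (Z - P i)" using closed by (simp add: openin_diff)
    from ball_chart_preimage_open[OF c this] have "open {x \<in> ball (p z) r. q x \<in> Z - P i}" .
    moreover have "p z \<in> {x \<in> ball (p z) r. q x \<in> Z - P i}"
      using False z ball_chartD(1,2)[OF c] by simp
    moreover have "\<exists>x\<in>ball (p z) e. (1 :: complex) \<noteq> 0" if "e > 0" for e
      using that by (intro bexI[of _ "p z"]) auto
    ultimately show ?thesis
      by (intro exI[of _ "{x \<in> ball (p z) r. q x \<in> Z - P i}"] exI[of _ "\<lambda>x. 1"])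
         (simp add: hol_const subset_eq)
  next
    case True
    then obtain \<phi> \<eta> where lq: "local_quotient Z p (F i) (P i) z \<phi> \<eta>"
      using m by (auto simp: meromorphic_with_polar_locus_def)
    then have germs: "hol_germ Z p z \<phi>" "hol_germ Z p z \<eta>" "\<not> germ_eq Z z \<eta> (\<lambda>_. 0)"
      "\<exists>W. nbhd_in Z z W \<and> (\<forall>w\<in>W. w \<notin> P i \<longrightarrow> \<eta> w \<noteq> 0 \<longrightarrow> F i w = \<phi> w / \<eta> w)"
      unfolding local_quotient_def by auto
    obtain X1 where X1: "open X1" "p z \<in> X1" "X1 \<subseteq> ball (p z) r" "cvec_holomorphic (\<lambda>x. \<phi> (q x)) X1"
      using germs(1) unfolding hol_germ_iff[OF c] by blast
    obtain X2 where X2: "open X2" "p z \<in> X2" "X2 \<subseteq> ball (p z) r" "cvec_holomorphic (\<lambda>x. \<eta> (q x)) X2"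
      using germs(2) unfolding hol_germ_iff[OF c] by blast
    obtain X3 where X3: "open X3" "p z \<in> X3" "X3 \<subseteq> ball (p z) r"
      "\<forall>x\<in>X3. q x \<notin> P i \<longrightarrow> \<eta> (q x) \<noteq> 0 \<longrightarrow> F i (q x) = \<phi> (q x) / \<eta> (q x)"
      using germs(4) unfolding nbhd_iff[OF c] by blast
    let ?X = "X1 \<inter> X2 \<inter> X3"
    have \<phi>X: "cvec_holomorphic (\<lambda>x. \<phi> (q x)) ?X" by (rule hol_subset[OF X1(4)]) auto
    have \<eta>X: "cvec_holomorphic (\<lambda>x. \<eta> (q x)) ?X" by (rule hol_subset[OF X2(4)]) auto
    have oX: "open ?X" "p z \<in> ?X" "?X \<subseteq> ball (p z) r" using X1 X2 X3 by auto
    have "\<exists>x\<in>ball (p z) e. \<eta> (q x) \<noteq> 0" if "e > 0" "ball (p z) e \<subseteq> ?X" for e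
    proof (rule ccontr)
      assume "\<not> ?thesis"
      then have "germ_eq Z z \<eta> (\<lambda>_. 0)"
        unfolding germ_eq_def nbhd_iff[OF c] using that oX(3) by (intro exI[of _ "ball (p z) e"]) auto
      then show False using germs(3) by blast
    qed
    moreover have "q x \<notin> P i" if x: "x \<in> ?X" "\<eta> (q x) \<noteq> 0" for x
    proof
      assume xP: "q x \<in> P i"
      let ?Y = "{x \<in> ?X. \<eta> (q x) \<noteq> 0}"
      have "hol_extends Z p (F i) (P i) (q x)"
      proof (rule hol_extendsI[OF c, of ?Y])
        show "open ?Y" by (rule open_nonzero_set[OF oX(1) \<eta>X])
        show "cvec_holomorphic (\<lambda>x. \<phi> (q x) / \<eta> (q x)) ?Y"
          by (intro hol_divide hol_subset[OF \<phi>X] hol_subset[OF \<eta>X]) auto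
      qed (use x oX(3) X3(4) in auto)
      then show False
        using m xP unfolding meromorphic_with_polar_locus_def hol_extends_def by blast
    qed
    ultimately show ?thesis
      using oX \<eta>X by (intro exI[of _ ?X] exI[of _ "\<lambda>x. \<eta> (q x)"]) blast
  qed
  then obtain X \<eta> where X: "open X" "p z \<in> X" "X \<subseteq> ball (p z) r" "cvec_holomorphic \<eta> X"
    and nzX: "\<And>e. e > 0 \<Longrightarrow> ball (p z) e \<subseteq> X \<Longrightarrow> \<exists>x\<in>ball (p z) e. \<eta> x \<noteq> 0"
    and offX: "\<And>x. x \<in> X \<Longrightarrow> \<eta> x \<noteq> 0 \<Longrightarrow> q x \<notin> P i"
    by blast
  obtain t0 where "t0 > 0" "ball (p z) t0 \<subseteq> X" using X open_contains_ball by blast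
  define t where "t = min t0 s"
  have t: "t > 0" "t \<le> s" "ball (p z) t \<subseteq> X"
    using \<open>t0 > 0\<close> \<open>ball (p z) t0 \<subseteq> X\<close> s by (auto simp: t_def)
  have sub: "ball (p z) t \<subseteq> ball (p z) s" using t by auto
  obtain x1 where x1: "x1 \<in> ball (p z) t" "\<eta> x1 \<noteq> 0" using nzX[OF t(1,3)] by blast
  have \<eta>t: "cvec_holomorphic \<eta> (ball (p z) t)" by (rule hol_subset[OF X(4) t(3)])
  have \<psi>t: "cvec_holomorphic \<psi> (ball (p z) t)" by (rule hol_subset[OF \<psi>(1) sub])
  have "\<exists>x\<in>ball (p z) t. \<psi> x * \<eta> x \<noteq> 0"
  proof (rule ccontr)
    assume no: "\<not> ?thesis"
    have "\<psi> x = 0" if "x \<in> ball (p z) t" for x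
      by (rule hol_integral_domain[OF convex_ball open_ball \<psi>t \<eta>t _ x1 that]) (use no in auto)
    then show False
      using nonzero_on_subball[OF convex_ball open_ball \<psi> sub t(1)] by metis
  qed
  then obtain x2 where x2: "x2 \<in> ball (p z) t" "\<psi> x2 * \<eta> x2 \<noteq> 0" by blast
  show ?case
  proof (intro exI conjI)
    show "0 < t" "t \<le> r" using t s by auto
    show "cvec_holomorphic (\<lambda>x. \<psi> x * \<eta> x) (ball (p z) t)" by (intro hol_mult \<psi>t \<eta>t)
    show "\<forall>x\<in>ball (p z) t. \<psi> x * \<eta> x \<noteq> 0 \<longrightarrow> (\<forall>i\<in>insert i I. q x \<notin> P i)"
      using off offX sub t(3) by auto
  qed (use x2 in auto)
qed

definition riccati_at ::
    "('n + bool \<Rightarrow> complex) \<Rightarrow> ('n + bool \<Rightarrow> complex ^ 'n \<Rightarrow> complex) \<Rightarrow> complex ^ 'n \<Rightarrow> bool" where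
  "riccati_at \<theta> G x \<longleftrightarrow> (\<forall>j i. i \<noteq> Inl j \<longrightarrow> partial_deriv j (G i) x =
     residue_flow \<theta> j x (\<lambda>m. G m x) i - (1 - (\<Sum>m\<in>UNIV. \<theta> m)) * G i x * G (Inl j) x)"

lemma riccati_at_cong:
  assumes "open X" "x \<in> X" "\<And>m y. y \<in> X \<Longrightarrow> G m y = G' m y"
  shows "riccati_at \<theta> G x \<longleftrightarrow> riccati_at \<theta> G' x"
proof -
  have "partial_deriv j (G i) x = partial_deriv j (G' i) x" for j i
    by (rule partial_deriv_cong[OF assms(1) _ assms(2)]) (rule assms(3))
  moreover have "G m x = G' m x" for m using assms by blast
  ultimately show ?thesis by (simp add: riccati_at_def)
qed

text \<open>
  The defect of each Riccati equation is holomorphic off the zeros of \<open>\<psi>\<close>.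
\<close>

lemma riccati_identity_theorem:
  fixes G :: "'n::finite + bool \<Rightarrow> complex ^ 'n \<Rightarrow> complex"
  assumes U: "convex U" "open U" "U \<subseteq> garnier_base"
    and \<psi>: "cvec_holomorphic \<psi> U" "x1 \<in> U" "\<psi> x1 \<noteq> 0"
    and G: "\<And>m. cvec_holomorphic (G m) {x \<in> U. \<psi> x \<noteq> 0}"
    and W: "open W" "p \<in> W" "W \<subseteq> U" "\<And>x. x \<in> W \<Longrightarrow> \<psi> x \<noteq> 0 \<Longrightarrow> riccati_at \<theta> G x"
    and x: "x \<in> U" "\<psi> x \<noteq> 0"
  shows "riccati_at \<theta> G x"
  unfolding riccati_at_def
proof (intro allI impI)
  fix j i assume i: "i \<noteq> (Inl j :: 'n + bool)"
  let ?D = "{x \<in> U. \<psi> x \<noteq> 0}"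
  have "partial_deriv j (G i) x - (residue_flow \<theta> j x (\<lambda>m. G m x) i - (1 - (\<Sum>m\<in>UNIV. \<theta> m)) * G i x * G (Inl j) x) = 0"
  proof (rule identity_theorem_off_zeros[OF U(1,2) \<psi> _ W(1-3) _ x])
    show "cvec_holomorphic (\<lambda>x. partial_deriv j (G i) x -
        (residue_flow \<theta> j x (\<lambda>m. G m x) i - (1 - (\<Sum>m\<in>UNIV. \<theta> m)) * G i x * G (Inl j) x)) ?D"
      by (intro hol_intros hol_partial_deriv hol_residue_flow
          open_nonzero_set[OF U(2) \<psi>(1)] G) (use U(3) in auto)
    show "partial_deriv j (G i) x - (residue_flow \<theta> j x (\<lambda>m. G m x) i - (1 - (\<Sum>m\<in>UNIV. \<theta> m)) * G i x * G (Inl j) x) = 0"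
      if "x \<in> W" "\<psi> x \<noteq> 0" for x
      using W(4)[OF that] i unfolding riccati_at_def by simp
  qed
  then show "partial_deriv j (G i) x =
     residue_flow \<theta> j x (\<lambda>m. G m x) i - (1 - (\<Sum>m\<in>UNIV. \<theta> m)) * G i x * G (Inl j) x" by simp
qed

text \<open>
  A free homotopy between two constant loops traces a path between their values.
\<close>

lemma simply_connected_imp_connected_space:
  fixes S :: "'a::topological_space set"
  assumes "simply_connected S"
  shows "connected S"
proof (rule path_connected_imp_connected)
  have "path_component S a b" if ab: "a \<in> S" "b \<in> S" for a b
  proof -
    have "homotopic_loops S (\<lambda>t. a) (\<lambda>t. b)"
      by (rule assms[unfolded simply_connected_def, rule_format])
         (use ab in \<open>auto simp: path_def pathstart_def pathfinish_def path_image_def\<close>)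
    from homotopic_loops_imp_path_component_value[OF this, of 0] show ?thesis by simp
  qed
  then show "path_connected S" by (simp add: path_connected_component)
qed

theorem proposition1:
  fixes Z :: "'z::topological_space set"
    and p :: "'z \<Rightarrow> complex ^ 'n"
    and \<theta> :: "'n + bool \<Rightarrow> complex" and \<theta>inf :: complex
    and D :: "(complex ^ 'n) set" and u :: "complex ^ 'n \<Rightarrow> complex ^ 'n"
    and F :: "nat \<Rightarrow> 'z \<Rightarrow> complex" and P :: "nat \<Rightarrow> 'z set" and z0 :: 'z
  assumes cover: "universal_cover Z p garnier_base"
    and theta: "(\<Sum>m\<in>UNIV. \<theta> m) - 1 = \<theta>inf \<or> (\<Sum>m\<in>UNIV. \<theta> m) - 1 = - \<theta>inf"
    and solution: "garnier_solution \<theta> \<theta>inf D u (\<lambda>a. 0)"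
    and base_point: "z0 \<in> Z" "p z0 \<in> D"
    and meromorphic: "\<And>i. i \<in> {1..CARD('n)} \<Longrightarrow> meromorphic_with_polar_locus Z p (F i) (P i)"
    and extends: "\<And>i. i \<in> {1..CARD('n)} \<Longrightarrow>
       \<exists>W. nbhd_in Z z0 W \<and> (\<forall>w\<in>W - P i. F i w = elem_sym i (u (p w)))"
  shows "\<forall>i\<in>{1..CARD('n)}. analytic_submanifold Z p (P i) \<and>
           (\<forall>z. regular_point Z p (P i) z \<longrightarrow> polar_order Z p (F i) (P i) z = -1)"
proof -
  let ?I = "{1..CARD('n)}"
  have cov: "covering_space Z p garnier_base" and sc: "simply_connected Z"
    using cover by (auto simp: universal_cover_def)
  have connZ: "connected Z" by (rule simply_connected_imp_connected_space[OF sc])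
  have kappa: "garnier_kappa \<theta> \<theta>inf = 0" by (rule garnier_kappa_zero[OF theta])
  have closedP: "closedin (top_of_set Z) (P i)" and holF: "cover_holomorphic Z p (F i) (Z - P i)"
    and polar: "\<And>w. w \<in> P i \<Longrightarrow> \<not> hol_extends Z p (F i) (P i) w" if "i \<in> ?I" for i
    using meromorphic[OF that] unfolding meromorphic_with_polar_locus_def hol_extends_def by blast+
  define G where "G q m x = residue_of_syms x (\<lambda>i. F i (q x)) m" for q :: "complex ^ 'n \<Rightarrow> 'z" and m x
  \<comment> \<open>Chart balls on which all \<open>F i\<close> are holomorphic off the zeros of one \<open>\<psi>\<close>.\<close>
  define nice where "nice z s q \<psi> \<longleftrightarrow> ball_chart Z p z s q \<and> cvec_holomorphic \<psi> (ball (p z) s) \<and>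
      (\<exists>x\<in>ball (p z) s. \<psi> x \<noteq> 0) \<and> (\<forall>x\<in>ball (p z) s. \<psi> x \<noteq> 0 \<longrightarrow> (\<forall>i\<in>?I. q x \<notin> P i))" for z s q \<psi>
  have nice_ex: "\<exists>s q \<psi>. nice z s q \<psi>" if z: "z \<in> Z" for z
  proof -
    obtain r q where c: "ball_chart Z p z r q" using ball_chart_exists[OF cov open_garnier_base z] .
    obtain s \<psi> x where s: "0 < s" "s \<le> r" "cvec_holomorphic \<psi> (ball (p z) s)" "x \<in> ball (p z) s" "\<psi> x \<noteq> 0"
      "\<forall>x\<in>ball (p z) s. \<psi> x \<noteq> 0 \<longrightarrow> (\<forall>i\<in>?I. q x \<notin> P i)"
      using common_denominator[OF c z, of ?I F P] meromorphic by auto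
    have "ball_chart Z p z s q" by (rule ball_chart_smaller[OF c s(1,2)])
    then show ?thesis using s unfolding nice_def by blast
  qed
  have nice_off: "q x \<notin> P i" if "nice z s q \<psi>" "x \<in> ball (p z) s" "\<psi> x \<noteq> 0" "i \<in> ?I" for z s q \<psi> x i
    using that unfolding nice_def by meson
  have nice_base: "ball (p z) s \<subseteq> garnier_base" if n: "nice z s q \<psi>" for z s q \<psi>
  proof
    fix x assume x: "x \<in> ball (p z) s"
    have c: "ball_chart Z p z s q" using n by (simp add: nice_def)
    have "p ` Z = garnier_base" using cov by (simp add: covering_space_def)
    then show "x \<in> garnier_base" using ball_chartD(5,6)[OF c x] by (metis image_eqI)
  qed
  have nice_F: "cvec_holomorphic (\<lambda>x. F i (q x)) {x \<in> ball (p z) s. \<psi> x \<noteq> 0}"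
    if n: "nice z s q \<psi>" and i: "i \<in> ?I" for z s q \<psi> i
  proof -
    have c: "ball_chart Z p z s q" and \<psi>: "cvec_holomorphic \<psi> (ball (p z) s)" using n by (auto simp: nice_def)
    show ?thesis
      by (rule cover_holomorphic_chart[OF holF[OF i] c open_nonzero_set[OF open_ball \<psi>]])
         (use n i ball_chartD(6)[OF c] in \<open>auto simp: nice_def\<close>)
  qed
  have nice_G: "cvec_holomorphic (G q m) {x \<in> ball (p z) s. \<psi> x \<noteq> 0}" if n: "nice z s q \<psi>" for z s q \<psi> m
    unfolding G_def by (rule hol_residue_of_syms) (use nice_base[OF n] nice_F[OF n] in auto)
  \<comment> \<open>The Riccati system holds on open sets arbitrarily close to \<open>z\<close>. Stated in this weak form, poles
    at \<open>z\<close> do no harm, and within one nice chart the property spreads from any point to all others.\<close>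
  define R where "R z \<longleftrightarrow> (\<forall>T. nbhd_in Z z T \<longrightarrow>
      (\<exists>z' r' q'. ball_chart Z p z' r' q' \<and> q' ` ball (p z') r' \<subseteq> T \<and>
         (\<forall>x\<in>ball (p z') r'. riccati_at \<theta> (G q') x)))" for z
  have spread: "riccati_at \<theta> (G q) x"
    if n: "nice z s q \<psi>" and w: "w \<in> q ` ball (p z) s" "R w" and x: "x \<in> ball (p z) s" "\<psi> x \<noteq> 0"
    for z s q \<psi> w x
  proof -
    have c: "ball_chart Z p z s q" and \<psi>: "cvec_holomorphic \<psi> (ball (p z) s)" using n by (auto simp: nice_def)
    obtain x1 where x1: "x1 \<in> ball (p z) s" "\<psi> x1 \<noteq> 0" using n by (auto simp: nice_def)
    have "nbhd_in Z w (q ` ball (p z) s)" using w(1) ball_chartD(3)[OF c] by simp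
    then have "\<exists>z' r' q'. ball_chart Z p z' r' q' \<and> q' ` ball (p z') r' \<subseteq> q ` ball (p z) s \<and>
         (\<forall>x\<in>ball (p z') r'. riccati_at \<theta> (G q') x)"
      by (rule w(2)[unfolded R_def, rule_format])
    then obtain z' r' q' where c': "ball_chart Z p z' r' q'" "q' ` ball (p z') r' \<subseteq> q ` ball (p z) s"
      and ric: "\<And>x. x \<in> ball (p z') r' \<Longrightarrow> riccati_at \<theta> (G q') x"
      by (elim exE conjE) (rule that; blast)
    have same: "y \<in> ball (p z) s \<and> q y = q' y" if y: "y \<in> ball (p z') r'" for y
    proof -
      obtain v where v: "v \<in> ball (p z) s" "q' y = q v" using c'(2) y by blast
      then have "v = y" using ball_chartD(5)[OF c] ball_chartD(5)[OF c'(1) y] by metis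
      then show ?thesis using v by simp
    qed
    show ?thesis
    proof (rule riccati_identity_theorem[OF convex_ball open_ball nice_base[OF n] \<psi> x1 nice_G[OF n] open_ball _ _ _ x])
      show "p z' \<in> ball (p z') r'" using ball_chartD(1)[OF c'(1)] by simp
      show "ball (p z') r' \<subseteq> ball (p z) s" using same by blast
      show "riccati_at \<theta> (G q) y" if "y \<in> ball (p z') r'" for y
        using ric[OF that] riccati_at_cong[OF open_ball that, of "G q" "G q'"] same by (simp add: G_def)
    qed
  qed
  have R_of_riccati: "R y"
    if n: "nice z s q \<psi>" and X: "open X" "X \<subseteq> ball (p z) s" and y: "y \<in> q ` X"
      and ric: "\<And>x. x \<in> X \<Longrightarrow> \<psi> x \<noteq> 0 \<Longrightarrow> riccati_at \<theta> (G q) x"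
    for z s q \<psi> y X
    unfolding R_def
  proof (intro allI impI)
    fix T assume T: "nbhd_in Z y T"
    have c: "ball_chart Z p z s q" and \<psi>: "cvec_holomorphic \<psi> (ball (p z) s)" using n by (auto simp: nice_def)
    obtain x1 where x1: "x1 \<in> ball (p z) s" "\<psi> x1 \<noteq> 0" using n by (auto simp: nice_def)
    obtain v where v: "v \<in> X" "y = q v" using y by blast
    define Y where "Y = X \<inter> {x \<in> ball (p z) s. q x \<in> T}"
    have Y: "open Y" "v \<in> Y" "Y \<subseteq> ball (p z) s"
      using ball_chart_preimage_open[OF c, of T] T v X by (auto simp: Y_def)
    obtain x2 where x2: "x2 \<in> Y" "\<psi> x2 \<noteq> 0"
      using identity_theorem[OF convex_ball open_ball \<psi> Y(1,2,3) _ x1(1)] x1(2) by blast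
    have \<psi>Y: "cvec_holomorphic \<psi> Y" by (rule hol_subset[OF \<psi> Y(3)])
    obtain e where e: "e > 0" "ball x2 e \<subseteq> {x \<in> Y. \<psi> x \<noteq> 0}"
      using open_nonzero_set[OF Y(1) \<psi>Y] x2 open_contains_ball by (metis (mono_tags, lifting) mem_Collect_eq)
    have "ball x2 e \<subseteq> ball (p z) s" using e(2) Y(3) by blast
    from ball_chart_sub[OF c this e(1)]
    have "ball_chart Z p (q x2) e q" "p (q x2) = x2" .
    moreover have "q ` ball x2 e \<subseteq> T" using e(2) by (auto simp: Y_def)
    moreover have "\<forall>x\<in>ball x2 e. riccati_at \<theta> (G q) x"
      using e(2) ric by (auto simp: Y_def)
    ultimately show "\<exists>z' r' q'. ball_chart Z p z' r' q' \<and> q' ` ball (p z') r' \<subseteq> T \<and>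
         (\<forall>x\<in>ball (p z') r'. riccati_at \<theta> (G q') x)" by metis
  qed
  have "R z0"
  proof -
    obtain s q \<psi> where n: "nice z0 s q \<psi>" using nice_ex[OF base_point(1)] by blast
    have c: "ball_chart Z p z0 s q" and \<psi>: "cvec_holomorphic \<psi> (ball (p z0) s)" using n by (auto simp: nice_def)
    have openD: "open D" using solution by (simp add: garnier_solution_def)
    obtain W where W: "\<And>i. i \<in> ?I \<Longrightarrow> nbhd_in Z z0 (W i)"
      "\<And>i w. i \<in> ?I \<Longrightarrow> w \<in> W i - P i \<Longrightarrow> F i w = elem_sym i (u (p w))"
      using extends by metis
    define X where "X = D \<inter> ball (p z0) s \<inter> (\<Inter>i\<in>?I. {x \<in> ball (p z0) s. q x \<in> W i})"
    have X: "open X" "X \<subseteq> ball (p z0) s" "p z0 \<in> X"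
    proof -
      show "open X"
        unfolding X_def using ball_chart_preimage_open[OF c] W(1) openD
        by (intro open_Int open_INT ballI) auto
      show "p z0 \<in> X" using base_point(2) ball_chartD(1,2)[OF c] W(1) by (auto simp: X_def)
    qed (auto simp: X_def)
    show ?thesis
    proof (rule R_of_riccati[OF n X(1,2)])
      show "z0 \<in> q ` X" using X(3) ball_chartD(2)[OF c] by (metis image_eqI)
      fix x assume x: "x \<in> X" "\<psi> x \<noteq> 0"
      let ?Y = "{x \<in> X. \<psi> x \<noteq> 0}"
      have Y: "open ?Y" "x \<in> ?Y"
        using open_nonzero_set[OF X(1) hol_subset[OF \<psi> X(2)]] x by auto
      have G_eq: "G q m y = node_residue (sing_pt y) (node_poly (\<lambda>k. u y $ k) UNIV) m" if y: "y \<in> ?Y" for m y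
      proof -
        have "y \<in> ball (p z0) s" using y X(2) by blast
        have "F i (q y) = elem_sym i (u y)" if i: "i \<in> ?I" for i
        proof -
          have "q y \<in> W i" using y i by (simp add: X_def)
          then have "q y \<in> W i - P i"
            using nice_off[OF n \<open>y \<in> ball (p z0) s\<close> _ i] y by simp
          then show ?thesis using W(2)[OF i] ball_chartD(5)[OF c \<open>y \<in> ball (p z0) s\<close>] by simp
        qed
        then show ?thesis unfolding G_def by (subst residue_of_syms_elem_sym) auto
      qed
      have "x \<in> D" using x by (simp add: X_def)
      then have "riccati_at \<theta> (\<lambda>m y. node_residue (sing_pt y) (node_poly (\<lambda>k. u y $ k) UNIV) m) x"
        unfolding riccati_at_def using garnier_riccati[OF kappa solution] by blast
      then show "riccati_at \<theta> (G q) x"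
        by (rule iffD2[OF riccati_at_cong[OF Y G_eq], rotated]) simp
    qed
  qed
  have R: "R z" if z: "z \<in> Z" for z
  proof (rule connected_induction_simple[where P = R, OF connZ base_point(1) z \<open>R z0\<close>])
    fix a assume "a \<in> Z"
    then obtain s q \<psi> where n: "nice a s q \<psi>" using nice_ex by blast
    have c: "ball_chart Z p a s q" using n by (auto simp: nice_def)
    show "\<exists>T. openin (top_of_set Z) T \<and> a \<in> T \<and> (\<forall>x\<in>T. \<forall>y\<in>T. R x \<longrightarrow> R y)"
    proof (intro exI conjI ballI impI)
      show "openin (top_of_set Z) (q ` ball (p a) s)" "a \<in> q ` ball (p a) s"
        using ball_chartD(3,7)[OF c] by auto
      fix x y assume "x \<in> q ` ball (p a) s" "y \<in> q ` ball (p a) s" "R x"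
      then show "R y"
        by (intro R_of_riccati[OF n open_ball order_refl]) (use spread[OF n] in auto)
    qed
  qed
  \<comment> \<open>At a pole, the linear lift provides \<open>F i = N / L\<close>.\<close>
  have key: "regular_point Z p (P i) z \<and> polar_order Z p (F i) (P i) z = -1" if i: "i \<in> ?I" and z: "z \<in> P i" for i z
  proof -
    have zZ: "z \<in> Z" using closedP[OF i] z closedin_imp_subset by blast
    then obtain s q \<psi> where n: "nice z s q \<psi>" using nice_ex by blast
    have c: "ball_chart Z p z s q" and \<psi>: "cvec_holomorphic \<psi> (ball (p z) s)" using n by (auto simp: nice_def)
    obtain x1 where x1: "x1 \<in> ball (p z) s" "\<psi> x1 \<noteq> 0" using n by (auto simp: nice_def)
    have base: "x \<in> garnier_base" if "x \<in> ball (p z) s" for x using nice_base[OF n] that by blast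
    have ric: "riccati_at \<theta> (G q) x" if "x \<in> ball (p z) s" "\<psi> x \<noteq> 0" for x
      using spread[OF n ball_chartD(7)[OF c] R[OF zZ] that] .
    have sum0: "(\<Sum>m\<in>UNIV. G q m x) = 0" and sum1: "(\<Sum>m\<in>UNIV. sing_pt x m * G q m x) = 1"
      if "x \<in> ball (p z) s" for x
      unfolding G_def using sum_residue_of_syms[OF base[OF that]] by auto
    obtain \<rho> L y where \<rho>: "\<rho> > 0" "\<rho> \<le> s" and L: "cvec_holomorphic L (ball (p z) \<rho>)"
      and y: "\<And>m. cvec_holomorphic (y m) (ball (p z) \<rho>)"
      and yLG: "\<And>x m. x \<in> ball (p z) \<rho> \<Longrightarrow> \<psi> x \<noteq> 0 \<Longrightarrow> y m x = L x * G q m x"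
      and grad: "L (p z) = 0 \<Longrightarrow> \<exists>j. partial_deriv j L (p z) \<noteq> 0"
    proof (rule riccati_linearization[OF ball_chartD(1)[OF c] nice_base[OF n] \<psi> x1 nice_G[OF n],
          where \<theta> = \<theta> and c = "1 - (\<Sum>m\<in>UNIV. \<theta> m)"])
      show "partial_deriv j (G q k) x = residue_flow \<theta> j x (\<lambda>m. G q m x) k
          - (1 - (\<Sum>m\<in>UNIV. \<theta> m)) * G q k x * G q (Inl j) x"
        if "x \<in> ball (p z) s" "\<psi> x \<noteq> 0" "k \<noteq> Inl j" for x j k
        using ric[OF that(1,2)] that(3) unfolding riccati_at_def by blast
    qed (use sum0 sum1 in auto)
    have c\<rho>: "ball_chart Z p z \<rho> q" by (rule ball_chart_smaller[OF c \<rho>])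
    have sub: "ball (p z) \<rho> \<subseteq> ball (p z) s" using \<rho> by auto
    define N where "N x = sym_of_residues x (\<lambda>m. y m x) i" for x
    have N: "cvec_holomorphic N (ball (p z) \<rho>)"
      unfolding N_def by (rule hol_sym_of_residues[OF y])
    have FLN: "F i (q x) * L x - N x = 0" if x: "x \<in> ball (p z) \<rho>" "\<psi> x \<noteq> 0" for x
    proof -
      have "N x = L x * sym_of_residues x (\<lambda>m. G q m x) i"
        unfolding N_def yLG[OF x] by (rule sym_of_residues_scale)
      also have "(\<lambda>m. G q m x) = residue_of_syms x (\<lambda>i. F i (q x))" by (simp add: G_def fun_eq_iff)
      also have "sym_of_residues x \<dots> i = F i (q x)"
        using sym_of_residue_of_syms[OF base i, of x "\<lambda>i. F i (q x)"] x sub by blast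
      finally show ?thesis by simp
    qed
    have FLN': "F i (q x) * L x = N x" if x: "x \<in> ball (p z) \<rho>" "q x \<notin> P i" for x
    proof -
      let ?Y = "{x \<in> ball (p z) \<rho>. q x \<in> Z - P i}"
      have "openin (top_of_set Z) (Z - P i)" using closedP[OF i] by (simp add: openin_diff)
      then have oY: "open ?Y" by (rule ball_chart_preimage_open[OF c\<rho>])
      have "x \<in> ?Y" using x ball_chartD(6)[OF c\<rho>] by blast
      then obtain e where e: "e > 0" "ball x e \<subseteq> ?Y" using oY open_contains_ball by blast
      have FY: "cvec_holomorphic (\<lambda>x. F i (q x)) ?Y"
        by (rule cover_holomorphic_chart[OF holF[OF i] c\<rho> oY]) auto
      have eB: "ball x e \<subseteq> ball (p z) \<rho>" using e(2) by blast
      have \<psi>e: "cvec_holomorphic \<psi> (ball x e)" using hol_subset[OF \<psi>] eB sub by blast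
      obtain x2 where x2: "x2 \<in> ball x e" "\<psi> x2 \<noteq> 0"
        by (rule nonzero_on_subball[OF convex_ball open_ball \<psi> x1, of x e]) (use e(1) eB sub in auto)
      have "F i (q x) * L x - N x = 0"
      proof (rule hol_integral_domain[OF convex_ball open_ball _ \<psi>e _ x2])
        show "cvec_holomorphic (\<lambda>x. F i (q x) * L x - N x) (ball x e)"
          by (intro hol_diff hol_mult hol_subset[OF FY e(2)]
              hol_subset[OF L eB] hol_subset[OF N eB])
        show "(F i (q v) * L v - N v) * \<psi> v = 0" if "v \<in> ball x e" for v
          using FLN[of v] eB that by (cases "\<psi> v = 0") auto
      qed (use e in simp)
      then show ?thesis by simp
    qed
    show ?thesis
      by (rule polar_divisor_smooth_order_one[OF c\<rho> L N grad closedP[OF i] holF[OF i] FLN' z polar[OF i]])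
  qed
  show ?thesis
  proof (intro ballI conjI allI impI)
    fix i assume i: "i \<in> ?I"
    show "analytic_submanifold Z p (P i)"
      unfolding analytic_submanifold_def using closedP[OF i] key[OF i] by blast
    show "polar_order Z p (F i) (P i) z = -1" if "regular_point Z p (P i) z" for z
      using key[OF i] that unfolding regular_point_def by blast
  qed
qed

end
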